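(* Assume $\sum_{i=1}^k\mu_i<\Lambda_{N,s}$ and let $(w_n)\subset X$ satisfy $w_n\rightharpoonup0$ weakly in $X$. Then $$\liminf_{n\to\infty}\Big(Q_{\boldsymbol\mu,\mathbf a}(w_n)-S_*\,\|w_n\|^2_{L^{2_s^*}(\Omega)}\Big)\ge0.$$
   Context: Let $N\in\mathbb N$, $s\in(0,1)$, $N>2s$, $2_s^*=\frac{2N}{N-2s}$. For measurable $u:\mathbb R^N\to\mathbb R$ put $[u]_s^2=\frac{C_{N,s}}2\iint_{\mathbb R^{2N}}\frac{|u(x)-u(y)|^2}{|x-y|^{N+2s}}dxdy$, with $C_{N,s}=\big(\int_{\mathbb R^N}\frac{1-\cos\zeta_1}{|\zeta|^{N+2s}}d\zeta\big)^{-1}$ (so $[u]_s=\|(-\Delta)^{s/2}u\|_{L^2(\mathbb R^N)}$). $\dot H^s(\mathbb R^N)$ is the completion of $C_c^\infty(\mathbb R^N)$ with respect to $[\cdot]_s$. $\Omega\subset\mathbb R^N$ is a bounded connected open set with smooth boundary; $k\ge1$; $a_1,\dots,a_k\in\Omega$ are distinct points; $\mu_1,\dots,\mu_k\ge0$; $\mathbf a=(a_1,\dots,a_k)$, $\boldsymbol\mu=(\mu_1,\dots,\mu_k)$. $X=\{u\in\dot H^s(\mathbb R^N):u=0\text{ a.e. in }\mathbb R^N\setminus\Omega\}$, a Hilbert space with norm $[\cdot]_s$. $\Lambda_{N,s}=2^{2s}\Gamma(\frac{N+2s}4)^2/\Gamma(\frac{N-2s}4)^2$ (the sharp fractional Hardy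 constant). $Q_{\boldsymbol\mu,\mathbf a}(u)=[u]_s^2-\sum_{i=1}^k\mu_i\int_\Omega\frac{u^2}{|x-a_i|^{2s}}dx$. For $0\le\mu<\Lambda_{N,s}$, $S_\mu=\inf_{u\in\dot H^s(\mathbb R^N)\setminus\{0\}}\frac{[u]_s^2-\mu\int_{\mathbb R^N}|x|^{-2s}u^2dx}{\|u\|^2_{L^{2_s^*}(\mathbb R^N)}}$, $S=S_0$, and $S_*=\min\{S,S_{\mu_1},\dots,S_{\mu_k}\}$. *)

theory Defs
  imports "HOL-Analysis.Analysis"
begin

text \<open>
  The space \<open>\<real>\<^sup>N\<close> is a type \<open>'a\<close> of class \<open>euclidean_space\<close> with \<open>N = DIM('a)\<close>. Functions are
  honest functions; identification almost everywhere is made explicit where it matters.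
\<close>

section \<open>Smooth functions and smooth domains\<close>

fun C_k :: "nat \<Rightarrow> ('a::euclidean_space \<Rightarrow> real) \<Rightarrow> bool" where
  "C_k 0 f \<longleftrightarrow> continuous_on UNIV f"
| "C_k (Suc k) f \<longleftrightarrow> (\<forall>x. f differentiable (at x)) \<and>
     (\<forall>b\<in>Basis. C_k k (\<lambda>x. frechet_derivative f (at x) b))"

definition smooth_fun :: "('a::euclidean_space \<Rightarrow> real) \<Rightarrow> bool" where
  "smooth_fun f \<longleftrightarrow> (\<forall>k. C_k k f)"

definition test_function :: "('a::euclidean_space \<Rightarrow> real) \<Rightarrow> bool" where
  "test_function f \<longleftrightarrow> smooth_fun f \<and> compact (closure {x. f x \<noteq> 0})"

text \<open>
  Near every boundary point the set is the strict epigraph of a smooth function of \<open>N - 1\<close>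
  variables, in suitably rotated coordinates: \<open>e\<close> is the vertical direction, and \<open>\<gamma>\<close> is only
  evaluated on the hyperplane orthogonal to \<open>e\<close>.
\<close>
definition smooth_boundary :: "'a::euclidean_space set \<Rightarrow> bool" where
  "smooth_boundary \<Omega> \<longleftrightarrow> (\<forall>z\<in>frontier \<Omega>. \<exists>r>0. \<exists>e \<gamma>. norm e = 1 \<and> smooth_fun \<gamma> \<and>
     \<Omega> \<inter> ball z r = {y \<in> ball z r. y \<bullet> e > \<gamma> (y - (y \<bullet> e) *\<^sub>R e)})"

section \<open>Constants\<close>

definition crit_exp :: "'a::euclidean_space itself \<Rightarrow> real \<Rightarrow> real" where
  "crit_exp T s = 2 * real DIM('a) / (real DIM('a) - 2 * s)"

text \<open>
  The first coordinate is the one along a chosen basis vector; by symmetry the integral does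
  not depend on the choice.
\<close>
definition C_const :: "'a::euclidean_space itself \<Rightarrow> real \<Rightarrow> real" where
  "C_const T s = inverse (LINT \<zeta>|lebesgue. (1 - cos (\<zeta> \<bullet> (SOME b::'a. b \<in> Basis)))
                             / norm \<zeta> powr (real DIM('a) + 2 * s))"

definition Hardy_const :: "'a::euclidean_space itself \<Rightarrow> real \<Rightarrow> real" where
  "Hardy_const T s = 2 powr (2 * s) * (Gamma ((real DIM('a) + 2 * s) / 4))\<^sup>2
                       / (Gamma ((real DIM('a) - 2 * s) / 4))\<^sup>2"

section \<open>Function spaces\<close>

text \<open>The quantity \<open>[u]\<^sub>s\<^sup>2\<close>, possibly infinite.\<close>
definition ext_energy :: "real \<Rightarrow> ('a::euclidean_space \<Rightarrow> real) \<Rightarrow> ennreal" where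
  "ext_energy s u = ennreal (C_const TYPE('a) s / 2) *
     (\<integral>\<^sup>+p. ennreal (\<bar>u (fst p) - u (snd p)\<bar>\<^sup>2
               / norm (fst p - snd p) powr (real DIM('a) + 2 * s))
        \<partial>(lebesgue \<Otimes>\<^sub>M lebesgue))"

definition energy :: "real \<Rightarrow> ('a::euclidean_space \<Rightarrow> real) \<Rightarrow> real" where
  "energy s u = enn2real (ext_energy s u)"

definition seminorm_s :: "real \<Rightarrow> ('a::euclidean_space \<Rightarrow> real) \<Rightarrow> real" where
  "seminorm_s s u = sqrt (energy s u)"

text \<open>
  The completion of the test functions, realised for \<open>N > 2s\<close> in the usual way as a space of
  measurable functions. A sequence that is Cauchy for \<open>[\<cdot>]\<^sub>s\<close> converges almost everywhere along
  a subsequence, and its class in the completion is identified with the limit function. The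
  almost everywhere convergence fixes the additive constant that \<open>[\<cdot>]\<^sub>s\<close> does not see.
\<close>
definition Hdot :: "real \<Rightarrow> ('a::euclidean_space \<Rightarrow> real) set" where
  "Hdot s = {u. u \<in> borel_measurable lebesgue \<and>
     (\<exists>\<phi>. (\<forall>n. test_function (\<phi> n)) \<and>
          ((\<lambda>n. ext_energy s (\<lambda>x. \<phi> n x - u x)) \<longlongrightarrow> 0) sequentially \<and>
          (AE x in lebesgue. (\<lambda>n::nat. \<phi> n x) \<longlonglongrightarrow> u x))}"

definition X_space :: "real \<Rightarrow> 'a::euclidean_space set \<Rightarrow> ('a \<Rightarrow> real) set" where
  "X_space s \<Omega> = {u \<in> Hdot s. AE x in lebesgue. x \<notin> \<Omega> \<longrightarrow> u x = 0}"

text \<open>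
  Boundedness with respect to \<open>[\<cdot>]\<^sub>s\<close> forces such a functional to respect equality almost
  everywhere, so these are the elements of the dual space.
\<close>
definition X_dual :: "real \<Rightarrow> 'a::euclidean_space set \<Rightarrow> (('a \<Rightarrow> real) \<Rightarrow> real) set" where
  "X_dual s \<Omega> = {F.
     (\<forall>u\<in>X_space s \<Omega>. \<forall>v\<in>X_space s \<Omega>. F (\<lambda>x. u x + v x) = F u + F v) \<and>
     (\<forall>c. \<forall>u\<in>X_space s \<Omega>. F (\<lambda>x. c * u x) = c * F u) \<and>
     (\<exists>B. \<forall>u\<in>X_space s \<Omega>. \<bar>F u\<bar> \<le> B * seminorm_s s u)}"

definition X_weakly_converges ::
  "real \<Rightarrow> 'a::euclidean_space set \<Rightarrow> (nat \<Rightarrow> 'a \<Rightarrow> real) \<Rightarrow> ('a \<Rightarrow> real) \<Rightarrow> bool" where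
  "X_weakly_converges s \<Omega> w u \<longleftrightarrow>
     (\<forall>n. w n \<in> X_space s \<Omega>) \<and> u \<in> X_space s \<Omega> \<and> (\<forall>F\<in>X_dual s \<Omega>. (\<lambda>n. F (w n)) \<longlonglongrightarrow> F u)"

definition Lp_norm :: "real \<Rightarrow> 'a::euclidean_space set \<Rightarrow> ('a \<Rightarrow> real) \<Rightarrow> real" where
  "Lp_norm p A u = (LINT x:A|lebesgue. \<bar>u x\<bar> powr p) powr (1 / p)"

section \<open>The quadratic form and the Hardy--Sobolev constants\<close>

definition Hardy_term ::
  "real \<Rightarrow> 'a::euclidean_space \<Rightarrow> 'a set \<Rightarrow> ('a \<Rightarrow> real) \<Rightarrow> real" where
  "Hardy_term s a A u = (LINT x:A|lebesgue. (u x)\<^sup>2 / norm (x - a) powr (2 * s))"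

definition Q_form ::
  "real \<Rightarrow> 'a::euclidean_space set \<Rightarrow> nat \<Rightarrow> (nat \<Rightarrow> real) \<Rightarrow> (nat \<Rightarrow> 'a) \<Rightarrow> ('a \<Rightarrow> real) \<Rightarrow> real" where
  "Q_form s \<Omega> k \<mu> a u = energy s u - (\<Sum>i=1..k. \<mu> i * Hardy_term s (a i) \<Omega> u)"

definition S_mu :: "'a::euclidean_space itself \<Rightarrow> real \<Rightarrow> real \<Rightarrow> real" where
  "S_mu T s \<mu> = (INF u \<in> {u :: 'a \<Rightarrow> real. u \<in> Hdot s \<and> \<not> (AE x in lebesgue. u x = 0)}.
     (energy s u - \<mu> * Hardy_term s 0 UNIV u) / (Lp_norm (crit_exp TYPE('a) s) UNIV u)\<^sup>2)"

definition S_star :: "'a::euclidean_space itself \<Rightarrow> real \<Rightarrow> nat \<Rightarrow> (nat \<Rightarrow> real) \<Rightarrow> real" where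
  "S_star T s k \<mu> = Min (insert (S_mu TYPE('a) s 0) ((\<lambda>i. S_mu TYPE('a) s (\<mu> i)) ` {1..k}))"

end

theory Submission
  imports Defs "HOL-Probability.Characteristic_Functions"
begin

text \<open>
  With a quadratic partition of unity \<open>\<psi>\<^sub>1, \<dots>, \<psi>\<^sub>k\<close> such that \<open>\<psi>\<^sub>j(a\<^sub>i) = 0\<close> for \<open>i \<noteq> j\<close>, the IMS
  formula bounds the form from below by the sum of the one-pole forms of \<open>\<psi>\<^sub>i w\<close>, up to a multiple of
  \<open>\<parallel>w\<parallel>\<^sub>2\<^sup>2\<close>. Each one-pole form dominates \<open>S\<^sub>\<mu>\<^sub>i \<parallel>\<psi>\<^sub>i w\<parallel>\<^sup>2\<close>, and by Minkowski's inequality in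
  \<open>L\<^sup>p\<^sup>/\<^sup>2\<close> these add up to at least \<open>S\<^sub>* \<parallel>w\<parallel>\<^sup>2\<close>. A weakly null sequence tends to zero in \<open>L\<^sup>2\<close>: it is
  bounded, its ball averages tend to zero pointwise, and \<open>w\<close> differs from its ball averages by a small
  multiple of the energy.

  The infima \<open>S\<^sub>\<mu>\<close> are lower bounds only because the Hardy inequality holds with the sharp constant.
  Writing \<open>|z|\<^sup>-\<^sup>N\<^sup>-\<^sup>2\<^sup>s\<close> as a superposition of Gaussians reduces it to a Schur test with the ground state
  \<open>|x|\<^sup>-\<^sup>(\<^sup>N\<^sup>-\<^sup>2\<^sup>s\<^sup>)\<^sup>/\<^sup>2\<close>, itself a superposition of Gaussians. Cutting off the Gaussian parameter at \<open>M\<close>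
  keeps every term nonnegative and finite, and the sharp constant appears in the limit \<open>M \<rightarrow> \<infinity>\<close>.
\<close>

section \<open>Gamma and Gaussian integrals\<close>

text \<open>The obstacle in the Hardy inequality is that the mass of |z|^(-N-2s) and its convolution
  with the ground state are both infinite, so their difference cannot be formed. Once the Gaussian
  parameter l of the kernel stays below M, the mass is finite. If t is the Gaussian parameter of the
  ground state, the ratio c = t / l separates the variables: the mass is an integral over c of one
  profile, and the convolution is bounded by the integral of the same profile with the weight (1 +
  c)^(-g), where g = (N - 2s)/4. The difference is then taken under the integral, where it is
  nonnegative and increases with M. The inequality is used again as a tool. Elements of
  \<open>Hdot\<close> need not be square integrable, so the commutator of a multiplier with the
  energy is controlled by the Hardy weight; on a bounded set the same weight gives a Poincare
  inequality. Both localization errors are of the order of the squared L^2 norm: the multipliers are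
  bounded and Lipschitz, and a Lipschitz function vanishing at a pole has a square that absorbs the
  singularity |x - a|^(-2s), as s < 1.\<close>

lemma nn_integral_half_line_scale:
  fixes f :: "real \<Rightarrow> ennreal"
  assumes [measurable]: "f \<in> borel_measurable borel" and c: "c > 0"
  shows "(\<integral>\<^sup>+x\<in>{0<..}. f x \<partial>lborel) = ennreal c * (\<integral>\<^sup>+x\<in>{0<..}. f (c * x) \<partial>lborel)"
proof -
  have "(\<integral>\<^sup>+x\<in>{0<..}. f x \<partial>lborel)
        = ennreal c * (\<integral>\<^sup>+x. f (0 + c * x) * indicator {0<..} (0 + c * x) \<partial>lborel)"
    using c by (subst nn_integral_real_affine[where c=c and t=0]) auto
  also have "(\<integral>\<^sup>+x. f (0 + c * x) * indicator {0<..} (0 + c * x) \<partial>lborel)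
     = (\<integral>\<^sup>+x\<in>{0<..}. f (c * x) \<partial>lborel)"
    using c by (intro nn_integral_cong) (auto simp: indicator_def zero_less_mult_iff)
  finally show ?thesis .
qed

text \<open>Read from right to left, this writes a negative power of \<open>r\<close> as a
  superposition of exponentials. With \<open>r\<close> a multiple of a squared norm it produces the
  Gaussian mixtures used below.\<close>

lemma nn_integral_Gamma_scaled:
  assumes b: "b > 0" and r: "r > 0"
  shows "(\<integral>\<^sup>+x\<in>{0<..}. ennreal (x powr (b - 1) * exp (- (r * x))) \<partial>lborel)
         = ennreal (Gamma b * r powr (- b))"
proof -
  have G: "(\<integral>\<^sup>+x\<in>{0<..}. ennreal (x powr (b - 1) * exp (- x)) \<partial>lborel) = ennreal (Gamma b)"
    unfolding Gamma_conv_nn_integral_real[OF b]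
    by (intro nn_integral_cong) (auto simp: indicator_def exp_minus field_simps)
  have E: "(1/r * x) powr (b - 1) * exp (- (r * (1/r * x))) = r powr (1 - b) * (x powr (b - 1) * exp (- x))" for x
    using r powr_minus_divide[of r "b - 1"] by (simp add: powr_divide)
  have "(\<integral>\<^sup>+x\<in>{0<..}. ennreal (x powr (b - 1) * exp (- (r * x))) \<partial>lborel)
      = ennreal (1/r) * (\<integral>\<^sup>+x\<in>{0<..}. ennreal ((1/r * x) powr (b - 1) * exp (- (r * (1/r * x)))) \<partial>lborel)"
    by (rule nn_integral_half_line_scale) (use r in auto)
  also have "\<dots> = ennreal (1/r) * (\<integral>\<^sup>+x. ennreal (r powr (1 - b)) *
       (ennreal (x powr (b - 1) * exp (- x)) * indicator {0<..} x) \<partial>lborel)"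
    unfolding E by (rule arg_cong2[where f="(*)", OF refl], rule nn_integral_cong)
      (simp only: ennreal_mult' powr_ge_zero mult.assoc)
  also have "\<dots> = ennreal (1/r) * (ennreal (r powr (1 - b)) * ennreal (Gamma b))"
    by (subst nn_integral_cmult) (auto simp: G)
  also have "\<dots> = ennreal (Gamma b * r powr (- b))"
    using r b by (auto simp: ennreal_mult'[symmetric] powr_diff powr_minus field_simps)
  finally show ?thesis .
qed

text \<open>The Bernstein representation of \<open>v powr s\<close>. Writing 1 - exp(- v x) as the
  integral of x exp(- t x) over 0 < t < v and exchanging the integrals leaves a Gamma integral in x,
  of order 1 - s > 0, and then t^(s-1), integrable at 0 because s > 0.\<close>

lemma nn_integral_one_minus_exp:
  assumes s: "0 < s" "s < 1" and v: "v > 0"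
  shows "(\<integral>\<^sup>+x\<in>{0<..}. ennreal (x powr (- 1 - s) * (1 - exp (- (v * x)))) \<partial>lborel)
         = ennreal (v powr s * Gamma (1 - s) / s)"
proof -
  have A: "ennreal (1 - exp (- (v * x))) = (\<integral>\<^sup>+t\<in>{0<..v}. ennreal (x * exp (- (t * x))) \<partial>lborel)"
    if "x > 0" for x
  proof -
    have "(\<integral>\<^sup>+t. ennreal (x * exp (- (t * x))) * indicator {0..v} t \<partial>lborel)
        = ennreal (- exp (- (v * x)) - (- exp (- (0 * x))))"
      by (rule nn_integral_FTC_Icc) (use that v in \<open>auto intro!: derivative_eq_intros\<close>)
    also have "(\<integral>\<^sup>+t. ennreal (x * exp (- (t * x))) * indicator {0..v} t \<partial>lborel)
        = (\<integral>\<^sup>+t\<in>{0<..v}. ennreal (x * exp (- (t * x))) \<partial>lborel)"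
      by (intro nn_integral_cong_AE AE_I[where N="{0}"]) (auto simp: indicator_def split: if_splits)
    finally show ?thesis by simp
  qed
  have "(\<integral>\<^sup>+x\<in>{0<..}. ennreal (x powr (- 1 - s) * (1 - exp (- (v * x)))) \<partial>lborel)
      = (\<integral>\<^sup>+x. (\<integral>\<^sup>+t. ennreal (x powr ((1 - s) - 1) * exp (- (t * x))) * indicator {0<..} x * indicator {0<..v} t \<partial>lborel) \<partial>lborel)"
  proof (rule nn_integral_cong)
    fix x :: real
    show "ennreal (x powr (- 1 - s) * (1 - exp (- (v * x)))) * indicator {0<..} x
      = (\<integral>\<^sup>+t. ennreal (x powr ((1 - s) - 1) * exp (- (t * x))) * indicator {0<..} x * indicator {0<..v} t \<partial>lborel)"
    proof (cases "x > 0")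
      case True
      have "ennreal (x powr (- 1 - s) * (1 - exp (- (v * x)))) = ennreal (x powr (-1-s)) * ennreal (1 - exp (- (v * x)))"
        by (rule ennreal_mult') simp
      also have "\<dots> = (\<integral>\<^sup>+t. ennreal (x powr (-1-s)) * (ennreal (x * exp (- (t * x))) * indicator {0<..v} t) \<partial>lborel)"
        unfolding A[OF True] by (subst nn_integral_cmult) auto
      also have "\<dots> = (\<integral>\<^sup>+t. ennreal (x powr ((1 - s) - 1) * exp (- (t * x))) * indicator {0<..} x * indicator {0<..v} t \<partial>lborel)"
        using True by (intro nn_integral_cong)
          (auto simp: indicator_def ennreal_mult'[symmetric] powr_diff powr_minus field_simps)
      finally show ?thesis using True by simp
    qed auto
  qed
  also have "\<dots> = (\<integral>\<^sup>+t. (\<integral>\<^sup>+x. ennreal (x powr ((1 - s) - 1) * exp (- (t * x))) * indicator {0<..} x * indicator {0<..v} t \<partial>lborel) \<partial>lborel)"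
    by (rule lborel_pair.Fubini') measurable
  \<comment> \<open>The interval may be closed at 0 because
    \<open>0 powr (s - 1) = 0\<close>.\<close>
  also have "\<dots> = (\<integral>\<^sup>+t. ennreal (Gamma (1 - s)) * (ennreal (t powr (s - 1)) * indicator {0..v} t) \<partial>lborel)"
  proof (intro nn_integral_cong_AE AE_I2)
    fix t :: real
    have "(\<integral>\<^sup>+x. ennreal (x powr ((1 - s) - 1) * exp (- (t * x))) * indicator {0<..} x \<partial>lborel)
        = ennreal (Gamma (1 - s) * t powr (- (1 - s)))" if "t > 0"
      using s that by (intro nn_integral_Gamma_scaled) auto
    then show "(\<integral>\<^sup>+x. ennreal (x powr ((1 - s) - 1) * exp (- (t * x))) * indicator {0<..} x * indicator {0<..v} t \<partial>lborel)
       = ennreal (Gamma (1 - s)) * (ennreal (t powr (s - 1)) * indicator {0..v} t)"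
      using s by (auto simp: indicator_def ennreal_mult'')
  qed
  also have "\<dots> = ennreal (Gamma (1 - s)) * (\<integral>\<^sup>+t. ennreal (t powr (s - 1)) * indicator {0..v} t \<partial>lborel)"
    by (subst nn_integral_cmult) auto
  also have "(\<integral>\<^sup>+t. ennreal (t powr (s - 1)) * indicator {0..v} t \<partial>lborel) = ennreal (v powr s / s)"
  proof -
    have "((\<lambda>t. t powr (s - 1)) has_integral (v powr (s - 1 + 1) / (s - 1 + 1))) {0..v}"
      using s v by (intro has_integral_powr_from_0) auto
    from nn_integral_has_integral_lebesgue[OF _ this]
    show ?thesis by (simp add: ennreal_mult'[symmetric] ennreal_indicator[symmetric] mult.commute)
  qed
  also have "ennreal (Gamma (1 - s)) * ennreal (v powr s / s) = ennreal (v powr s * Gamma (1 - s) / s)"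
    using s by (simp add: ennreal_mult'[symmetric] mult.commute)
  finally show ?thesis .
qed

lemma nn_integral_gaussian_1:
  assumes r: "r > 0"
  shows "(\<integral>\<^sup>+x. ennreal (exp (- (r * x\<^sup>2))) \<partial>lborel) = ennreal (sqrt (pi / r))" (is ?A)
    and "(\<integral>\<^sup>+x. ennreal ((1 - cos x) * exp (- (r * x\<^sup>2))) \<partial>lborel)
         = ennreal (sqrt (pi / r) * (1 - exp (- (1 / (4 * r)))))" (is ?B)
proof -
  \<comment> \<open>The standard deviation of the normal density proportional to exp(- r
    x^2).\<close>
  define q where "q = 1 / sqrt (2 * r)"
  have q: "q > 0" "q\<^sup>2 = 1 / (2 * r)" using r by (auto simp: q_def power_divide)
  have q': "2 * q\<^sup>2 = 1 / r" "sqrt (2 * pi * q\<^sup>2) = sqrt (pi / r)" using r q by (auto simp: field_simps)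
  have dens: "exp (- (r * x\<^sup>2)) = sqrt (pi / r) * normal_density 0 q x" for x
    using r by (simp add: normal_density_def q' del: real_sqrt_mult)
  have i1: "integrable lborel (normal_density 0 q)" "(\<integral>x. normal_density 0 q x \<partial>lborel) = 1"
    using q by auto
  show ?A
    using i1 r q unfolding dens
    by (subst nn_integral_eq_integral) (auto simp: normal_density_nonneg)
  interpret prob_space std_normal_distribution
    by (rule real_dist_normal_dist[THEN real_distribution.axioms(1)])
  \<comment> \<open>After rescaling to unit variance the cosine integral is the real part of the
    characteristic function at \<open>q\<close>.\<close>
  have "(\<integral>x. cos (q * x) \<partial>std_normal_distribution) = Re (char std_normal_distribution q)"
    unfolding char_def
    by (subst integral_Re[symmetric])
      (auto intro!: integrable_iexp simp: Re_exp)
  also have "\<dots> = exp (- (q\<^sup>2 / 2))"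
    by (simp add: char_std_normal_distribution Re_exp)
  finally have c1: "(\<integral>x. std_normal_density x * cos (q * x) \<partial>lborel) = exp (- (1 / (4 * r)))"
    using q by (subst (asm) integral_density) auto
  have "integrable lborel (\<lambda>x. normal_density 0 q x * cos x)"
    by (rule Bochner_Integration.integrable_bound[OF i1(1)])
      (use q in \<open>auto simp: abs_mult normal_density_nonneg intro!: mult_left_le\<close>)
  then have i2: "integrable lborel (\<lambda>x. sqrt (pi / r) * (normal_density 0 q x - normal_density 0 q x * cos x))"
    using i1 by auto
  have "(\<integral>x. normal_density 0 q x * cos x \<partial>lborel) = q * (\<integral>x. normal_density 0 q (0 + q * x) * cos (0 + q * x) \<partial>lborel)"
    using q lborel_integral_real_affine[of q "\<lambda>x. normal_density 0 q x * cos x" 0] by simp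
  also have "\<dots> = (\<integral>x. q * (normal_density 0 q (0 + q * x) * cos (0 + q * x)) \<partial>lborel)"
    by simp
  also have "\<dots> = (\<integral>x. std_normal_density x * cos (q * x) \<partial>lborel)"
    using q(1) by (intro Bochner_Integration.integral_cong) (auto simp: normal_density_def power_mult_distrib real_sqrt_mult)
  finally have c2: "(\<integral>x. normal_density 0 q x * cos x \<partial>lborel) = exp (- (1 / (4 * r)))"
    using c1 by simp
  have "(\<integral>\<^sup>+x. ennreal ((1 - cos x) * exp (- (r * x\<^sup>2))) \<partial>lborel) =
     (\<integral>\<^sup>+x. ennreal (sqrt (pi / r) * (normal_density 0 q x - normal_density 0 q x * cos x)) \<partial>lborel)"
    unfolding dens by (intro nn_integral_cong) (simp add: algebra_simps)
  also have "\<dots> = ennreal (\<integral>x. sqrt (pi / r) * (normal_density 0 q x - normal_density 0 q x * cos x) \<partial>lborel)"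
    by (rule nn_integral_eq_integral[OF i2])
      (use r in \<open>auto simp: normal_density_nonneg mult_left_le\<close>)
  also have "(\<integral>x. sqrt (pi / r) * (normal_density 0 q x - normal_density 0 q x * cos x) \<partial>lborel)
     = sqrt (pi / r) * (1 - exp (- (1 / (4 * r))))"
    using i1 c2 \<open>integrable lborel (\<lambda>x. normal_density 0 q x * cos x)\<close> by simp
  finally show ?B .
qed

lemma nn_integral_gaussian:
  assumes r: "r > 0"
  shows "(\<integral>\<^sup>+z. ennreal (exp (- (r * (norm (z::'a::euclidean_space))\<^sup>2))) \<partial>lborel)
      = ennreal ((pi / r) powr (real DIM('a) / 2))"
proof -
  have n: "(norm z)\<^sup>2 = (\<Sum>b\<in>Basis. (z \<bullet> b)\<^sup>2)" for z :: 'a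
    by (subst euclidean_inner[of z z, folded power2_norm_eq_inner]) (simp add: power2_eq_square)
  have "(\<integral>\<^sup>+z. ennreal (exp (- (r * (norm (z::'a))\<^sup>2))) \<partial>lborel)
      = (\<integral>\<^sup>+z. (\<Prod>b\<in>Basis. ennreal (exp (- (r * (z \<bullet> (b::'a))\<^sup>2)))) \<partial>lborel)"
    by (intro nn_integral_cong, subst prod_ennreal)
      (auto simp: n sum_distrib_left exp_sum simp flip: sum_negf)
  also have "\<dots> = (\<Prod>b\<in>(Basis::'a set). (\<integral>\<^sup>+x. ennreal (exp (- (r * x\<^sup>2))) \<partial>lborel))"
    by (rule nn_integral_lborel_prod) auto
  also have "\<dots> = ennreal ((pi / r) powr (real DIM('a) / 2))"
    using r by (simp add: nn_integral_gaussian_1 ennreal_power powr_half_sqrt[symmetric]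
       powr_powr flip: powr_realpow)
  finally show ?thesis .
qed

text \<open>Only the coordinate along \<open>e\<close> sees the cosine. The factor 1 - cos is kept
  whole because it is nonnegative, so the extended integral factorises over the coordinates.\<close>

lemma nn_integral_gaussian_cos:
  assumes r: "r > 0" and e: "e \<in> Basis"
  shows "(\<integral>\<^sup>+z. ennreal ((1 - cos ((z::'a::euclidean_space) \<bullet> e)) * exp (- (r * (norm z)\<^sup>2))) \<partial>lborel)
      = ennreal ((pi / r) powr (real DIM('a) / 2) * (1 - exp (- (1 / (4 * r)))))"
proof -
  have n: "(norm z)\<^sup>2 = (\<Sum>b\<in>Basis. (z \<bullet> b)\<^sup>2)" for z :: 'a
    by (subst euclidean_inner[of z z, folded power2_norm_eq_inner]) (simp add: power2_eq_square)
  let ?f = "\<lambda>b x. ennreal ((if b = e then 1 - cos x else 1) * exp (- (r * x\<^sup>2)))"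
  have "(\<integral>\<^sup>+z. ennreal ((1 - cos (z \<bullet> e)) * exp (- (r * (norm z)\<^sup>2))) \<partial>lborel)
      = (\<integral>\<^sup>+z. (\<Prod>b\<in>Basis. ?f b (z \<bullet> b)) \<partial>lborel)"
  proof (intro nn_integral_cong)
    fix z :: 'a
    have "(\<Prod>b\<in>Basis. ?f b (z \<bullet> b))
      = ennreal (\<Prod>b\<in>Basis. (if b = e then 1 - cos (z \<bullet> b) else 1) * exp (- (r * (z \<bullet> b)\<^sup>2)))"
      by (rule prod_ennreal) auto
    also have "(\<Prod>b\<in>Basis. (if b = e then 1 - cos (z \<bullet> b) else 1) * exp (- (r * (z \<bullet> b)\<^sup>2)))
        = (1 - cos (z \<bullet> e)) * exp (- (r * (norm z)\<^sup>2))"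
      using e by (simp add: prod.distrib n exp_sum sum_distrib_left flip: sum_negf)
    finally show "ennreal ((1 - cos (z \<bullet> e)) * exp (- (r * (norm z)\<^sup>2))) = (\<Prod>b\<in>Basis. ?f b (z \<bullet> b))" ..
  qed
  also have "\<dots> = (\<Prod>b\<in>Basis. (\<integral>\<^sup>+x. ?f b x \<partial>lborel))"
    by (rule nn_integral_lborel_prod) (auto intro!: mult_nonneg_nonneg)
  also have "\<dots> = (\<Prod>b\<in>Basis. ennreal (sqrt (pi / r) * (if b = e then 1 - exp (- (1 / (4 * r))) else 1)))"
    using r by (intro prod.cong) (auto simp: nn_integral_gaussian_1)
  also have "\<dots> = ennreal ((pi / r) powr (real DIM('a) / 2) * (1 - exp (- (1 / (4 * r)))))"
    using r e by (subst prod_ennreal) (auto simp: prod.distrib powr_half_sqrt[symmetric]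
       powr_powr simp flip: powr_realpow)
  finally show ?thesis .
qed

section \<open>The Riesz kernel and the normalising constant\<close>

text \<open>The substitution x = 1 / (4 t) turns this into \<open>nn_integral_one_minus_exp\<close>
  with \<open>v = 1\<close>.\<close>

lemma nn_integral_one_minus_exp_inverse:
  assumes s: "0 < s" "s < 1"
  shows "(\<integral>\<^sup>+x\<in>{0<..}. ennreal (x powr (s - 1) * (1 - exp (- (1 / (4 * x))))) \<partial>lborel)
         = ennreal (4 powr (- s) * Gamma (1 - s) / s)"
proof -
  define I where "I = 4 powr (- s) * Gamma (1 - s) / s"
  define f where "f x = x powr (s - 1) * (1 - exp (- (1 / (4 * x))))" for x :: real
  \<comment> \<open>\<open>h\<close> is \<open>f\<close> after the substitution x = 1 / (4 t),
    Jacobian included.\<close>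
  define h where "h x = 4 powr (- s) * (x powr (- 1 - s) * (1 - exp (- (1 * x))))" for x :: real
  have I: "I \<ge> 0" using s by (auto simp: I_def)
  have [measurable]: "h \<in> borel_measurable borel" unfolding h_def[abs_def] by measurable
  have "(\<integral>\<^sup>+x\<in>{0<..}. ennreal (h x) \<partial>lborel)
      = ennreal (4 powr (-s)) * (\<integral>\<^sup>+x\<in>{0<..}. ennreal (x powr (- 1 - s) * (1 - exp (- (1 * x)))) \<partial>lborel)"
    unfolding h_def by (subst nn_integral_cmult[symmetric]) (auto simp: ennreal_mult' mult.assoc)
  also have "\<dots> = ennreal I"
    using s by (subst nn_integral_one_minus_exp) (auto simp: I_def ennreal_mult'[symmetric])
  finally have "(\<integral>\<^sup>+x. ennreal (if x \<in> {0<..} then h x else 0) \<partial>lborel) = ennreal I"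
    by (subst (asm) nn_integral_cong[where v="\<lambda>x. ennreal (if x \<in> {0<..} then h x else 0)"]) auto
  then have "((\<lambda>x. if x \<in> {0<..} then h x else 0) has_integral I) UNIV"
    using I by (intro nn_integral_has_integral) (auto simp: h_def)
  then have hI: "(h has_integral I) {0<..}"
    by (simp only: has_integral_restrict_UNIV)
  then have ha: "h absolutely_integrable_on {0<..}"
    by (intro nonnegative_absolutely_integrable_1) (auto simp: h_def integrable_on_def)
  define g where "g t = 1 / (4 * t)" for t :: real
  have hg: "h t = \<bar>- (1 / (4 * t\<^sup>2))\<bar> * f (g t)" if "t \<in> {0<..}" for t
  proof -
    have t: "t > 0" using that by simp
    have h1: "4 powr (-s) * t powr (-1-s) = (4 * t) powr (- s) / t"
      using t by (simp add: powr_mult powr_diff powr_minus divide_simps)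
    have h2: "(1 / (4 * t)) powr (s - 1) = (4*t) powr (-s) * (4 * t)"
      using t by (simp add: powr_diff powr_divide powr_minus divide_simps)
    have "h t = (4 powr (-s) * t powr (-1-s)) * (1 - exp (- t))" by (simp add: h_def)
    moreover have "f (g t) = (1 / (4 * t)) powr (s - 1) * (1 - exp (- t))"
      using t by (simp add: f_def g_def)
    ultimately show ?thesis
      unfolding h1 h2 using t by (simp add: power2_eq_square)
  qed
  have img: "g ` {0<..} = {0<..}"
  proof (intro equalityI subsetI)
    fix y :: real assume "y \<in> {0<..}"
    then show "y \<in> g ` {0<..}" by (intro image_eqI[of _ _ "1 / (4 * y)"]) (auto simp: g_def)
  qed (auto simp: g_def)
  have "(\<lambda>x. \<bar>- (1 / (4 * x\<^sup>2))\<bar> * f (g x)) absolutely_integrable_on {0<..} \<and>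
        integral {0<..} (\<lambda>x. \<bar>- (1 / (4 * x\<^sup>2))\<bar> * f (g x)) = I \<longleftrightarrow>
      f absolutely_integrable_on (g ` {0<..}) \<and> integral (g ` {0<..}) f = I"
    by (rule has_absolute_integral_change_of_variables_1')
      (auto simp: g_def inj_on_def power2_eq_square intro!: derivative_eq_intros)
  moreover have "(\<lambda>x. \<bar>- (1 / (4 * x\<^sup>2))\<bar> * f (g x)) absolutely_integrable_on {0<..}"
    using ha hg by (subst set_integrable_cong[OF refl refl, of _ _ h]) auto
  moreover have "integral {0<..} (\<lambda>x. \<bar>- (1 / (4 * x\<^sup>2))\<bar> * f (g x)) = integral {0<..} h"
    by (rule Henstock_Kurzweil_Integration.integral_cong) (use hg in auto)
  ultimately have "f absolutely_integrable_on {0<..}" "integral {0<..} f = I"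
    using hI img by (auto simp: integral_unique)
  then have "(f has_integral I) {0<..}"
    using set_lebesgue_integral_eq_integral(1) by blast
  from nn_integral_has_integral_lebesgue[OF _ this]
  show ?thesis
    by (simp add: f_def I_def mult.commute nn_integral_completion ennreal_mult'[symmetric]
       ennreal_indicator[symmetric])
qed

lemma riesz_kernel:
  fixes z :: "'a::euclidean_space"
  assumes s: "0 < s" and z: "z \<noteq> 0"
  shows "(\<integral>\<^sup>+x\<in>{0<..}. ennreal (x powr (real DIM('a) / 2 + s - 1) * exp (- (x * (norm z)\<^sup>2))) \<partial>lborel)
     = ennreal (Gamma (real DIM('a) / 2 + s) / norm z powr (real DIM('a) + 2 * s))"
proof -
  have "(norm z)\<^sup>2 powr (- (real DIM('a) / 2 + s)) = 1 / norm z powr (real DIM('a) + 2 * s)"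
    using z powr_minus_divide[of "norm z" "real DIM('a) + 2 * s"]
    by (simp add: powr_powr distrib_left flip: powr_numeral)
  then show ?thesis
    using nn_integral_Gamma_scaled[of "real DIM('a) / 2 + s" "(norm z)\<^sup>2"] s z
    by (simp add: mult.commute)
qed

text \<open>Once the kernel is replaced by its Gaussian mixture, the z-integral is explicit. The
  factors x^(N/2) cancel, and \<open>nn_integral_one_minus_exp_inverse\<close> evaluates what
  remains in x.\<close>

lemma nn_integral_cos_kernel:
  fixes e :: "'a::euclidean_space"
  assumes s: "0 < s" "s < 1" and e: "e \<in> Basis"
  shows "(\<integral>\<^sup>+z. ennreal ((1 - cos (z \<bullet> e)) / norm z powr (real DIM('a) + 2 * s)) \<partial>lborel)
    = ennreal (pi powr (real DIM('a) / 2) * 4 powr (- s) * Gamma (1 - s) / (s * Gamma (real DIM('a) / 2 + s)))"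
proof -
  let ?N = "real DIM('a)"
  define G where "G = Gamma (?N / 2 + s)"
  have G: "G > 0" using s by (simp add: G_def add_nonneg_pos)
  let ?k = "\<lambda>z x. ennreal (1 - cos (z \<bullet> e)) * (ennreal (x powr (?N / 2 + s - 1) * exp (- (x * (norm z)\<^sup>2))) * indicator {0<..} x)"
  have "ennreal G * (\<integral>\<^sup>+z. ennreal ((1 - cos (z \<bullet> e)) / norm z powr (?N + 2 * s)) \<partial>lborel)
     = (\<integral>\<^sup>+z. (\<integral>\<^sup>+x. ?k z x \<partial>lborel) \<partial>lborel)"
  proof (subst nn_integral_cmult[symmetric], simp, rule nn_integral_cong)
    fix z :: 'a
    show "ennreal G * ennreal ((1 - cos (z \<bullet> e)) / norm z powr (?N + 2 * s)) = (\<integral>\<^sup>+x. ?k z x \<partial>lborel)"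
    proof (cases "z = 0")
      case False
      then show ?thesis
        using s G riesz_kernel[OF s(1) False]
        by (subst nn_integral_cmult) (auto simp: G_def ennreal_mult'[symmetric])
    qed auto
  qed
  also have "\<dots> = (\<integral>\<^sup>+x. (\<integral>\<^sup>+z. ?k z x \<partial>lborel) \<partial>lborel)"
    by (rule lborel_pair.Fubini'[symmetric]) measurable
  also have "\<dots> = (\<integral>\<^sup>+x. ennreal (pi powr (?N / 2)) * (ennreal (x powr (s - 1) * (1 - exp (- (1 / (4 * x))))) * indicator {0<..} x) \<partial>lborel)"
  proof (rule nn_integral_cong)
    fix x :: real
    show "(\<integral>\<^sup>+z. ?k z x \<partial>lborel) = ennreal (pi powr (?N / 2)) * (ennreal (x powr (s - 1) * (1 - exp (- (1 / (4 * x))))) * indicator {0<..} x)"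
    proof (cases "x > 0")
      case True
      have "(\<integral>\<^sup>+z. ?k z x \<partial>lborel) = (\<integral>\<^sup>+z. ennreal (x powr (?N / 2 + s - 1)) *
           ennreal ((1 - cos ((z::'a) \<bullet> e)) * exp (- (x * (norm z)\<^sup>2))) \<partial>lborel)"
        using True by (intro nn_integral_cong) (simp add: ennreal_mult'[symmetric] mult_ac)
      also have "\<dots> = ennreal (x powr (?N / 2 + s - 1)) * ennreal ((pi / x) powr (?N / 2) * (1 - exp (- (1 / (4 * x)))))"
        using nn_integral_gaussian_cos[OF True e] by (subst nn_integral_cmult) auto
      also have "\<dots> = ennreal (pi powr (?N / 2)) * ennreal (x powr (s - 1) * (1 - exp (- (1 / (4 * x)))))"
        using True by (simp add: ennreal_mult'[symmetric] powr_divide powr_add powr_diff)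
      finally show ?thesis using True by simp
    qed simp
  qed
  also have "\<dots> = ennreal (pi powr (?N / 2)) * ennreal (4 powr (- s) * Gamma (1 - s) / s)"
    using nn_integral_one_minus_exp_inverse[OF s] by (subst nn_integral_cmult) auto
  finally have "ennreal G * (\<integral>\<^sup>+z. ennreal ((1 - cos (z \<bullet> e)) / norm z powr (?N + 2 * s)) \<partial>lborel)
     = ennreal (pi powr (?N / 2)) * ennreal (4 powr (- s) * Gamma (1 - s) / s)" (is "_ * ?L = ?R") .
  then have "ennreal (1 / G) * (ennreal G * ?L) = ennreal (1 / G) * ?R" by simp
  then have "?L = ennreal (1 / G) * ?R"
    using G by (simp add: mult.assoc[symmetric] ennreal_mult'[symmetric])
  then show ?thesis
    using G by (simp add: ennreal_mult'[symmetric] G_def mult_ac)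
qed

text \<open>The value matters here and not just the sign: the Gamma factors produced by the Schur
  test have to cancel against it to leave exactly \<open>Hardy_const\<close>.\<close>

lemma C_const_eq:
  assumes s: "0 < s" "s < 1"
  shows "C_const TYPE('a::euclidean_space) s
    = s * 4 powr s * Gamma (real DIM('a) / 2 + s) / (pi powr (real DIM('a) / 2) * Gamma (1 - s))"
proof -
  let ?e = "SOME b::'a. b \<in> Basis" and ?N = "real DIM('a)"
  have e: "?e \<in> Basis" using nonempty_Basis some_in_eq by blast
  let ?f = "\<lambda>z. (1 - cos (z \<bullet> ?e)) / norm z powr (?N + 2 * s)"
  have "(LINT z|lebesgue. ?f z) = (\<integral>z. ?f z \<partial>lborel)"
    by (rule integral_completion) measurable
  also have "\<dots> = enn2real (\<integral>\<^sup>+z. ennreal (?f z) \<partial>lborel)"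
    by (rule integral_eq_nn_integral) (auto intro!: divide_nonneg_nonneg)
  also have "\<dots> = pi powr (?N / 2) * 4 powr (- s) * Gamma (1 - s) / (s * Gamma (?N / 2 + s))"
    using s by (subst nn_integral_cos_kernel[OF s e]) (auto intro!: divide_nonneg_nonneg mult_nonneg_nonneg)
  finally show ?thesis
    by (simp add: C_const_def powr_minus field_simps)
qed

lemma C_const_pos: "0 < s \<Longrightarrow> s < 1 \<Longrightarrow> C_const TYPE('a::euclidean_space) s > 0"
  by (simp add: C_const_eq Gamma_real_pos add_nonneg_pos)

section \<open>A Schur test\<close>

text \<open>The energy integrates over a product of completed measures, so exchanging integrals
  calls for sigma-finiteness of \<open>lebesgue\<close> itself; it inherits the countable cover of
  \<open>lborel\<close>.\<close>

interpretation lebesgue: sigma_finite_measure "lebesgue :: 'a::euclidean_space measure"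
proof
  obtain A :: "'a set set" where "countable A" "A \<subseteq> sets lborel" "\<Union>A = space lborel" "\<forall>a\<in>A. emeasure lborel a \<noteq> \<infinity>"
    using lborel.sigma_finite_countable by blast
  then show "\<exists>A::'a set set. countable A \<and> A \<subseteq> sets lebesgue \<and> \<Union>A = space lebesgue \<and> (\<forall>a\<in>A. emeasure lebesgue a \<noteq> \<infinity>)"
    by (intro exI[of _ A]) (auto intro!: sets_completionI_sets)
qed

interpretation lebesgue_pair: pair_sigma_finite "lebesgue :: 'a::euclidean_space measure" "lebesgue :: 'b::euclidean_space measure" ..

lemma measurable_ident_lebesgue [measurable (raw)]: "(\<lambda>x. x) \<in> lebesgue \<rightarrow>\<^sub>M (borel :: 'a::euclidean_space measure)"
  by (rule measurable_completion) simp

lemma measurable_fst_lebesgue [measurable]: "fst \<in> lebesgue \<Otimes>\<^sub>M M \<rightarrow>\<^sub>M (borel :: 'a::euclidean_space measure)"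
  by (rule measurable_compose[OF measurable_fst measurable_ident_lebesgue])

lemma measurable_snd_lebesgue [measurable]: "snd \<in> M \<Otimes>\<^sub>M lebesgue \<rightarrow>\<^sub>M (borel :: 'a::euclidean_space measure)"
  by (rule measurable_compose[OF measurable_snd measurable_ident_lebesgue])

lemma nn_integral_lborel_shift:
  fixes f :: "'a::euclidean_space \<Rightarrow> ennreal"
  assumes [measurable]: "f \<in> borel_measurable borel"
  shows "(\<integral>\<^sup>+y. f (c + y) \<partial>lborel) = (\<integral>\<^sup>+y. f y \<partial>lborel)"
  by (subst (2) lborel_distr_plus[of c, symmetric]) (simp add: nn_integral_distr)

lemma nn_integral_lborel_uminus:
  fixes f :: "'a::euclidean_space \<Rightarrow> ennreal"
  assumes [measurable]: "f \<in> borel_measurable borel"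
  shows "(\<integral>\<^sup>+y. f (- y) \<partial>lborel) = (\<integral>\<^sup>+y. f y \<partial>lborel)"
  by (subst (2) lborel_affine[of "-1" "0::'a"]) (simp_all add: nn_integral_distr nn_integral_density)

lemma nn_integral_lborel_reflect:
  fixes f :: "'a::euclidean_space \<Rightarrow> ennreal"
  assumes [measurable]: "f \<in> borel_measurable borel"
  shows "(\<integral>\<^sup>+y. f (c - y) \<partial>lborel) = (\<integral>\<^sup>+y. f y \<partial>lborel)"
  using nn_integral_lborel_uminus[of "\<lambda>y. f (c + y)"] nn_integral_lborel_shift[of f c] by simp

text \<open>
  Schur test with the positive weight \<open>\<omega>\<close>; \<open>D\<close> bounds from below how far \<open>\<omega>\<close> is from being
  invariant under convolution with \<open>k\<close>.
\<close>
lemma schur_test_lower_bound: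
  fixes k :: "'a::euclidean_space \<Rightarrow> ennreal" and u \<omega> :: "'a \<Rightarrow> real"
  assumes k[measurable]: "k \<in> borel_measurable borel" and sym: "\<And>z. k (- z) = k z"
    and m: "(\<integral>\<^sup>+z. k z \<partial>lborel) = m" "m < \<infinity>"
    and \<omega>[measurable]: "\<omega> \<in> borel_measurable borel" and pos: "\<And>x. x \<noteq> 0 \<Longrightarrow> \<omega> x > 0"
    and D[measurable]: "D \<in> borel_measurable borel"
    and D_le: "\<And>x. x \<noteq> 0 \<Longrightarrow> (\<integral>\<^sup>+y. ennreal (\<omega> y / \<omega> x) * k (x - y) \<partial>lborel) + D x \<le> m"
    and u[measurable]: "u \<in> borel_measurable lebesgue" and L2: "(\<integral>\<^sup>+x. ennreal ((u x)\<^sup>2) \<partial>lebesgue) < \<infinity>"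
  shows "2 * (\<integral>\<^sup>+x. ennreal ((u x)\<^sup>2) * D x \<partial>lebesgue)
    \<le> (\<integral>\<^sup>+x. (\<integral>\<^sup>+y. ennreal (\<bar>u x - u y\<bar>\<^sup>2) * k (x - y) \<partial>lebesgue) \<partial>lebesgue)"
proof -
  define U where "U = (\<integral>\<^sup>+x. ennreal ((u x)\<^sup>2) \<partial>lebesgue)"
  define b where "b x = (\<integral>\<^sup>+y. ennreal (\<omega> y / \<omega> x) * k (x - y) \<partial>lborel)" for x
  define B where "B = (\<integral>\<^sup>+x. ennreal ((u x)\<^sup>2) * b x \<partial>lebesgue)"
  define E where "E = (\<integral>\<^sup>+x. (\<integral>\<^sup>+y. ennreal (\<bar>u x - u y\<bar>\<^sup>2) * k (x - y) \<partial>lebesgue) \<partial>lebesgue)"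
  define DD where "DD = (\<integral>\<^sup>+x. ennreal ((u x)\<^sup>2) * D x \<partial>lebesgue)"
  have [measurable]: "b \<in> borel_measurable borel"
    unfolding b_def[abs_def] by measurable
  have ae0: "AE x in lebesgue. x \<noteq> (0::'a)"
    by (rule AE_completion) (rule AE_lborel_singleton)
  have km: "(\<integral>\<^sup>+y. k (x - y) \<partial>lebesgue) = m" for x
    using m nn_integral_lborel_reflect[of k x] by (simp add: nn_integral_completion)
  have kmeas: "(\<lambda>y. k (x - y)) \<in> borel_measurable lebesgue" for x
    by (rule measurable_completion) measurable
  have ksym: "k (x - y) = k (y - x)" for x y using sym[of "y - x"] by simp
  have sq1: "(\<integral>\<^sup>+x. (\<integral>\<^sup>+y. ennreal ((u x)\<^sup>2) * k (x - y) \<partial>lebesgue) \<partial>lebesgue) = m * U"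
    by (simp add: nn_integral_cmult[OF kmeas] km nn_integral_multc U_def) (simp only: mult.commute)
  have sq2: "(\<integral>\<^sup>+x. (\<integral>\<^sup>+y. ennreal ((u y)\<^sup>2) * k (x - y) \<partial>lebesgue) \<partial>lebesgue) = m * U"
    unfolding sq1[symmetric]
    by (subst lebesgue_pair.Fubini') (auto simp: ksym intro!: nn_integral_cong)
  have B1: "(\<integral>\<^sup>+x. (\<integral>\<^sup>+y. ennreal ((u x)\<^sup>2) * (ennreal (\<omega> y / \<omega> x) * k (x - y)) \<partial>lebesgue) \<partial>lebesgue) = B"
    by (simp add: nn_integral_cmult B_def b_def nn_integral_completion)
  have B2: "(\<integral>\<^sup>+x. (\<integral>\<^sup>+y. ennreal ((u y)\<^sup>2) * (ennreal (\<omega> x / \<omega> y) * k (x - y)) \<partial>lebesgue) \<partial>lebesgue) = B"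
    unfolding B1[symmetric]
    by (subst lebesgue_pair.Fubini') (auto simp: ksym intro!: nn_integral_cong)
  \<comment> \<open>The expansion of |u(x) - u(y)|^2 is integrated with every term on the side where
    it is nonnegative, since nothing may be subtracted before finiteness is known.\<close>
  have "m * U + m * U = (\<integral>\<^sup>+x. (\<integral>\<^sup>+y. ennreal ((u x)\<^sup>2) * k (x - y) + ennreal ((u y)\<^sup>2) * k (x - y) \<partial>lebesgue) \<partial>lebesgue)"
    by (subst nn_integral_add; (subst nn_integral_add)?; simp add: sq1 sq2)
  also have "\<dots> \<le> (\<integral>\<^sup>+x. (\<integral>\<^sup>+y. ennreal (\<bar>u x - u y\<bar>\<^sup>2) * k (x - y) +
     (ennreal ((u x)\<^sup>2) * (ennreal (\<omega> y / \<omega> x) * k (x - y)) + ennreal ((u y)\<^sup>2) * (ennreal (\<omega> x / \<omega> y) * k (x - y))) \<partial>lebesgue) \<partial>lebesgue)"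
  proof (rule nn_integral_mono_AE, use ae0 in eventually_elim)
    fix x :: 'a assume x: "x \<noteq> 0"
    show "(\<integral>\<^sup>+y. ennreal ((u x)\<^sup>2) * k (x - y) + ennreal ((u y)\<^sup>2) * k (x - y) \<partial>lebesgue)
       \<le> (\<integral>\<^sup>+y. ennreal (\<bar>u x - u y\<bar>\<^sup>2) * k (x - y) +
     (ennreal ((u x)\<^sup>2) * (ennreal (\<omega> y / \<omega> x) * k (x - y)) + ennreal ((u y)\<^sup>2) * (ennreal (\<omega> x / \<omega> y) * k (x - y))) \<partial>lebesgue)"
    proof (rule nn_integral_mono_AE, use ae0 in eventually_elim)
      fix y :: 'a assume y: "y \<noteq> 0"
      \<comment> \<open>Weighted AM-GM: 2 u(x) u(y) is at most q^2 u(x)^2 + u(y)^2 / q^2, with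
        equality when u is proportional to \<omega>.\<close>
      define q where "q = sqrt (\<omega> y / \<omega> x)"
      have q: "q > 0" "q\<^sup>2 = \<omega> y / \<omega> x" "1 / q\<^sup>2 = \<omega> x / \<omega> y"
        using pos[OF x] pos[OF y] by (auto simp: q_def)
      have "0 \<le> (u x * q - u y / q)\<^sup>2" by simp
      also have "\<dots> = (u x)\<^sup>2 * (\<omega> y / \<omega> x) + (u y)\<^sup>2 * (\<omega> x / \<omega> y) - 2 * (u x * u y)"
        unfolding q(2,3)[symmetric] using q(1) by (simp add: power2_diff power_mult_distrib power_divide)
      finally have "(u x)\<^sup>2 + (u y)\<^sup>2 \<le> \<bar>u x - u y\<bar>\<^sup>2 + ((u x)\<^sup>2 * (\<omega> y / \<omega> x) + (u y)\<^sup>2 * (\<omega> x / \<omega> y))"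
        by (simp add: power2_diff)
      then have "ennreal ((u x)\<^sup>2 + (u y)\<^sup>2) * k (x - y)
         \<le> ennreal (\<bar>u x - u y\<bar>\<^sup>2 + ((u x)\<^sup>2 * (\<omega> y / \<omega> x) + (u y)\<^sup>2 * (\<omega> x / \<omega> y))) * k (x - y)"
        by (intro mult_right_mono ennreal_leI) auto
      then show "ennreal ((u x)\<^sup>2) * k (x - y) + ennreal ((u y)\<^sup>2) * k (x - y) \<le>
         ennreal (\<bar>u x - u y\<bar>\<^sup>2) * k (x - y) +
     (ennreal ((u x)\<^sup>2) * (ennreal (\<omega> y / \<omega> x) * k (x - y)) + ennreal ((u y)\<^sup>2) * (ennreal (\<omega> x / \<omega> y) * k (x - y)))"
        using pos[OF x] pos[OF y]
        by (simp add: ennreal_plus ennreal_mult' distrib_right mult.assoc del: power2_abs times_divide_eq_right)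
    qed
  qed
  also have "\<dots> = E + (B + B)"
    by (simp add: nn_integral_add B1 B2 E_def)
  finally have main: "m * U + m * U \<le> E + (B + B)" .
  have BD: "B + DD \<le> m * U"
  proof -
    have "B + DD = (\<integral>\<^sup>+x. ennreal ((u x)\<^sup>2) * (b x + D x) \<partial>lebesgue)"
      by (simp add: B_def DD_def nn_integral_add distrib_left)
    also have "\<dots> \<le> (\<integral>\<^sup>+x. ennreal ((u x)\<^sup>2) * m \<partial>lebesgue)"
      by (rule nn_integral_mono_AE, use ae0 in eventually_elim)
        (use D_le in \<open>auto simp: b_def intro!: mult_left_mono\<close>)
    also have "\<dots> = U * m" unfolding U_def by (rule nn_integral_multc) measurable
    finally show ?thesis by (simp only: mult.commute)
  qed
  \<comment> \<open>Finite mass of the kernel and u in L^2 make the convolution term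
    \<open>B\<close> finite, so that it can be cancelled.\<close>
  have "m * U < \<infinity>" using m L2 by (simp add: U_def ennreal_mult_less_top)
  then have "B \<noteq> \<infinity>" using BD by (auto simp: top_unique)
  have "(B + B) + (DD + DD) \<le> m * U + m * U"
    using add_mono[OF BD BD] by (simp add: ac_simps)
  also note main
  finally have "(B + B) + (DD + DD) \<le> (B + B) + E" by (simp add: ac_simps)
  then have "DD + DD \<le> E" using \<open>B \<noteq> \<infinity>\<close>
    by (simp add: ennreal_add_left_cancel_le)
  then show ?thesis by (simp add: DD_def E_def mult_2)
qed

lemma nn_integral_gaussian_conv:
  fixes x :: "'a::euclidean_space"
  assumes l: "l > 0" "t > 0"
  shows "(\<integral>\<^sup>+y. ennreal (exp (- (l * (norm (x - y))\<^sup>2)) * exp (- (t * (norm y)\<^sup>2))) \<partial>lborel)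
     = ennreal ((pi / (l + t)) powr (real DIM('a) / 2) * exp (- (l * t / (l + t) * (norm x)\<^sup>2)))"
proof -
  \<comment> \<open>The point at which the sum of the two quadratic exponents is smallest; centring
    there completes the square.\<close>
  define c where "c = (l / (l + t)) *\<^sub>R x"
  have sq: "l * (norm (x - (c + y)))\<^sup>2 + t * (norm (c + y))\<^sup>2 = (l + t) * (norm y)\<^sup>2 + l * t / (l + t) * (norm x)\<^sup>2" for y
  proof -
    have "l * (norm (x - (c + y)))\<^sup>2 + t * (norm (c + y))\<^sup>2
      = l * (norm x)\<^sup>2 + (l + t) * (c \<bullet> c) + (l + t) * (norm y)\<^sup>2 + 2 * ((l + t) * (c \<bullet> y) - l * (x \<bullet> y)) - 2 * l * (x \<bullet> c)"
      by (simp add: power2_norm_eq_inner inner_diff_left inner_diff_right inner_add_left inner_add_right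
          inner_commute algebra_simps)
    also have "(l + t) * (c \<bullet> y) = l * (x \<bullet> y)" using l by (simp add: c_def)
    also have "(l + t) * (c \<bullet> c) = l\<^sup>2 / (l + t) * (norm x)\<^sup>2"
      using l by (simp add: c_def dot_square_norm power2_eq_square)
    finally have "l * (norm (x - (c + y)))\<^sup>2 + t * (norm (c + y))\<^sup>2 = l * (norm x)\<^sup>2 + l\<^sup>2 / (l + t) * (norm x)\<^sup>2
       + (l + t) * (norm y)\<^sup>2 + 2 * (l * (x \<bullet> y) - l * (x \<bullet> y)) - 2 * l * (x \<bullet> c)" .
    moreover have "x \<bullet> c = l / (l + t) * (norm x)\<^sup>2" by (simp add: c_def power2_norm_eq_inner)
    moreover have "l * t / (l + t) = l - l\<^sup>2 / (l + t)"
    proof -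
      have "l * t = l * (l + t) - l\<^sup>2" by algebra
      then show ?thesis using l by (simp add: diff_divide_distrib)
    qed
    ultimately show ?thesis
      by (simp only:) (simp add: algebra_simps power2_eq_square)
  qed
  have "(\<integral>\<^sup>+y. ennreal (exp (- (l * (norm (x - y))\<^sup>2)) * exp (- (t * (norm y)\<^sup>2))) \<partial>lborel)
     = (\<integral>\<^sup>+y. ennreal (exp (- (l * (norm (x - (c + y)))\<^sup>2)) * exp (- (t * (norm (c + y))\<^sup>2))) \<partial>lborel)"
    by (subst nn_integral_lborel_shift[symmetric, of _ c]) auto
  also have "\<dots> = (\<integral>\<^sup>+y. ennreal (exp (- (l * t / (l + t) * (norm x)\<^sup>2))) * ennreal (exp (- ((l + t) * (norm (y::'a))\<^sup>2))) \<partial>lborel)"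
  proof (intro nn_integral_cong)
    fix y :: 'a
    show "ennreal (exp (- (l * (norm (x - (c + y)))\<^sup>2)) * exp (- (t * (norm (c + y))\<^sup>2)))
       = ennreal (exp (- (l * t / (l + t) * (norm x)\<^sup>2))) * ennreal (exp (- ((l + t) * (norm y)\<^sup>2)))"
      using sq[of y] by (simp flip: exp_add ennreal_mult')
  qed
  also have "\<dots> = ennreal ((pi / (l + t)) powr (real DIM('a) / 2) * exp (- (l * t / (l + t) * (norm x)\<^sup>2)))"
    using l by (subst nn_integral_cmult) (auto simp: nn_integral_gaussian ennreal_mult'[symmetric] mult.commute)
  finally show ?thesis .
qed

text \<open>1 - (1 + x)^(-g) is the mean of 1 - exp(- v x) for v distributed by the Gamma law of
  order g. So \<open>nn_integral_one_minus_exp\<close> applies for each v and leaves a Gamma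
  integral of order g + s. For the Hardy constant, g + s = (N + 2s)/4.\<close>

lemma nn_integral_one_minus_shifted_powr:
  assumes s: "0 < s" "s < 1" and g: "g > 0"
  shows "(\<integral>\<^sup>+x\<in>{0<..}. ennreal (x powr (- 1 - s) * (1 - (1 + x) powr (- g))) \<partial>lborel)
    = ennreal (Gamma (g + s) * Gamma (1 - s) / (s * Gamma g))"
proof -
  let ?k = "\<lambda>x v. ennreal (v powr (g - 1) * exp (- v)) * ennreal (x powr (- 1 - s) * (1 - exp (- (v * x)))) * indicator {0<..} v * indicator {0<..} x"
  have G: "Gamma g > 0" using g by simp
  have pt: "ennreal (Gamma g) * ennreal (1 - (1 + x) powr (- g))
      = (\<integral>\<^sup>+v\<in>{0<..}. ennreal (v powr (g - 1) * exp (- v) * (1 - exp (- (v * x)))) \<partial>lborel)" if x: "x > 0" for x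
  proof -
    have i1: "(\<integral>\<^sup>+v\<in>{0<..}. ennreal (v powr (g - 1) * exp (- (1 * v))) \<partial>lborel) = ennreal (Gamma g * 1 powr (- g))"
      using g by (intro nn_integral_Gamma_scaled) auto
    have i2: "(\<integral>\<^sup>+v\<in>{0<..}. ennreal (v powr (g - 1) * exp (- ((1 + x) * v))) \<partial>lborel) = ennreal (Gamma g * (1 + x) powr (- g))"
      using g x by (intro nn_integral_Gamma_scaled) auto
    have ex: "exp (- ((1 + x) * v)) = exp (- v) * exp (- (v * x))" for v :: real
      by (simp add: algebra_simps flip: exp_add)
    have ex2: "ennreal (v powr (g - 1) * exp (- v) * (1 - exp (- (v * x)))) + ennreal (v powr (g - 1) * exp (- ((1 + x) * v)))
        = ennreal (v powr (g - 1) * exp (- v))" if "v > 0" for v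
      using that x unfolding ex by (subst ennreal_plus[symmetric]) (auto simp: algebra_simps)
    let ?I = "\<integral>\<^sup>+v\<in>{0<..}. ennreal (v powr (g - 1) * exp (- v) * (1 - exp (- (v * x)))) \<partial>lborel"
    have "?I + ennreal (Gamma g * (1 + x) powr (- g)) = ennreal (Gamma g)"
    proof -
      have "?I + ennreal (Gamma g * (1 + x) powr (- g)) =
        (\<integral>\<^sup>+v. ennreal (v powr (g - 1) * exp (- v) * (1 - exp (- (v * x)))) * indicator {0<..} v
            + ennreal (v powr (g - 1) * exp (- ((1 + x) * v))) * indicator {0<..} v \<partial>lborel)"
        unfolding i2[symmetric] by (rule nn_integral_add[symmetric]) auto
      also have "\<dots> = (\<integral>\<^sup>+v\<in>{0<..}. ennreal (v powr (g - 1) * exp (- (1 * v))) \<partial>lborel)"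
        using x by (intro nn_integral_cong)
          (simp add: indicator_def ex2)
      also have "\<dots> = ennreal (Gamma g)" unfolding i1 by simp
      finally show ?thesis .
    qed
    \<comment> \<open>The identity was proved as a sum; the term now cancelled is finite.\<close>
    then have "(?I + ennreal (Gamma g * (1 + x) powr (- g))) - ennreal (Gamma g * (1 + x) powr (- g))
        = ennreal (Gamma g) - ennreal (Gamma g * (1 + x) powr (- g))"
      by (rule arg_cong)
    then have "?I = ennreal (Gamma g) - ennreal (Gamma g * (1 + x) powr (- g))"
      by (simp only: ennreal_add_diff_cancel_right[OF ennreal_neq_top])
    also have "\<dots> = ennreal (Gamma g - Gamma g * (1 + x) powr (- g))"
      using G by (intro ennreal_minus) auto
    also have "\<dots> = ennreal (Gamma g) * ennreal (1 - (1 + x) powr (- g))"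
      using G by (simp add: ennreal_mult'[symmetric] right_diff_distrib)
    finally show ?thesis ..
  qed
  have "ennreal (Gamma g) * (\<integral>\<^sup>+x\<in>{0<..}. ennreal (x powr (- 1 - s) * (1 - (1 + x) powr (- g))) \<partial>lborel)
     = (\<integral>\<^sup>+x. (\<integral>\<^sup>+v. ?k x v \<partial>lborel) \<partial>lborel)"
  proof (subst nn_integral_cmult[symmetric], simp, rule nn_integral_cong)
    fix x :: real
    show "ennreal (Gamma g) * (ennreal (x powr (- 1 - s) * (1 - (1 + x) powr (- g))) * indicator {0<..} x) = (\<integral>\<^sup>+v. ?k x v \<partial>lborel)"
    proof (cases "x > 0")
      case True
      have "(\<integral>\<^sup>+v. ?k x v \<partial>lborel) = (\<integral>\<^sup>+v. ennreal (x powr (-1-s)) * (ennreal (v powr (g - 1) * exp (- v) * (1 - exp (- (v * x)))) * indicator {0<..} v) \<partial>lborel)"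
        using True by (intro nn_integral_cong) (auto simp: indicator_def ennreal_mult'[symmetric] mult_ac)
      also have "\<dots> = ennreal (x powr (-1-s)) * (ennreal (Gamma g) * ennreal (1 - (1 + x) powr (- g)))"
        unfolding pt[OF True] by (subst nn_integral_cmult) auto
      finally show ?thesis using True G by (simp add: ennreal_mult' mult_ac)
    qed simp
  qed
  also have "\<dots> = (\<integral>\<^sup>+v. (\<integral>\<^sup>+x. ?k x v \<partial>lborel) \<partial>lborel)"
    by (rule lborel_pair.Fubini') measurable
  also have "\<dots> = (\<integral>\<^sup>+v. ennreal (Gamma (1 - s) / s) * (ennreal (v powr (g + s - 1) * exp (- (1 * v))) * indicator {0<..} v) \<partial>lborel)"
  proof (rule nn_integral_cong)
    fix v :: real
    show "(\<integral>\<^sup>+x. ?k x v \<partial>lborel) = ennreal (Gamma (1 - s) / s) * (ennreal (v powr (g + s - 1) * exp (- (1 * v))) * indicator {0<..} v)"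
    proof (cases "v > 0")
      case True
      have "(\<integral>\<^sup>+x. ?k x v \<partial>lborel) = (\<integral>\<^sup>+x. ennreal (v powr (g - 1) * exp (- v)) * (ennreal (x powr (- 1 - s) * (1 - exp (- (v * x)))) * indicator {0<..} x) \<partial>lborel)"
        using True by (intro nn_integral_cong) (auto simp: indicator_def)
      also have "\<dots> = ennreal (v powr (g - 1) * exp (- v)) * ennreal (v powr s * Gamma (1 - s) / s)"
        using nn_integral_one_minus_exp[OF s True] by (subst nn_integral_cmult) auto
      also have "\<dots> = ennreal (Gamma (1 - s) / s) * ennreal (v powr (g + s - 1) * exp (- (1 * v)))"
        using s by (simp add: ennreal_mult'[symmetric] powr_add powr_diff mult_ac)
      finally show ?thesis using True by simp
    qed simp
  qed
  also have "\<dots> = ennreal (Gamma (1 - s) / s) * ennreal (Gamma (g + s))"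
    using g s nn_integral_Gamma_scaled[of "g + s" 1] by (subst nn_integral_cmult) auto
  finally have "ennreal (Gamma g) * (\<integral>\<^sup>+x\<in>{0<..}. ennreal (x powr (- 1 - s) * (1 - (1 + x) powr (- g))) \<partial>lborel)
     = ennreal (Gamma (1 - s) / s) * ennreal (Gamma (g + s))" (is "_ * ?L = ?R") .
  then have "ennreal (1 / Gamma g) * (ennreal (Gamma g) * ?L) = ennreal (1 / Gamma g) * ?R" by simp
  then have "?L = ennreal (1 / Gamma g) * ?R"
    using G by (simp add: mult.assoc[symmetric] ennreal_mult'[symmetric])
  then show ?thesis
    using G s g by (simp add: ennreal_mult'[symmetric] mult_ac)
qed

section \<open>The sharp fractional Hardy inequality\<close>

text \<open>As \<open>M\<close> tends to infinity this increases to Gamma(N/2 + s) |z|^(-N-2s). The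
  cut removes the singularity at 0, which makes the kernel integrable, and keeps it a mixture of
  Gaussians.\<close>

definition cut_kernel :: "real \<Rightarrow> real \<Rightarrow> 'a::euclidean_space \<Rightarrow> ennreal" where
  "cut_kernel s M z =
     (\<integral>\<^sup>+l\<in>{0<..<M}. ennreal (l powr (real DIM('a) / 2 + s - 1) * exp (- (l * (norm z)\<^sup>2))) \<partial>lborel)"

lemma borel_measurable_cut_kernel [measurable]: "cut_kernel s M \<in> borel_measurable borel"
  unfolding cut_kernel_def[abs_def] by measurable

lemma cut_kernel_uminus: "cut_kernel s M (- z) = cut_kernel s M z"
  by (simp add: cut_kernel_def)

lemma cut_kernel_le:
  fixes z :: "'a::euclidean_space"
  assumes "0 < s" "z \<noteq> 0"
  shows "cut_kernel s M z \<le> ennreal (Gamma (real DIM('a) / 2 + s) / norm z powr (real DIM('a) + 2 * s))"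
  unfolding riesz_kernel[OF assms, symmetric] cut_kernel_def
  by (intro nn_integral_mono) (auto simp: indicator_def)

lemma nn_integral_powr_cut:
  assumes "s > 0" "M > 0"
  shows "(\<integral>\<^sup>+l\<in>{0<..<M}. ennreal (l powr (s - 1)) \<partial>lborel) = ennreal (M powr s / s)"
proof -
  have "((\<lambda>t. t powr (s - 1)) has_integral (M powr (s - 1 + 1) / (s - 1 + 1))) {0..M}"
    using assms by (intro has_integral_powr_from_0) auto
  from nn_integral_has_integral_lebesgue[OF _ this]
  have "(\<integral>\<^sup>+l. ennreal (l powr (s - 1)) * indicator {0..M} l \<partial>lborel) = ennreal (M powr s / s)"
    by (simp add: ennreal_mult'[symmetric] ennreal_indicator[symmetric] mult.commute)
  moreover have "(\<integral>\<^sup>+l. ennreal (l powr (s - 1)) * indicator {0..M} l \<partial>lborel) =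
     (\<integral>\<^sup>+l\<in>{0<..<M}. ennreal (l powr (s - 1)) \<partial>lborel)"
    by (intro nn_integral_cong_AE AE_I[where N="{0, M}"]) (auto simp: indicator_def emeasure_lborel_countable split: if_splits)
  ultimately show ?thesis by simp
qed

lemma nn_integral_cut_kernel:
  assumes s: "0 < s" and M: "M > 0"
  shows "(\<integral>\<^sup>+z. cut_kernel s M (z::'a::euclidean_space) \<partial>lborel)
     = ennreal (pi powr (real DIM('a) / 2)) * ennreal (M powr s / s)"
proof -
  let ?N = "real DIM('a)"
  let ?f = "\<lambda>z l. ennreal (l powr (?N / 2 + s - 1) * exp (- (l * (norm z)\<^sup>2))) * indicator {0<..<M} l"
  have "(\<integral>\<^sup>+z. cut_kernel s M (z::'a) \<partial>lborel) = (\<integral>\<^sup>+l. (\<integral>\<^sup>+z. ?f (z::'a) l \<partial>lborel) \<partial>lborel)"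
    unfolding cut_kernel_def by (rule lborel_pair.Fubini'[symmetric]) measurable
  also have "\<dots> = (\<integral>\<^sup>+l. ennreal (pi powr (?N / 2)) * (ennreal (l powr (s - 1)) * indicator {0<..<M} l) \<partial>lborel)"
  proof (rule nn_integral_cong)
    fix l :: real
    show "(\<integral>\<^sup>+z. ?f (z::'a) l \<partial>lborel) = ennreal (pi powr (?N / 2)) * (ennreal (l powr (s - 1)) * indicator {0<..<M} l)"
    proof (cases "l \<in> {0<..<M}")
      case True
      then have l: "l > 0" by simp
      have "(\<integral>\<^sup>+z. ?f (z::'a) l \<partial>lborel) = (\<integral>\<^sup>+z. ennreal (l powr (?N / 2 + s - 1)) * ennreal (exp (- (l * (norm (z::'a))\<^sup>2))) \<partial>lborel)"
        using True by (intro nn_integral_cong) (simp add: ennreal_mult')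
      also have "\<dots> = ennreal (l powr (?N / 2 + s - 1)) * ennreal ((pi / l) powr (?N / 2))"
        using l by (subst nn_integral_cmult) (auto simp: nn_integral_gaussian)
      also have "\<dots> = ennreal (pi powr (?N / 2)) * ennreal (l powr (s - 1))"
        using l by (simp add: ennreal_mult'[symmetric] powr_divide powr_add powr_diff)
      finally show ?thesis using True by simp
    qed simp
  qed
  also have "\<dots> = ennreal (pi powr (?N / 2)) * ennreal (M powr s / s)"
    using nn_integral_powr_cut[OF s M] by (subst nn_integral_cmult) auto
  finally show ?thesis .
qed

text \<open>What the integration over the Gaussian parameter l of the kernel leaves when the ratio
  \<open>c\<close> of the two Gaussian parameters is held fixed: an incomplete Gamma integral in c
  |x|^2. In the application \<open>b\<close> is (N + 2s)/4.\<close>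

definition hardy_profile :: "real \<Rightarrow> real \<Rightarrow> real \<Rightarrow> 'a::euclidean_space \<Rightarrow> ennreal" where
  "hardy_profile b M c x =
     (\<integral>\<^sup>+l\<in>{0<..<M}. ennreal (l powr (b - 1) * exp (- (l * c * (norm x)\<^sup>2))) \<partial>lborel)"

lemma hardy_profile_measurable [measurable (raw)]:
  assumes [measurable]: "f \<in> N \<rightarrow>\<^sub>M borel" "g \<in> N \<rightarrow>\<^sub>M borel"
  shows "(\<lambda>p. hardy_profile b M (f p) (g p)) \<in> borel_measurable N"
  unfolding hardy_profile_def by measurable

text \<open>Replacing l by c l moves the cut from \<open>M\<close> to \<open>M / c\<close>.
  Restoring \<open>M\<close> is the only loss in the computation of the convolution; it has the
  favourable sign and disappears as \<open>M\<close> tends to infinity.\<close>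

lemma hardy_profile_scale:
  assumes c: "c \<ge> 1"
  shows "hardy_profile b M (t / c) x \<le> ennreal (c powr b) * hardy_profile b M t x"
proof -
  have "hardy_profile b M (t / c) x = (\<integral>\<^sup>+l\<in>{0<..}. ennreal (l powr (b - 1) * exp (- (l * (t / c) * (norm x)\<^sup>2))) * indicator {0<..<M} l \<partial>lborel)"
    unfolding hardy_profile_def by (intro nn_integral_cong) (auto simp: indicator_def)
  also have "\<dots> = ennreal c * (\<integral>\<^sup>+l\<in>{0<..}. ennreal ((c * l) powr (b - 1) * exp (- (c * l * (t / c) * (norm x)\<^sup>2))) * indicator {0<..<M} (c * l) \<partial>lborel)"
    using c by (intro nn_integral_half_line_scale) auto
  also have "\<dots> \<le> ennreal c * (\<integral>\<^sup>+l. ennreal (c powr (b - 1)) * (ennreal (l powr (b - 1) * exp (- (l * t * (norm x)\<^sup>2))) * indicator {0<..<M} l) \<partial>lborel)"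
  proof (intro mult_left_mono nn_integral_mono)
    fix l :: real
    have "l < M" if "l > 0" "c * l < M"
      using that c by (smt (verit) mult_right_mono mult_le_cancel_right1)
    then show "ennreal ((c * l) powr (b - 1) * exp (- (c * l * (t / c) * (norm x)\<^sup>2))) * indicator {0<..<M} (c * l) * indicator {0<..} l
      \<le> ennreal (c powr (b - 1)) * (ennreal (l powr (b - 1) * exp (- (l * t * (norm x)\<^sup>2))) * indicator {0<..<M} l)"
      using c by (auto simp: indicator_def powr_mult ennreal_mult'[symmetric] mult.assoc)
  qed auto
  also have "\<dots> = ennreal (c powr b) * hardy_profile b M t x"
    using c unfolding hardy_profile_def
    by (subst nn_integral_cmult) (auto simp: mult.assoc[symmetric] ennreal_mult'[symmetric] powr_diff)
  finally show ?thesis .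
qed

text \<open>The ground state |y|^(-2g) is the mixture of exp(- t |y|^2) with weight t^(g-1) /
  Gamma(g), so the convolution is a double mixture of the integrals in
  \<open>nn_integral_gaussian_conv\<close>. With t = l c the exponent becomes l |x|^2 c / (1 + c),
  and \<open>hardy_profile_scale\<close> trades the denominator 1 + c for a power of it.\<close>

lemma cut_kernel_conv_le:
  fixes x :: "'a::euclidean_space"
  assumes N: "real DIM('a) > 2 * s" and M: "M > 0" and x: "x \<noteq> 0"
  defines "g \<equiv> (real DIM('a) - 2 * s) / 4" and "b \<equiv> (real DIM('a) + 2 * s) / 4"
  shows "(\<integral>\<^sup>+y. ennreal (norm y powr (- (2 * g)) / norm x powr (- (2 * g))) * cut_kernel s M (x - y) \<partial>lborel)
    \<le> ennreal (norm x powr (2 * g) * pi powr (real DIM('a) / 2) / Gamma g) *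
       (\<integral>\<^sup>+c\<in>{0<..}. ennreal (c powr (g - 1) * (1 + c) powr (- g)) * hardy_profile b M c x \<partial>lborel)"
    (is "?L \<le> _")
proof -
  let ?N = "real DIM('a)"
  have g: "g > 0" using N by (simp add: g_def)
  have G: "Gamma g > 0" using g by simp
  \<comment> \<open>The normalisation 1 / Gamma(g) of the mixture, divided by the ground state at
    \<open>x\<close>.\<close>
  define A where "A = norm x powr (2 * g) / Gamma g"
  have A: "A \<ge> 0" using G by (simp add: A_def)
  let ?F = "\<lambda>y l t. ennreal (t powr (g - 1) * l powr (?N / 2 + s - 1)) * ennreal (exp (- (l * (norm (x - y))\<^sup>2)) * exp (- (t * (norm y)\<^sup>2)))
       * indicator {0<..<M} l * indicator {0<..} t"
  have "(\<integral>\<^sup>+y. ennreal (norm y powr (- (2 * g)) / norm x powr (- (2 * g))) * cut_kernel s M (x - y) \<partial>lborel)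
     = (\<integral>\<^sup>+y. ennreal A * (\<integral>\<^sup>+l. (\<integral>\<^sup>+t. ?F y l t \<partial>lborel) \<partial>lborel) \<partial>lborel)"
  proof (rule nn_integral_cong_AE, use AE_lborel_singleton[of "0::'a"] in eventually_elim)
    fix y :: 'a assume y: "y \<noteq> 0"
    have p: "(norm y)\<^sup>2 powr (- g) = norm y powr (- (2 * g))"
      using y by (simp add: powr_powr flip: powr_numeral)
    have G1: "(\<integral>\<^sup>+t\<in>{0<..}. ennreal (t powr (g - 1) * exp (- ((norm y)\<^sup>2 * t))) \<partial>lborel) = ennreal (Gamma g * norm y powr (- (2 * g)))"
      using nn_integral_Gamma_scaled[of g "(norm y)\<^sup>2"] g y p by simp
    have "(\<integral>\<^sup>+l. (\<integral>\<^sup>+t. ?F y l t \<partial>lborel) \<partial>lborel)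
      = (\<integral>\<^sup>+l. (\<integral>\<^sup>+t. (ennreal (l powr (?N / 2 + s - 1) * exp (- (l * (norm (x - y))\<^sup>2))) * indicator {0<..<M} l) *
             (ennreal (t powr (g - 1) * exp (- ((norm y)\<^sup>2 * t))) * indicator {0<..} t) \<partial>lborel) \<partial>lborel)"
      by (intro nn_integral_cong) (simp add: indicator_def ennreal_mult'[symmetric] mult_ac)
    also have "\<dots> = (\<integral>\<^sup>+l. (ennreal (l powr (?N / 2 + s - 1) * exp (- (l * (norm (x - y))\<^sup>2))) * indicator {0<..<M} l) *
             ennreal (Gamma g * norm y powr (- (2 * g))) \<partial>lborel)"
      unfolding G1[symmetric] by (intro nn_integral_cong nn_integral_cmult) auto
    also have "\<dots> = cut_kernel s M (x - y) * ennreal (Gamma g * norm y powr (- (2 * g)))"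
      unfolding cut_kernel_def by (rule nn_integral_multc) auto
    finally have "ennreal A * (\<integral>\<^sup>+l. (\<integral>\<^sup>+t. ?F y l t \<partial>lborel) \<partial>lborel)
       = (ennreal A * ennreal (Gamma g * norm y powr (- (2 * g)))) * cut_kernel s M (x - y)"
      by (simp only: mult_ac)
    also have "ennreal A * ennreal (Gamma g * norm y powr (- (2 * g))) = ennreal (norm y powr (- (2 * g)) / norm x powr (- (2 * g)))"
      using A G x by (simp add: ennreal_mult'[symmetric] A_def powr_minus divide_simps)
    finally show "ennreal (norm y powr (- (2 * g)) / norm x powr (- (2 * g))) * cut_kernel s M (x - y)
       = ennreal A * (\<integral>\<^sup>+l. (\<integral>\<^sup>+t. ?F y l t \<partial>lborel) \<partial>lborel)" ..
  qed
  also have "\<dots> = ennreal A * (\<integral>\<^sup>+y. (\<integral>\<^sup>+l. (\<integral>\<^sup>+t. ?F y l t \<partial>lborel) \<partial>lborel) \<partial>lborel)"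
    by (rule nn_integral_cmult) measurable
  also have "(\<integral>\<^sup>+y. (\<integral>\<^sup>+l. (\<integral>\<^sup>+t. ?F y l t \<partial>lborel) \<partial>lborel) \<partial>lborel)
     = (\<integral>\<^sup>+l. (\<integral>\<^sup>+y. (\<integral>\<^sup>+t. ?F y l t \<partial>lborel) \<partial>lborel) \<partial>lborel)"
    by (rule lborel_pair.Fubini'[symmetric]) measurable
  also have "\<dots> = (\<integral>\<^sup>+l. (\<integral>\<^sup>+t. (\<integral>\<^sup>+y. ?F y l t \<partial>lborel) \<partial>lborel) \<partial>lborel)"
    by (intro nn_integral_cong lborel_pair.Fubini'[symmetric]) measurable
  also have "\<dots> = (\<integral>\<^sup>+l. (\<integral>\<^sup>+c. ennreal (pi powr (?N / 2)) * (ennreal (c powr (g - 1) * (1 + c) powr (- (?N / 2))) * indicator {0<..} c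
       * (ennreal (l powr (b - 1) * exp (- (l * (c / (1 + c)) * (norm x)\<^sup>2))) * indicator {0<..<M} l)) \<partial>lborel) \<partial>lborel)"
  proof (rule nn_integral_cong)
    fix l :: real
    show "(\<integral>\<^sup>+t. (\<integral>\<^sup>+y. ?F y l t \<partial>lborel) \<partial>lborel) = (\<integral>\<^sup>+c. ennreal (pi powr (?N / 2)) * (ennreal (c powr (g - 1) * (1 + c) powr (- (?N / 2))) * indicator {0<..} c
       * (ennreal (l powr (b - 1) * exp (- (l * (c / (1 + c)) * (norm x)\<^sup>2))) * indicator {0<..<M} l)) \<partial>lborel)"
    proof (cases "l \<in> {0<..<M}")
      case True
      then have l: "l > 0" by simp
      have "(\<integral>\<^sup>+t. (\<integral>\<^sup>+y. ?F y l t \<partial>lborel) \<partial>lborel) = (\<integral>\<^sup>+t\<in>{0<..}. ennreal (t powr (g - 1) * l powr (?N / 2 + s - 1)) *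
           ennreal ((pi / (l + t)) powr (?N / 2) * exp (- (l * t / (l + t) * (norm x)\<^sup>2))) \<partial>lborel)"
      proof (rule nn_integral_cong)
        fix t :: real
        show "(\<integral>\<^sup>+y. ?F y l t \<partial>lborel) = ennreal (t powr (g - 1) * l powr (?N / 2 + s - 1)) *
           ennreal ((pi / (l + t)) powr (?N / 2) * exp (- (l * t / (l + t) * (norm x)\<^sup>2))) * indicator {0<..} t"
        proof (cases "t > 0")
          case tp: True
          have "(\<integral>\<^sup>+y. ?F y l t \<partial>lborel) = (\<integral>\<^sup>+y. ennreal (t powr (g - 1) * l powr (?N / 2 + s - 1)) *
             ennreal (exp (- (l * (norm (x - y))\<^sup>2)) * exp (- (t * (norm y)\<^sup>2))) \<partial>lborel)"
            using True tp by (intro nn_integral_cong) simp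
          also have "\<dots> = ennreal (t powr (g - 1) * l powr (?N / 2 + s - 1)) *
             ennreal ((pi / (l + t)) powr (?N / 2) * exp (- (l * t / (l + t) * (norm x)\<^sup>2)))"
            by (subst nn_integral_cmult) (simp_all only: nn_integral_gaussian_conv[OF l tp], measurable)
          finally show ?thesis using tp by simp
        qed simp
      qed
      \<comment> \<open>The substitution t = l c, after which the total power of l is b - 1.\<close>
      also have "\<dots> = ennreal l * (\<integral>\<^sup>+c\<in>{0<..}. ennreal ((l * c) powr (g - 1) * l powr (?N / 2 + s - 1)) *
           ennreal ((pi / (l + l * c)) powr (?N / 2) * exp (- (l * (l * c) / (l + l * c) * (norm x)\<^sup>2))) \<partial>lborel)"
        by (rule nn_integral_half_line_scale) (use l in auto)
      also have "\<dots> = (\<integral>\<^sup>+c. ennreal l * (ennreal ((l * c) powr (g - 1) * l powr (?N / 2 + s - 1)) *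
           ennreal ((pi / (l + l * c)) powr (?N / 2) * exp (- (l * (l * c) / (l + l * c) * (norm x)\<^sup>2))) * indicator {0<..} c) \<partial>lborel)"
        by (rule nn_integral_cmult[symmetric]) measurable
      also have "\<dots> = (\<integral>\<^sup>+c. ennreal (pi powr (?N / 2)) * (ennreal (c powr (g - 1) * (1 + c) powr (- (?N / 2))) * indicator {0<..} c
       * (ennreal (l powr (b - 1) * exp (- (l * (c / (1 + c)) * (norm x)\<^sup>2))) * indicator {0<..<M} l)) \<partial>lborel)"
      proof (rule nn_integral_cong)
        fix c :: real
        show "ennreal l * (ennreal ((l * c) powr (g - 1) * l powr (?N / 2 + s - 1)) *
           ennreal ((pi / (l + l * c)) powr (?N / 2) * exp (- (l * (l * c) / (l + l * c) * (norm x)\<^sup>2))) * indicator {0<..} c)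
          = ennreal (pi powr (?N / 2)) * (ennreal (c powr (g - 1) * (1 + c) powr (- (?N / 2))) * indicator {0<..} c
       * (ennreal (l powr (b - 1) * exp (- (l * (c / (1 + c)) * (norm x)\<^sup>2))) * indicator {0<..<M} l))"
        proof (cases "c > 0")
          case c: True
          have lc: "l + l * c = l * (1 + c)" by (simp add: algebra_simps)
          have e1: "l * (l * c) / (l + l * c) = l * (c / (1 + c))"
            unfolding lc using l by simp
          from lc have e2: "(pi / (l + l * c)) powr (?N / 2) = pi powr (?N / 2) * (l powr (- (?N / 2)) * (1 + c) powr (- (?N / 2)))"
            using l c by (simp add: powr_divide powr_mult powr_minus_divide)
          have e3: "l * ((l * c) powr (g - 1) * l powr (?N / 2 + s - 1)) * l powr (- (?N / 2)) = c powr (g - 1) * l powr (b - 1)"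
          proof -
            have "b - 1 = 1 + (g - 1) + (?N / 2 + s - 1) + - (?N / 2)" by (simp add: b_def g_def field_simps)
            then have "l powr (b - 1) = l * l powr (g - 1) * l powr (?N / 2 + s - 1) * l powr (- (?N / 2))"
              using l by (simp only: powr_add) simp
            then show ?thesis by (simp add: powr_mult)
          qed
          have "l * (((l * c) powr (g - 1) * l powr (?N / 2 + s - 1)) * ((pi / (l + l * c)) powr (?N / 2) * exp (- (l * (l * c) / (l + l * c) * (norm x)\<^sup>2))))
             = pi powr (?N / 2) * ((c powr (g - 1) * (1 + c) powr (- (?N / 2))) * (l powr (b - 1) * exp (- (l * (c / (1 + c)) * (norm x)\<^sup>2))))"
            (is "?L = ?R")
          proof -
            have "?L = pi powr (?N / 2) * (l * ((l * c) powr (g - 1) * l powr (?N / 2 + s - 1)) * l powr (- (?N / 2))) * (1 + c) powr (- (?N / 2))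
               * exp (- (l * (c / (1 + c)) * (norm x)\<^sup>2))"
              unfolding e1 e2 by (simp only: mult_ac)
            then show ?thesis unfolding e3 by (simp only: mult_ac)
          qed
          then show ?thesis using True c l
            by (simp add: ennreal_mult'[symmetric] del: times_divide_eq_right)
        qed simp
      qed
      finally show ?thesis .
    qed simp
  qed
  also have "\<dots> = (\<integral>\<^sup>+c. (\<integral>\<^sup>+l. ennreal (pi powr (?N / 2)) * (ennreal (c powr (g - 1) * (1 + c) powr (- (?N / 2))) * indicator {0<..} c
       * (ennreal (l powr (b - 1) * exp (- (l * (c / (1 + c)) * (norm x)\<^sup>2))) * indicator {0<..<M} l)) \<partial>lborel) \<partial>lborel)"
    by (rule lborel_pair.Fubini') measurable
  also have "\<dots> = (\<integral>\<^sup>+c. ennreal (pi powr (?N / 2)) * (ennreal (c powr (g - 1) * (1 + c) powr (- (?N / 2))) * indicator {0<..} c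
       * hardy_profile b M (c / (1 + c)) x) \<partial>lborel)"
    unfolding hardy_profile_def
    by (intro nn_integral_cong, subst nn_integral_cmult, simp, subst nn_integral_cmult) auto
  also have "\<dots> = ennreal (pi powr (?N / 2)) * (\<integral>\<^sup>+c. ennreal (c powr (g - 1) * (1 + c) powr (- (?N / 2))) * indicator {0<..} c
       * hardy_profile b M (c / (1 + c)) x \<partial>lborel)"
    by (rule nn_integral_cmult) measurable
  finally have eq: "?L = ennreal A * (ennreal (pi powr (?N / 2)) * (\<integral>\<^sup>+c. ennreal (c powr (g - 1) * (1 + c) powr (- (?N / 2))) * indicator {0<..} c
       * hardy_profile b M (c / (1 + c)) x \<partial>lborel))" .
  have le: "(\<integral>\<^sup>+c. ennreal (c powr (g - 1) * (1 + c) powr (- (?N / 2))) * indicator {0<..} c * hardy_profile b M (c / (1 + c)) x \<partial>lborel)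
     \<le> (\<integral>\<^sup>+c\<in>{0<..}. ennreal (c powr (g - 1) * (1 + c) powr (- g)) * hardy_profile b M c x \<partial>lborel)"
  proof (rule nn_integral_mono)
    fix c :: real
    show "ennreal (c powr (g - 1) * (1 + c) powr (- (?N / 2))) * indicator {0<..} c * hardy_profile b M (c / (1 + c)) x
      \<le> ennreal (c powr (g - 1) * (1 + c) powr (- g)) * hardy_profile b M c x * indicator {0<..} c"
    proof (cases "c > 0")
      case c: True
      have "ennreal (c powr (g - 1) * (1 + c) powr (- (?N / 2))) * hardy_profile b M (c / (1 + c)) x
        \<le> ennreal (c powr (g - 1) * (1 + c) powr (- (?N / 2))) * (ennreal ((1 + c) powr b) * hardy_profile b M c x)"
        using c by (intro mult_left_mono hardy_profile_scale) auto
      also have "\<dots> = ennreal (c powr (g - 1) * ((1 + c) powr (- (?N / 2)) * (1 + c) powr b)) * hardy_profile b M c x"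
        by (simp add: ennreal_mult' mult.assoc)
      also have "(1 + c) powr (- (?N / 2)) * (1 + c) powr b = (1 + c) powr (- g)"
      proof -
        have "- (?N / 2) + b = - g" by (simp add: b_def g_def field_simps)
        then show ?thesis unfolding powr_add[symmetric] by simp
      qed
      finally show ?thesis using c by simp
    qed simp
  qed
  have "?L \<le> ennreal A * (ennreal (pi powr (?N / 2)) *
      (\<integral>\<^sup>+c\<in>{0<..}. ennreal (c powr (g - 1) * (1 + c) powr (- g)) * hardy_profile b M c x \<partial>lborel))"
    unfolding eq by (intro mult_left_mono le) auto
  also have "\<dots> = ennreal (A * pi powr (?N / 2)) *
      (\<integral>\<^sup>+c\<in>{0<..}. ennreal (c powr (g - 1) * (1 + c) powr (- g)) * hardy_profile b M c x \<partial>lborel)"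
    unfolding ennreal_mult'[OF A] by (rule mult.assoc[symmetric])
  finally show ?thesis unfolding A_def by simp
qed

text \<open>The energy without its constant and as an iterated integral, the form delivered by the
  Schur test and by the product rule.\<close>

definition gagliardo :: "real \<Rightarrow> ('a::euclidean_space \<Rightarrow> real) \<Rightarrow> ennreal" where
  "gagliardo s u = (\<integral>\<^sup>+x. (\<integral>\<^sup>+y. ennreal (\<bar>u x - u y\<bar>\<^sup>2 / norm (x - y) powr (real DIM('a) + 2 * s)) \<partial>lebesgue) \<partial>lebesgue)"

lemma ext_energy_eq:
  fixes u :: "'a::euclidean_space \<Rightarrow> real"
  assumes [measurable]: "u \<in> borel_measurable lebesgue"
  shows "ext_energy s u = ennreal (C_const TYPE('a) s / 2) * gagliardo s u"
  unfolding ext_energy_def gagliardo_def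
  by (subst lebesgue.nn_integral_fst[symmetric]) auto

text \<open>The mass of the cut kernel minus the bound for its convolution, with the subtraction
  carried out under the c-integral. In this form it is visibly nonnegative and increasing in
  \<open>M\<close>, although both quantities diverge as \<open>M\<close> grows.\<close>

definition hardy_defect :: "real \<Rightarrow> real \<Rightarrow> 'a::euclidean_space \<Rightarrow> ennreal" where
  "hardy_defect s M x = (let g = (real DIM('a) - 2 * s) / 4; b = (real DIM('a) + 2 * s) / 4 in
     ennreal (norm x powr (2 * g) * pi powr (real DIM('a) / 2) / Gamma g) *
       (\<integral>\<^sup>+c\<in>{0<..}. ennreal (c powr (g - 1) * (1 - (1 + c) powr (- g))) * hardy_profile b M c x \<partial>lborel))"

lemma borel_measurable_hardy_defect [measurable]: "hardy_defect s M \<in> borel_measurable borel"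
  unfolding hardy_defect_def[abs_def] Let_def by measurable

text \<open>Without the factor (1 + c)^(-g) the c-integral is, up to the prefactor, the mass of the
  cut kernel. This puts mass and convolution under one integral.\<close>

lemma hardy_profile_integral:
  fixes x :: "'a::euclidean_space"
  assumes s: "0 < s" and N: "real DIM('a) > 2 * s" and M: "M > 0" and x: "x \<noteq> 0"
  defines "g \<equiv> (real DIM('a) - 2 * s) / 4" and "b \<equiv> (real DIM('a) + 2 * s) / 4"
  shows "(\<integral>\<^sup>+c\<in>{0<..}. ennreal (c powr (g - 1)) * hardy_profile b M c x \<partial>lborel)
     = ennreal (Gamma g * norm x powr (- (2 * g)) * (M powr s / s))"
proof -
  have g: "g > 0" using N by (simp add: g_def)
  have G: "Gamma g > 0" using g by simp
  let ?k = "\<lambda>c l. ennreal (c powr (g - 1)) * indicator {0<..} c * (ennreal (l powr (b - 1) * exp (- (l * c * (norm x)\<^sup>2))) * indicator {0<..<M} l)"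
  have "(\<integral>\<^sup>+c\<in>{0<..}. ennreal (c powr (g - 1)) * hardy_profile b M c x \<partial>lborel)
      = (\<integral>\<^sup>+c. (\<integral>\<^sup>+l. ?k c l \<partial>lborel) \<partial>lborel)"
    unfolding hardy_profile_def
    by (intro nn_integral_cong, subst nn_integral_cmult) (auto simp: mult_ac)
  also have "\<dots> = (\<integral>\<^sup>+l. (\<integral>\<^sup>+c. ?k c l \<partial>lborel) \<partial>lborel)"
    by (rule lborel_pair.Fubini') measurable
  also have "\<dots> = (\<integral>\<^sup>+l. ennreal (Gamma g * norm x powr (- (2 * g))) * (ennreal (l powr (s - 1)) * indicator {0<..<M} l) \<partial>lborel)"
  proof (rule nn_integral_cong)
    fix l :: real
    show "(\<integral>\<^sup>+c. ?k c l \<partial>lborel) = ennreal (Gamma g * norm x powr (- (2 * g))) * (ennreal (l powr (s - 1)) * indicator {0<..<M} l)"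
    proof (cases "l \<in> {0<..<M}")
      case True
      then have l: "l > 0" by simp
      have "(\<integral>\<^sup>+c. ?k c l \<partial>lborel) = (\<integral>\<^sup>+c. ennreal (l powr (b - 1)) * (ennreal (c powr (g - 1) * exp (- ((l * (norm x)\<^sup>2) * c))) * indicator {0<..} c) \<partial>lborel)"
        using True by (intro nn_integral_cong) (auto simp: indicator_def ennreal_mult'[symmetric] mult_ac)
      also have "\<dots> = ennreal (l powr (b - 1)) * ennreal (Gamma g * (l * (norm x)\<^sup>2) powr (- g))"
        using l x g nn_integral_Gamma_scaled[of g "l * (norm x)\<^sup>2"] by (subst nn_integral_cmult) auto
      also have "(l * (norm x)\<^sup>2) powr (- g) = l powr (- g) * norm x powr (- (2 * g))"
        using x by (simp add: powr_mult powr_powr flip: powr_numeral)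
      also have "ennreal (l powr (b - 1)) * ennreal (Gamma g * (l powr (- g) * norm x powr (- (2 * g))))
          = ennreal (Gamma g * norm x powr (- (2 * g))) * ennreal (l powr (b - 1) * l powr (- g))"
        using G by (simp add: ennreal_mult'[symmetric] mult_ac)
      also have "l powr (b - 1) * l powr (- g) = l powr (s - 1)"
      proof -
        have "(b - 1) + - g = s - 1" by (simp add: b_def g_def field_simps)
        then show ?thesis by (simp only: powr_add[symmetric])
      qed
      finally show ?thesis using True by simp
    qed simp
  qed
  also have "\<dots> = ennreal (Gamma g * norm x powr (- (2 * g))) * ennreal (M powr s / s)"
    using nn_integral_powr_cut[OF s M] by (subst nn_integral_cmult) auto
  also have "\<dots> = ennreal (Gamma g * norm x powr (- (2 * g)) * (M powr s / s))"
    using G by (subst ennreal_mult') auto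
  finally show ?thesis .
qed

text \<open>The weights (1 + c)^(-g) and 1 - (1 + c)^(-g) add up to 1, and
  \<open>hardy_profile_integral\<close> evaluates the sum to the total mass. This is the hypothesis
  on \<open>D\<close> in the Schur test.\<close>

lemma cut_kernel_conv_plus_defect:
  fixes x :: "'a::euclidean_space"
  assumes s: "0 < s" and N: "real DIM('a) > 2 * s" and M: "M > 0" and x: "x \<noteq> 0"
  defines "w \<equiv> \<lambda>y::'a. norm y powr (- (2 * ((real DIM('a) - 2 * s) / 4)))"
  shows "(\<integral>\<^sup>+y. ennreal (w y / w x) * cut_kernel s M (x - y) \<partial>lborel) + hardy_defect s M x
    \<le> ennreal (pi powr (real DIM('a) / 2)) * ennreal (M powr s / s)"
proof -
  define g where "g = (real DIM('a) - 2 * s) / 4"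
  define b where "b = (real DIM('a) + 2 * s) / 4"
  let ?A = "norm x powr (2 * g) * pi powr (real DIM('a) / 2) / Gamma g"
  have g: "g > 0" using N by (simp add: g_def)
  have G: "Gamma g > 0" using g by simp
  have "(\<integral>\<^sup>+y. ennreal (w y / w x) * cut_kernel s M (x - y) \<partial>lborel) + hardy_defect s M x
     \<le> ennreal ?A * (\<integral>\<^sup>+c\<in>{0<..}. ennreal (c powr (g - 1) * (1 + c) powr (- g)) * hardy_profile b M c x \<partial>lborel)
      + ennreal ?A * (\<integral>\<^sup>+c\<in>{0<..}. ennreal (c powr (g - 1) * (1 - (1 + c) powr (- g))) * hardy_profile b M c x \<partial>lborel)"
    using cut_kernel_conv_le[OF N M x]
    by (intro add_mono) (auto simp: w_def hardy_defect_def Let_def g_def b_def)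
  also have "\<dots> = ennreal ?A * (\<integral>\<^sup>+c. ennreal (c powr (g - 1) * (1 + c) powr (- g)) * hardy_profile b M c x * indicator {0<..} c
      + ennreal (c powr (g - 1) * (1 - (1 + c) powr (- g))) * hardy_profile b M c x * indicator {0<..} c \<partial>lborel)"
    by (subst nn_integral_add) (auto simp: distrib_left)
  also have "\<dots> = ennreal ?A * (\<integral>\<^sup>+c\<in>{0<..}. ennreal (c powr (g - 1)) * hardy_profile b M c x \<partial>lborel)"
  proof (rule arg_cong2[where f="(*)", OF refl], rule nn_integral_cong)
    fix c :: real
    have "(1 + c) powr (- g) \<le> 1" if "c > 0"
      using that g by (simp add: powr_minus inverse_le_1_iff ge_one_powr_ge_zero)
    then have "ennreal (c powr (g - 1) * (1 + c) powr (- g)) + ennreal (c powr (g - 1) * (1 - (1 + c) powr (- g)))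
      = ennreal (c powr (g - 1))" if "c > 0"
      using that by (subst ennreal_plus[symmetric]) (auto simp: algebra_simps)
    then show "ennreal (c powr (g - 1) * (1 + c) powr (- g)) * hardy_profile b M c x * indicator {0<..} c
      + ennreal (c powr (g - 1) * (1 - (1 + c) powr (- g))) * hardy_profile b M c x * indicator {0<..} c
      = ennreal (c powr (g - 1)) * hardy_profile b M c x * indicator {0<..} c"
      by (cases "c > 0") (auto simp: distrib_right[symmetric])
  qed
  also have "\<dots> = ennreal ?A * ennreal (Gamma g * norm x powr (- (2 * g)) * (M powr s / s))"
    unfolding g_def b_def hardy_profile_integral[OF s N M x] ..
  also have "\<dots> = ennreal (pi powr (real DIM('a) / 2)) * ennreal (M powr s / s)"
    using G x s M by (simp add: ennreal_mult'[symmetric] powr_minus divide_simps)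
  finally show ?thesis .
qed

section \<open>Removing the cut: the limit of the defect and the sharp constant\<close>

lemma SUP_hardy_profile:
  assumes c: "c > 0" and x: "x \<noteq> 0" and b: "b > 0"
  shows "(SUP n. hardy_profile b (real (Suc n)) c x) = ennreal (Gamma b * (c * (norm x)\<^sup>2) powr (- b))"
proof -
  have inc: "incseq (\<lambda>n l. ennreal (l powr (b - 1) * exp (- (l * c * (norm x)\<^sup>2))) * indicator {0<..<real (Suc n)} l)"
    by (auto simp: incseq_def le_fun_def indicator_def intro!: mult_left_mono)
  have "(SUP n. hardy_profile b (real (Suc n)) c x)
     = (\<integral>\<^sup>+l. (SUP n. ennreal (l powr (b - 1) * exp (- (l * c * (norm x)\<^sup>2))) * indicator {0<..<real (Suc n)} l) \<partial>lborel)"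
    unfolding hardy_profile_def by (rule nn_integral_monotone_convergence_SUP[symmetric, OF inc]) auto
  also have "\<dots> = (\<integral>\<^sup>+l\<in>{0<..}. ennreal (l powr (b - 1) * exp (- ((c * (norm x)\<^sup>2) * l))) \<partial>lborel)"
  proof (rule nn_integral_cong)
    fix l :: real
    obtain n where n: "l < real (Suc n)" using reals_Archimedean2[of l] by (metis less_trans of_nat_less_iff lessI)
    have "(SUP n. ennreal (l powr (b - 1) * exp (- (l * c * (norm x)\<^sup>2))) * indicator {0<..<real (Suc n)} l)
      = ennreal (l powr (b - 1) * exp (- (l * c * (norm x)\<^sup>2))) * indicator {0<..} l"
      by (rule antisym[OF SUP_least SUP_upper2[of n]]) (use n in \<open>auto simp: indicator_def\<close>)
    then show "(SUP n. ennreal (l powr (b - 1) * exp (- (l * c * (norm x)\<^sup>2))) * indicator {0<..<real (Suc n)} l)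
      = ennreal (l powr (b - 1) * exp (- ((c * (norm x)\<^sup>2) * l))) * indicator {0<..} l"
      by (simp add: mult_ac)
  qed
  also have "\<dots> = ennreal (Gamma b * (c * (norm x)\<^sup>2) powr (- b))"
    using c x b by (intro nn_integral_Gamma_scaled) auto
  finally show ?thesis .
qed

lemma hardy_profile_mono: "M \<le> M' \<Longrightarrow> hardy_profile b M c x \<le> hardy_profile b M' c x"
  unfolding hardy_profile_def by (intro nn_integral_mono) (auto simp: indicator_def)

lemma hardy_defect_mono: "M \<le> M' \<Longrightarrow> hardy_defect s M x \<le> hardy_defect s M' x"
  unfolding hardy_defect_def Let_def
  by (intro mult_left_mono nn_integral_mono mult_right_mono hardy_profile_mono) auto

text \<open>The limiting profile is Gamma(b) (c |x|^2)^(-b), and g - 1 - b = - 1 - s turns the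
  c-integral into \<open>nn_integral_one_minus_shifted_powr\<close>. Since g + s = b, that integral
  contributes another Gamma(b), whence the square.\<close>

lemma SUP_hardy_defect:
  fixes x :: "'a::euclidean_space"
  assumes s: "0 < s" "s < 1" and N: "real DIM('a) > 2 * s" and x: "x \<noteq> 0"
  defines "g \<equiv> (real DIM('a) - 2 * s) / 4" and "b \<equiv> (real DIM('a) + 2 * s) / 4"
  shows "(SUP n. hardy_defect s (real (Suc n)) x)
    = ennreal (pi powr (real DIM('a) / 2) * (Gamma b)\<^sup>2 * Gamma (1 - s) / (s * (Gamma g)\<^sup>2) / norm x powr (2 * s))"
proof -
  let ?A = "norm x powr (2 * g) * pi powr (real DIM('a) / 2) / Gamma g"
  have g: "g > 0" using N by (simp add: g_def)
  have b: "b > 0" using s by (simp add: b_def add_nonneg_pos)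
  have G: "Gamma g > 0" "Gamma b > 0" "Gamma (1 - s) > 0" using g b s by auto
  let ?f = "\<lambda>n c. ennreal (c powr (g - 1) * (1 - (1 + c) powr (- g))) * hardy_profile b (real (Suc n)) c x * indicator {0<..} c"
  have inc: "incseq ?f"
    by (auto simp: incseq_def le_fun_def intro!: mult_right_mono mult_left_mono hardy_profile_mono)
  have "(SUP n. hardy_defect s (real (Suc n)) x) = ennreal ?A * (SUP n. \<integral>\<^sup>+c. ?f n c \<partial>lborel)"
    unfolding hardy_defect_def Let_def g_def b_def by (rule SUP_mult_left_ennreal[symmetric])
  also have "(SUP n. \<integral>\<^sup>+c. ?f n c \<partial>lborel) = (\<integral>\<^sup>+c. (SUP n. ?f n c) \<partial>lborel)"
    by (rule nn_integral_monotone_convergence_SUP[symmetric, OF inc]) measurable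
  also have "\<dots> = (\<integral>\<^sup>+c. ennreal (Gamma b * norm x powr (- (2 * b))) *
      (ennreal (c powr (- 1 - s) * (1 - (1 + c) powr (- g))) * indicator {0<..} c) \<partial>lborel)"
  proof (rule nn_integral_cong)
    fix c :: real
    show "(SUP n. ?f n c) = ennreal (Gamma b * norm x powr (- (2 * b))) *
      (ennreal (c powr (- 1 - s) * (1 - (1 + c) powr (- g))) * indicator {0<..} c)"
    proof (cases "c > 0")
      case c: True
      have le1: "(1 + c) powr (- g) \<le> 1"
        using c g by (simp add: powr_minus inverse_le_1_iff ge_one_powr_ge_zero)
      have "(SUP n. ?f n c) = ennreal (c powr (g - 1) * (1 - (1 + c) powr (- g))) * (SUP n. hardy_profile b (real (Suc n)) c x)"
        using c by (simp add: SUP_mult_left_ennreal)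
      also have "\<dots> = ennreal (c powr (g - 1) * (1 - (1 + c) powr (- g))) * ennreal (Gamma b * (c * (norm x)\<^sup>2) powr (- b))"
        unfolding SUP_hardy_profile[OF c x b] ..
      also have "(c * (norm x)\<^sup>2) powr (- b) = c powr (- b) * norm x powr (- (2 * b))"
        using x by (simp add: powr_mult powr_powr flip: powr_numeral)
      also have "ennreal (c powr (g - 1) * (1 - (1 + c) powr (- g))) * ennreal (Gamma b * (c powr (- b) * norm x powr (- (2 * b))))
         = ennreal (Gamma b * norm x powr (- (2 * b))) * ennreal ((c powr (g - 1) * c powr (- b)) * (1 - (1 + c) powr (- g)))"
        using le1 G by (simp add: ennreal_mult'[symmetric] mult_ac)
      also have "c powr (g - 1) * c powr (- b) = c powr (- 1 - s)"
      proof -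
        have "(g - 1) + - b = - 1 - s" by (simp add: b_def g_def field_simps)
        then show ?thesis by (simp only: powr_add[symmetric])
      qed
      finally show ?thesis using c by simp
    qed simp
  qed
  also have "\<dots> = ennreal (Gamma b * norm x powr (- (2 * b))) * ennreal (Gamma (g + s) * Gamma (1 - s) / (s * Gamma g))"
    using nn_integral_one_minus_shifted_powr[OF s g] by (subst nn_integral_cmult) auto
  also have "g + s = b" by (simp add: g_def b_def field_simps)
  also have "ennreal ?A * (ennreal (Gamma b * norm x powr (- (2 * b))) * ennreal (Gamma b * Gamma (1 - s) / (s * Gamma g)))
     = ennreal (pi powr (real DIM('a) / 2) * (Gamma b)\<^sup>2 * Gamma (1 - s) / (s * (Gamma g)\<^sup>2) * (norm x powr (2 * g) * norm x powr (- (2 * b))))"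
    using G s by (simp add: ennreal_mult'[symmetric] power2_eq_square mult_ac)
  also have "norm x powr (2 * g) * norm x powr (- (2 * b)) = norm x powr (- (2 * s))"
  proof -
    have "2 * g + - (2 * b) = - (2 * s)" by (simp add: b_def g_def field_simps)
    then show ?thesis unfolding powr_add[symmetric] by simp
  qed
  finally show ?thesis by (simp only: powr_minus_divide times_divide_eq_right mult_1_right)
qed

text \<open>The Schur test is applied for every cut. By \<open>cut_kernel_le\<close> its right side
  is bounded independently of the cut, so monotone convergence can be used on the left. Square
  integrability serves the cancellation inside the Schur test; \<open>Hdot_hardy\<close> removes it
  afterwards.\<close>

lemma hardy_L2:
  fixes u :: "'a::euclidean_space \<Rightarrow> real"
  assumes s: "0 < s" "s < 1" and N: "real DIM('a) > 2 * s"
    and u[measurable]: "u \<in> borel_measurable lebesgue" and L2: "(\<integral>\<^sup>+x. ennreal ((u x)\<^sup>2) \<partial>lebesgue) < \<infinity>"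
  shows "ennreal (Hardy_const TYPE('a) s) * (\<integral>\<^sup>+x. ennreal ((u x)\<^sup>2 / norm x powr (2 * s)) \<partial>lebesgue) \<le> ext_energy s u"
proof -
  let ?N = "real DIM('a)"
  define g where "g = (?N - 2 * s) / 4"
  define b where "b = (?N + 2 * s) / 4"
  define G where "G = Gamma (?N / 2 + s)"
  define H where "H = (\<integral>\<^sup>+x. ennreal ((u x)\<^sup>2 / norm x powr (2 * s)) \<partial>lebesgue)"
  define L where "L = pi powr (?N / 2) * (Gamma b)\<^sup>2 * Gamma (1 - s) / (s * (Gamma g)\<^sup>2)"
  have G: "G > 0" using s by (simp add: G_def add_nonneg_pos)
  have Gg: "Gamma g > 0" "Gamma b > 0" "Gamma (1 - s) > 0" using N s by (auto simp: g_def b_def add_nonneg_pos)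
  have L: "L \<ge> 0" using s Gg by (simp add: L_def)
  have bound: "2 * (\<integral>\<^sup>+x. ennreal ((u x)\<^sup>2) * hardy_defect s (real (Suc n)) x \<partial>lebesgue) \<le> ennreal G * gagliardo s u" for n
  proof -
    let ?M = "real (Suc n)"
    have "2 * (\<integral>\<^sup>+x. ennreal ((u x)\<^sup>2) * hardy_defect s ?M x \<partial>lebesgue)
      \<le> (\<integral>\<^sup>+x. (\<integral>\<^sup>+y. ennreal (\<bar>u x - u y\<bar>\<^sup>2) * cut_kernel s ?M (x - y) \<partial>lebesgue) \<partial>lebesgue)"
    proof (rule schur_test_lower_bound[where \<omega>="\<lambda>y. norm y powr (- (2 * ((?N - 2 * s) / 4)))"])
      show "(\<integral>\<^sup>+y. ennreal (norm y powr (- (2 * ((?N - 2 * s) / 4))) / norm x powr (- (2 * ((?N - 2 * s) / 4)))) * cut_kernel s ?M (x - y) \<partial>lborel) + hardy_defect s ?M x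
         \<le> ennreal (pi powr (?N / 2)) * ennreal (?M powr s / s)" if "x \<noteq> 0" for x :: 'a
        by (rule cut_kernel_conv_plus_defect[OF s(1) N _ that]) simp
    qed (use s L2 in \<open>auto simp: nn_integral_cut_kernel cut_kernel_uminus ennreal_mult_less_top\<close>)
    also have "\<dots> \<le> (\<integral>\<^sup>+x. (\<integral>\<^sup>+y. ennreal G * ennreal (\<bar>u x - u y\<bar>\<^sup>2 / norm (x - y) powr (?N + 2 * s)) \<partial>lebesgue) \<partial>lebesgue)"
    proof (intro nn_integral_mono)
      fix x y :: 'a
      show "ennreal (\<bar>u x - u y\<bar>\<^sup>2) * cut_kernel s ?M (x - y) \<le> ennreal G * ennreal (\<bar>u x - u y\<bar>\<^sup>2 / norm (x - y) powr (?N + 2 * s))"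
      proof (cases "x = y")
        case False
        then have "ennreal (\<bar>u x - u y\<bar>\<^sup>2) * cut_kernel s ?M (x - y) \<le> ennreal (\<bar>u x - u y\<bar>\<^sup>2) * ennreal (G / norm (x - y) powr (?N + 2 * s))"
          unfolding G_def using s by (intro mult_left_mono cut_kernel_le) auto
        then show ?thesis using G by (simp add: ennreal_mult'[symmetric] mult_ac)
      qed simp
    qed
    also have "\<dots> = ennreal G * gagliardo s u"
      unfolding gagliardo_def by (simp add: nn_integral_cmult)
    finally show ?thesis .
  qed
  have inc: "incseq (\<lambda>n x. ennreal ((u x)\<^sup>2) * hardy_defect s (real (Suc n)) x)"
    by (auto simp: incseq_def le_fun_def intro!: mult_left_mono hardy_defect_mono)
  have ae0: "AE x in lebesgue. x \<noteq> (0::'a)"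
    by (rule AE_completion) (rule AE_lborel_singleton)
  have "ennreal (2 * L) * H = 2 * (\<integral>\<^sup>+x. ennreal L * ennreal ((u x)\<^sup>2 / norm x powr (2 * s)) \<partial>lebesgue)"
    using L by (simp add: H_def nn_integral_cmult ennreal_mult' mult.assoc)
  also have "(\<integral>\<^sup>+x. ennreal L * ennreal ((u x)\<^sup>2 / norm x powr (2 * s)) \<partial>lebesgue)
     = (\<integral>\<^sup>+x. (SUP n. ennreal ((u x)\<^sup>2) * hardy_defect s (real (Suc n)) x) \<partial>lebesgue)"
  proof (rule nn_integral_cong_AE, use ae0 in eventually_elim)
    fix x :: 'a assume x: "x \<noteq> 0"
    have "(SUP n. ennreal ((u x)\<^sup>2) * hardy_defect s (real (Suc n)) x) = ennreal ((u x)\<^sup>2) * ennreal (L / norm x powr (2 * s))"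
      by (simp only: SUP_mult_left_ennreal[symmetric] SUP_hardy_defect[OF s N x] L_def g_def b_def)
    then show "ennreal L * ennreal ((u x)\<^sup>2 / norm x powr (2 * s)) = (SUP n. ennreal ((u x)\<^sup>2) * hardy_defect s (real (Suc n)) x)"
      using L by (simp add: ennreal_mult'[symmetric] mult_ac)
  qed
  also have "\<dots> = (SUP n. \<integral>\<^sup>+x. ennreal ((u x)\<^sup>2) * hardy_defect s (real (Suc n)) x \<partial>lebesgue)"
    by (rule nn_integral_monotone_convergence_SUP[OF inc]) auto
  also have "2 * \<dots> = (SUP n. 2 * \<integral>\<^sup>+x. ennreal ((u x)\<^sup>2) * hardy_defect s (real (Suc n)) x \<partial>lebesgue)"
    by (rule SUP_mult_left_ennreal)
  also have "\<dots> \<le> ennreal G * gagliardo s u"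
    by (rule SUP_least) (rule bound)
  finally have main: "ennreal (2 * L) * H \<le> ennreal G * gagliardo s u" .
  define C where "C = C_const TYPE('a) s"
  have C: "C > 0" using C_const_pos[OF s] by (simp add: C_def)
  \<comment> \<open>The powers of pi, \<open>s\<close>, Gamma(1 - s) and Gamma(N/2 + s) cancel, and
    the 2 of the Schur test meets the 1/2 in the energy.\<close>
  have "C / (2 * G) * (2 * L) = Hardy_const TYPE('a) s"
  proof -
    have p4: "2 powr (2 * s) = 4 powr s" using powr_powr[of 2 2 s] by simp
    define G1 where "G1 = Gamma (1 - s)"
    have "G1 > 0" using Gg by (simp add: G1_def)
    then show ?thesis
      unfolding C_def C_const_eq[OF s] L_def Hardy_const_def G_def[symmetric] g_def[symmetric]
        b_def[symmetric] p4 G1_def[symmetric]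
      using Gg(1,2) G s by simp
  qed
  then have e1: "ennreal (C / (2 * G)) * ennreal (2 * L) = ennreal (Hardy_const TYPE('a) s)"
    using C G by (subst ennreal_mult'[symmetric]) auto
  have e2: "ennreal (C / (2 * G)) * ennreal G = ennreal (C / 2)"
    using C G by (subst ennreal_mult'[symmetric]) auto
  have "ennreal (Hardy_const TYPE('a) s) * H = ennreal (C / (2 * G)) * (ennreal (2 * L) * H)"
    by (simp only: mult.assoc[symmetric] e1)
  also have "\<dots> \<le> ennreal (C / (2 * G)) * (ennreal G * gagliardo s u)"
    by (intro mult_left_mono main) auto
  also have "\<dots> = ext_energy s u"
    by (simp only: ext_energy_eq[OF u] C_def[symmetric] mult.assoc[symmetric] e2)
  finally show ?thesis by (simp only: H_def)
qed

section \<open>Smooth functions and test functions\<close>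

text \<open>The closure properties are chosen so that the class is stable under partial derivatives; hence all
  its members are smooth.\<close>
inductive smooth_gen :: "('a::euclidean_space \<Rightarrow> real) \<Rightarrow> bool" where
  base: "smooth_fun f \<Longrightarrow> smooth_gen f"
| const: "smooth_gen (\<lambda>_. c)"
| coord: "smooth_gen (\<lambda>x. x \<bullet> v)"
| add: "smooth_gen f \<Longrightarrow> smooth_gen g \<Longrightarrow> smooth_gen (\<lambda>x. f x + g x)"
| mult: "smooth_gen f \<Longrightarrow> smooth_gen g \<Longrightarrow> smooth_gen (\<lambda>x. f x * g x)"
| shift: "smooth_gen f \<Longrightarrow> smooth_gen (\<lambda>x. f (x + v))"
| comp: "smooth_gen f \<Longrightarrow> (\<And>x. f x \<in> U) \<Longrightarrow>
     (\<And>n t. t \<in> U \<Longrightarrow> (d n has_real_derivative d (Suc n) t) (at t)) \<Longrightarrow> smooth_gen (\<lambda>x. d (n::nat) (f x))"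

lemma smooth_fun_derivative:
  assumes "smooth_fun f"
  shows "f differentiable (at x)" "b \<in> Basis \<Longrightarrow> smooth_fun (\<lambda>x. frechet_derivative f (at x) b)"
proof -
  have "C_k (Suc k) f" for k using assms unfolding smooth_fun_def by blast
  then have *: "f differentiable (at x)" "b \<in> Basis \<Longrightarrow> C_k k (\<lambda>x. frechet_derivative f (at x) b)" for k x b by auto
  from *(1) show "f differentiable (at x)" .
  from *(2) show "b \<in> Basis \<Longrightarrow> smooth_fun (\<lambda>x. frechet_derivative f (at x) b)" unfolding smooth_fun_def by blast
qed

text \<open>In the case \<open>comp\<close>, \<open>d\<close> lists the successive derivatives of
  the outer function, so the chain rule merely passes from \<open>d n\<close> to
  \<open>d (Suc n)\<close> and stays inside the class.\<close>

lemma smooth_gen_derivative: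
  assumes "smooth_gen f"
  shows "\<exists>f'. (\<forall>x. (f has_derivative f' x) (at x)) \<and> (\<forall>b\<in>Basis. smooth_gen (\<lambda>x. f' x b))"
  using assms
proof induction
  case (base f)
  then show ?case
    using smooth_fun_derivative[OF base] frechet_derivative_works[of f]
    by (intro exI[of _ "\<lambda>x. frechet_derivative f (at x)"]) (auto intro: smooth_gen.base)
next
  case (const c)
  then show ?case by (intro exI[of _ "\<lambda>_ _. 0"]) (auto intro: smooth_gen.const)
next
  case (coord v)
  then show ?case
    by (intro exI[of _ "\<lambda>_ b. b \<bullet> v"]) (auto intro!: smooth_gen.const derivative_eq_intros)
next
  case (add f g)
  then obtain f' g' where "\<forall>x. (f has_derivative f' x) (at x)" "\<forall>b\<in>Basis. smooth_gen (\<lambda>x. f' x b)"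
    "\<forall>x. (g has_derivative g' x) (at x)" "\<forall>b\<in>Basis. smooth_gen (\<lambda>x. g' x b)" by blast
  then show ?case
    by (intro exI[of _ "\<lambda>x b. f' x b + g' x b"]) (auto intro!: smooth_gen.add has_derivative_add)
next
  case (mult f g)
  then obtain f' g' where *: "\<forall>x. (f has_derivative f' x) (at x)" "\<forall>b\<in>Basis. smooth_gen (\<lambda>x. f' x b)"
    "\<forall>x. (g has_derivative g' x) (at x)" "\<forall>b\<in>Basis. smooth_gen (\<lambda>x. g' x b)" by blast
  show ?case
    using * mult.hyps
    by (intro exI[of _ "\<lambda>x b. f x * g' x b + f' x b * g x"])
      (auto intro!: smooth_gen.add smooth_gen.mult has_derivative_mult)
next
  case (shift f v)
  then obtain f' where *: "\<forall>x. (f has_derivative f' x) (at x)" "\<forall>b\<in>Basis. smooth_gen (\<lambda>x. f' x b)" by blast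
  have "((\<lambda>x. f (x + v)) has_derivative f' (x + v)) (at x)" for x
  proof -
    have "((\<lambda>x. x + v) has_derivative (\<lambda>h. h)) (at x)" by (auto intro!: derivative_eq_intros)
    from has_derivative_compose[OF this *(1)[rule_format]] show ?thesis .
  qed
  then show ?case
    using smooth_gen.shift[OF *(2)[rule_format]]
    by (intro exI[of _ "\<lambda>x. f' (x + v)"]) auto
next
  case (comp f U d n)
  then obtain f' where *: "\<forall>x. (f has_derivative f' x) (at x)" "\<forall>b\<in>Basis. smooth_gen (\<lambda>x. f' x b)" by blast
  have "((\<lambda>x. d n (f x)) has_derivative (\<lambda>h. f' x h * d (Suc n) (f x))) (at x)" for x
    by (rule DERIV_compose_FDERIV[OF comp.hyps(3)[OF comp.hyps(2)] *(1)[rule_format]])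
  then show ?case
    using * comp.hyps
    by (intro exI[of _ "\<lambda>x b. f' x b * d (Suc n) (f x)"])
      (auto intro!: smooth_gen.mult smooth_gen.comp[of f U d])
qed

lemma smooth_gen_imp_smooth: "smooth_gen f \<Longrightarrow> smooth_fun f"
proof -
  have "smooth_gen f \<Longrightarrow> C_k k f" for k
  proof (induction k arbitrary: f)
    case 0
    then obtain f' where "\<forall>x. (f has_derivative f' x) (at x)" using smooth_gen_derivative by blast
    then show ?case by (auto intro!: continuous_at_imp_continuous_on has_derivative_continuous)
  next
    case (Suc k)
    then obtain f' where *: "\<forall>x. (f has_derivative f' x) (at x)" "\<forall>b\<in>Basis. smooth_gen (\<lambda>x. f' x b)"
      using smooth_gen_derivative by blast
    then have "frechet_derivative f (at x) = f' x" for x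
      using frechet_derivative_at by metis
    then show ?case using * Suc.IH by (auto simp: differentiable_def)
  qed
  then show "smooth_gen f \<Longrightarrow> smooth_fun f" by (simp add: smooth_fun_def)
qed

lemma smooth_gen_iff: "smooth_gen f \<longleftrightarrow> smooth_fun f"
  using smooth_gen_imp_smooth smooth_gen.base by blast

lemma smooth_const: "smooth_fun (\<lambda>_. c)"
  and smooth_coord: "smooth_fun (\<lambda>x. x \<bullet> v)"
  and smooth_add: "smooth_fun f \<Longrightarrow> smooth_fun g \<Longrightarrow> smooth_fun (\<lambda>x. f x + g x)"
  and smooth_mult: "smooth_fun f \<Longrightarrow> smooth_fun g \<Longrightarrow> smooth_fun (\<lambda>x. f x * g x)"
  and smooth_shift: "smooth_fun f \<Longrightarrow> smooth_fun (\<lambda>x. f (x + v))"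
  unfolding smooth_gen_iff[symmetric] by (fact smooth_gen.intros)+

lemma smooth_powr:
  assumes f: "smooth_fun f" and pos: "\<And>x. f x > 0"
  shows "smooth_fun (\<lambda>x. f x powr p)"
proof -
  \<comment> \<open>The derivative of order \<open>n\<close> of \<open>t powr p\<close>, with its
    falling factorial.\<close>
  define d where "d n t = (\<Prod>i<n. p - real i) * t powr (p - real n)" for n :: nat and t :: real
  have der: "(d n has_real_derivative d (Suc n) t) (at t)" if "t \<in> {0<..}" for n t
  proof -
    have "((\<lambda>t. t powr (p - real n)) has_real_derivative (p - real n) * t powr (p - real n - 1)) (at t)"
      using that by (intro has_real_derivative_powr) auto
    from DERIV_cmult[OF this, of "\<Prod>i<n. p - real i"]
    show ?thesis by (simp add: d_def[abs_def] mult.assoc diff_diff_eq add.commute)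
  qed
  have "smooth_gen (\<lambda>x. d 0 (f x))"
  proof (rule smooth_gen.comp[where U="{0<..}" and d=d and n=0 and f=f])
    show "smooth_gen f" by (rule smooth_gen.base[OF f])
  qed (simp add: pos, erule der)
  then show ?thesis by (simp add: d_def smooth_gen_iff)
qed

lemma smooth_sum: "(\<And>i. i \<in> I \<Longrightarrow> smooth_fun (f i)) \<Longrightarrow> smooth_fun (\<lambda>x. \<Sum>i\<in>I. f i x)"
  by (induction I rule: infinite_finite_induct) (auto intro: smooth_const smooth_add)

lemma smooth_continuous: "smooth_fun f \<Longrightarrow> continuous_on UNIV f"
  unfolding smooth_fun_def by (metis C_k.simps(1))

lemma borel_measurable_smooth: "smooth_fun f \<Longrightarrow> f \<in> borel_measurable borel"
  by (intro borel_measurable_continuous_onI smooth_continuous)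

section \<open>Test functions: support, closure properties and Lipschitz bounds\<close>

lemma test_functionI:
  assumes "smooth_fun f" "\<And>x. f x \<noteq> 0 \<Longrightarrow> norm x \<le> R"
  shows "test_function f"
  unfolding test_function_def
proof
  have "bounded {x. f x \<noteq> 0}" unfolding bounded_iff using assms(2) by blast
  then show "compact (closure {x. f x \<noteq> 0})" by (simp add: compact_closure)
qed fact

lemma test_function_support:
  assumes "test_function f"
  shows "\<exists>R>0. \<forall>x. f x \<noteq> 0 \<longrightarrow> norm x \<le> R"
proof -
  have "bounded {x. f x \<noteq> 0}"
    using assms unfolding test_function_def
    by (intro bounded_subset[OF compact_imp_bounded closure_subset]) simp
  then show ?thesis unfolding bounded_pos by simp
qed

lemma test_function_smooth: "test_function f \<Longrightarrow> smooth_fun f"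
  by (simp add: test_function_def)

lemma test_function_mult_smooth:
  assumes f: "test_function f" and g: "smooth_fun g"
  shows "test_function (\<lambda>x. g x * f x)"
proof -
  obtain R where "\<forall>x. f x \<noteq> 0 \<longrightarrow> norm x \<le> R" using test_function_support[OF f] by blast
  then show ?thesis using f g by (intro test_functionI[of _ R] smooth_mult test_function_smooth[OF f]) auto
qed

lemma test_function_add:
  assumes f: "test_function f" and g: "test_function g"
  shows "test_function (\<lambda>x. f x + g x)"
proof -
  obtain R where R1: "\<forall>x. f x \<noteq> 0 \<longrightarrow> norm x \<le> R" using test_function_support[OF f] by blast
  obtain R' where R2: "\<forall>x. g x \<noteq> 0 \<longrightarrow> norm x \<le> R'" using test_function_support[OF g] by blast
  have "f x + g x \<noteq> 0 \<Longrightarrow> norm x \<le> max R R'" for x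
    using R1[rule_format, of x] R2[rule_format, of x] by (cases "f x = 0") auto
  then show ?thesis using f g by (intro test_functionI[of _ "max R R'"] smooth_add test_function_smooth[OF f] test_function_smooth[OF g]) auto
qed

lemma test_function_diff:
  assumes "test_function f" "test_function g"
  shows "test_function (\<lambda>x. f x - g x)"
  using test_function_add[OF assms(1) test_function_mult_smooth[OF assms(2) smooth_const[of "-1"]]] by simp

lemma test_function_shift:
  assumes f: "test_function f"
  shows "test_function (\<lambda>x. f (x + v))"
proof -
  obtain R where R: "\<forall>x. f x \<noteq> 0 \<longrightarrow> norm x \<le> R" using test_function_support[OF f] by blast
  have "norm x \<le> R + norm v" if "f (x + v) \<noteq> 0" for x
    using R[rule_format, OF that] norm_triangle_ineq4[of "x + v" v] by simp
  then show ?thesis using f by (intro test_functionI[of _ "R + norm v"] smooth_shift test_function_smooth[OF f]) auto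
qed

text \<open>Every partial derivative is continuous and vanishes outside the support ball, hence is
  bounded; the mean value inequality then gives a Lipschitz constant. The two constants are added so
  that one \<open>B\<close> serves both bounds.\<close>

lemma test_function_bounds:
  assumes f: "test_function (f :: 'a::euclidean_space \<Rightarrow> real)"
  shows "\<exists>B>0. (\<forall>x. \<bar>f x\<bar> \<le> B) \<and> (\<forall>x y. \<bar>f x - f y\<bar> \<le> B * norm (x - y))"
proof -
  obtain R where R: "R > 0" "\<forall>x. f x \<noteq> 0 \<longrightarrow> norm x \<le> R" using test_function_support[OF f] by blast
  have bd: "\<exists>B>0. \<forall>x. \<bar>g x\<bar> \<le> B" if g: "smooth_fun g" "\<And>x. norm x > R \<Longrightarrow> g x = 0" for g :: "'a \<Rightarrow> real"
  proof -
    have "compact (g ` cball 0 R)"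
      using smooth_continuous[OF g(1)] by (intro compact_continuous_image) (auto intro: continuous_on_subset)
    then obtain B where B: "B > 0" "\<forall>y\<in>g ` cball 0 R. norm y \<le> B" by (auto dest!: compact_imp_bounded simp: bounded_pos)
    have "\<bar>g x\<bar> \<le> B" for x
      using B g(2)[of x] by (cases "norm x \<le> R") auto
    then show ?thesis using B by blast
  qed
  let ?D = "\<lambda>b x. frechet_derivative f (at x) b"
  have sm: "smooth_fun f" using f by (simp add: test_function_def)
  have zero: "?D b x = 0" if "norm x > R" for b x
  proof -
    have "((\<lambda>_. 0) has_derivative (\<lambda>_. 0)) (at x)" by simp
    then have "(f has_derivative (\<lambda>_. 0)) (at x)"
    proof (rule has_derivative_transform_within_open[where s="- cball 0 R"])
      show "open (- cball 0 R)" by (simp add: closed_cball open_Compl)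
      show "0 = f y" if "y \<in> - cball 0 R" for y using R(2)[rule_format, of y] that by auto
    qed (use that in auto)
    then show ?thesis using frechet_derivative_at by metis
  qed
  have "\<exists>B>0. \<forall>x. \<bar>?D b x\<bar> \<le> B" if "b \<in> Basis" for b
    using that zero by (intro bd smooth_fun_derivative(2)[OF sm]) auto
  then obtain Bd where Bd: "\<And>b x. b \<in> Basis \<Longrightarrow> \<bar>?D b x\<bar> \<le> Bd b" "\<And>b. b \<in> Basis \<Longrightarrow> Bd b > 0" by metis
  have f0: "f x = 0" if "norm x > R" for x
    using R(2)[rule_format, of x] that by (cases "f x = 0") auto
  obtain B0 where B0: "B0 > 0" "\<forall>x. \<bar>f x\<bar> \<le> B0"
    using bd[OF sm f0] by blast
  define L where "L = (\<Sum>b\<in>(Basis::'a set). Bd b)"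
  have L: "L \<ge> 0" unfolding L_def using Bd(2) by (intro sum_nonneg) (auto intro: less_imp_le)
  have der: "(f has_derivative frechet_derivative f (at x)) (at x)" for x
    using smooth_fun_derivative(1)[OF sm] frechet_derivative_works by blast
  have on: "onorm (frechet_derivative f (at x)) \<le> L" for x
  proof (rule onorm_le)
    fix h :: 'a
    interpret bounded_linear "frechet_derivative f (at x)" using der by (rule has_derivative_bounded_linear)
    have "frechet_derivative f (at x) h = frechet_derivative f (at x) (\<Sum>b\<in>Basis. (h \<bullet> b) *\<^sub>R b)"
      by (simp add: euclidean_representation)
    also have "\<dots> = (\<Sum>b\<in>Basis. (h \<bullet> b) * ?D b x)" by (simp add: sum scaleR)
    finally have "\<bar>frechet_derivative f (at x) h\<bar> \<le> (\<Sum>b\<in>Basis. \<bar>(h \<bullet> b) * ?D b x\<bar>)"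
      by simp
    also have "\<dots> \<le> (\<Sum>b\<in>(Basis::'a set). norm h * Bd b)"
      unfolding abs_mult by (intro sum_mono mult_mono Basis_le_norm Bd(1)) auto
    finally show "norm (frechet_derivative f (at x) h) \<le> L * norm h"
      by (simp add: L_def sum_distrib_left mult.commute)
  qed
  have lip: "norm (f x - f y) \<le> L * norm (x - y)" for x y
    by (rule differentiable_bound[of UNIV f "\<lambda>x. frechet_derivative f (at x)"]) (use der on in auto)
  have "\<bar>f x - f y\<bar> \<le> (B0 + L) * norm (x - y)" for x y
    using lip[of x y] B0(1) by (simp add: distrib_right add_increasing)
  moreover have "\<bar>f x\<bar> \<le> B0 + L" for x using B0(2)[rule_format, of x] L by simp
  ultimately show ?thesis using B0(1) L by (intro exI[of _ "B0 + L"]) auto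
qed

section \<open>Commutator kernels and energy estimates\<close>

text \<open>The numerator is a smooth substitute for min(1, a |z|^2) whose Gaussian integrals are
  explicit. The power a^s is the one dictated by scaling.\<close>

lemma nn_integral_damped_kernel:
  assumes s: "0 < s" "s < 1"
  shows "\<exists>\<kappa>\<ge>0. \<forall>a>0. (\<integral>\<^sup>+z. ennreal ((1 - exp (- (a * (norm (z::'a::euclidean_space))\<^sup>2))) / norm z powr (real DIM('a) + 2 * s)) \<partial>lborel)
    \<le> ennreal (\<kappa> * a powr s)"
proof -
  let ?N = "real DIM('a)"
  define m where "m = ?N / 2"
  define G where "G = Gamma (m + s)"
  define I where "I = 4 powr (- s) * Gamma (1 - s) / s"
  define K where "K = pi powr m * (4 * m) powr s * I"
  have m: "m > 0" by (simp add: m_def)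
  have G: "G > 0" using s m by (simp add: G_def)
  have I: "I \<ge> 0" using s by (simp add: I_def)
  have K: "K \<ge> 0" using I by (simp add: K_def)
  have "(\<integral>\<^sup>+z. ennreal ((1 - exp (- (a * (norm (z::'a))\<^sup>2))) / norm z powr (?N + 2 * s)) \<partial>lborel)
     \<le> ennreal (K / G * a powr s)" if a: "a > 0" for a
  proof -
    let ?k = "\<lambda>z x. ennreal (1 - exp (- (a * (norm (z::'a))\<^sup>2))) * (ennreal (x powr (?N / 2 + s - 1) * exp (- (x * (norm z)\<^sup>2))) * indicator {0<..} x)"
    let ?L = "\<integral>\<^sup>+z. ennreal ((1 - exp (- (a * (norm (z::'a))\<^sup>2))) / norm z powr (?N + 2 * s)) \<partial>lborel"
    have "ennreal G * ?L = (\<integral>\<^sup>+z. (\<integral>\<^sup>+x. ?k z x \<partial>lborel) \<partial>lborel)"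
    proof (subst nn_integral_cmult[symmetric], simp, rule nn_integral_cong)
      fix z :: 'a
      show "ennreal G * ennreal ((1 - exp (- (a * (norm z)\<^sup>2))) / norm z powr (?N + 2 * s)) = (\<integral>\<^sup>+x. ?k z x \<partial>lborel)"
      proof (cases "z = 0")
        case False
        have "(\<integral>\<^sup>+x. ?k z x \<partial>lborel) = ennreal (1 - exp (- (a * (norm z)\<^sup>2))) * ennreal (G / norm z powr (?N + 2 * s))"
          using riesz_kernel[OF s(1) False] by (subst nn_integral_cmult) (auto simp: G_def m_def)
        also have "\<dots> = ennreal ((1 - exp (- (a * (norm z)\<^sup>2))) * (G / norm z powr (?N + 2 * s)))"
          using a by (intro ennreal_mult'[symmetric]) auto
        also have "\<dots> = ennreal (G * ((1 - exp (- (a * (norm z)\<^sup>2))) / norm z powr (?N + 2 * s)))"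
          by (simp add: mult_ac)
        also have "\<dots> = ennreal G * ennreal ((1 - exp (- (a * (norm z)\<^sup>2))) / norm z powr (?N + 2 * s))"
          using G by (intro ennreal_mult') auto
        finally show ?thesis ..
      qed auto
    qed
    also have "\<dots> = (\<integral>\<^sup>+x. (\<integral>\<^sup>+z. ?k z x \<partial>lborel) \<partial>lborel)"
      by (rule lborel_pair.Fubini'[symmetric]) measurable
    also have "\<dots> \<le> (\<integral>\<^sup>+x\<in>{0<..}. ennreal (pi powr m * (x powr (s - 1) * (1 - exp (- (m * a / x))))) \<partial>lborel)"
    proof (rule nn_integral_mono)
      fix x :: real
      show "(\<integral>\<^sup>+z. ?k z x \<partial>lborel) \<le> ennreal (pi powr m * (x powr (s - 1) * (1 - exp (- (m * a / x))))) * indicator {0<..} x"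
      proof (cases "x > 0")
        case x: True
        \<comment> \<open>Replacing the power of 1 + a / x by an exponential reduces the x-integral
          to one that has already been evaluated.\<close>
        have ge: "exp (- (m * a / x)) \<le> (1 + a / x) powr (- m)"
        proof -
          have "ln (1 + a / x) \<le> a / x" using a x by (intro ln_add_one_self_le_self) auto
          then have "m * ln (1 + a / x) \<le> m * (a / x)" using m by (intro mult_left_mono) auto
          moreover have "1 + a / x \<noteq> 0" using a x by (simp add: add_pos_pos less_imp_neq[symmetric])
          ultimately show ?thesis by (simp add: powr_def)
        qed
        have e1: "(pi / (x + a)) powr m = (pi / x) powr m * (1 + a / x) powr (- m)"
        proof -
          have "x + a = x * (1 + a / x)" using x by (simp add: field_simps)
          then show ?thesis using x a by (simp add: powr_divide powr_mult powr_minus_divide)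
        qed
        have "(\<integral>\<^sup>+z. ?k z x \<partial>lborel) = (\<integral>\<^sup>+z. ennreal (x powr (m + s - 1)) *
          (ennreal (exp (- (x * (norm (z::'a))\<^sup>2))) - ennreal (exp (- ((x + a) * (norm z)\<^sup>2)))) \<partial>lborel)"
        proof (rule nn_integral_cong)
          fix z :: 'a
          have "exp (- ((x + a) * (norm z)\<^sup>2)) = exp (- (x * (norm z)\<^sup>2)) * exp (- (a * (norm z)\<^sup>2))"
            by (simp add: algebra_simps flip: exp_add)
          then have e: "exp (- (x * (norm z)\<^sup>2)) - exp (- ((x + a) * (norm z)\<^sup>2))
             = (1 - exp (- (a * (norm z)\<^sup>2))) * exp (- (x * (norm z)\<^sup>2))" by (simp add: algebra_simps)
          have "ennreal (exp (- (x * (norm z)\<^sup>2))) - ennreal (exp (- ((x + a) * (norm z)\<^sup>2)))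
             = ennreal ((1 - exp (- (a * (norm z)\<^sup>2))) * exp (- (x * (norm z)\<^sup>2)))"
            unfolding e[symmetric] by (rule ennreal_minus) simp
          then have "ennreal (x powr (m + s - 1)) * (ennreal (exp (- (x * (norm z)\<^sup>2))) - ennreal (exp (- ((x + a) * (norm z)\<^sup>2))))
             = ennreal (x powr (m + s - 1) * ((1 - exp (- (a * (norm z)\<^sup>2))) * exp (- (x * (norm z)\<^sup>2))))"
            by (simp add: ennreal_mult')
          moreover have "?k z x = ennreal ((1 - exp (- (a * (norm z)\<^sup>2))) * (x powr (m + s - 1) * exp (- (x * (norm z)\<^sup>2))))"
            using x a by (simp add: m_def ennreal_mult')
          ultimately show "?k z x = ennreal (x powr (m + s - 1)) *
             (ennreal (exp (- (x * (norm z)\<^sup>2))) - ennreal (exp (- ((x + a) * (norm z)\<^sup>2))))"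
            by (simp only: mult_ac)
        qed
        also have "\<dots> = ennreal (x powr (m + s - 1)) *
          (\<integral>\<^sup>+z. ennreal (exp (- (x * (norm (z::'a))\<^sup>2))) - ennreal (exp (- ((x + a) * (norm z)\<^sup>2))) \<partial>lborel)"
          by (rule nn_integral_cmult) measurable
        also have "(\<integral>\<^sup>+z. ennreal (exp (- (x * (norm (z::'a))\<^sup>2))) - ennreal (exp (- ((x + a) * (norm z)\<^sup>2))) \<partial>lborel)
          = ennreal ((pi / x) powr m) - ennreal ((pi / (x + a)) powr m)"
        proof (subst nn_integral_diff)
          show "AE z in lborel. ennreal (exp (- ((x + a) * (norm (z::'a))\<^sup>2))) \<le> ennreal (exp (- (x * (norm z)\<^sup>2)))"
            using a by (intro AE_I2 ennreal_leI) (auto intro!: mult_right_mono)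
        qed (use x a in \<open>auto simp: nn_integral_gaussian m_def\<close>)
        also have "\<dots> = ennreal ((pi / x) powr m - (pi / (x + a)) powr m)"
          by (rule ennreal_minus) simp
        also have "\<dots> \<le> ennreal ((pi / x) powr m * (1 - exp (- (m * a / x))))"
          unfolding e1 using ge by (intro ennreal_leI) (simp add: right_diff_distrib mult_left_mono)
        finally have "(\<integral>\<^sup>+z. ?k z x \<partial>lborel) \<le> ennreal (x powr (m + s - 1)) * ennreal ((pi / x) powr m * (1 - exp (- (m * a / x))))"
          by (simp add: mult_left_mono)
        also have "\<dots> = ennreal (x powr (m + s - 1) * ((pi / x) powr m * (1 - exp (- (m * a / x)))))"
          by (rule ennreal_mult'[symmetric]) simp
        also have "x powr (m + s - 1) * ((pi / x) powr m * (1 - exp (- (m * a / x)))) = pi powr m * (x powr (s - 1) * (1 - exp (- (m * a / x))))"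
          using x by (simp add: powr_divide powr_add powr_diff)
        finally show ?thesis using x by simp
      qed simp
    qed
    \<comment> \<open>Scaling x by 4 m a turns m a / x into 1 / (4 x).\<close>
    also have "\<dots> = ennreal (4 * m * a) * (\<integral>\<^sup>+x\<in>{0<..}. ennreal (pi powr m * ((4 * m * a * x) powr (s - 1) * (1 - exp (- (m * a / (4 * m * a * x)))))) \<partial>lborel)"
      by (rule nn_integral_half_line_scale) (use m a in auto)
    also have "\<dots> = ennreal (4 * m * a) * (\<integral>\<^sup>+x. ennreal (pi powr m * (4 * m * a) powr (s - 1)) * (ennreal (x powr (s - 1) * (1 - exp (- (1 / (4 * x))))) * indicator {0<..} x) \<partial>lborel)"
    proof (rule arg_cong2[where f="(*)", OF refl], rule nn_integral_cong)
      fix x :: real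
      have "m * a / (4 * m * a * x) = 1 / (4 * x)" using m a by simp
      then show "ennreal (pi powr m * ((4 * m * a * x) powr (s - 1) * (1 - exp (- (m * a / (4 * m * a * x)))))) * indicator {0<..} x
        = ennreal (pi powr m * (4 * m * a) powr (s - 1)) * (ennreal (x powr (s - 1) * (1 - exp (- (1 / (4 * x))))) * indicator {0<..} x)"
        by (simp only: powr_mult ennreal_mult' powr_ge_zero mult.assoc mult_nonneg_nonneg)
    qed
    also have "\<dots> = ennreal (4 * m * a) * (ennreal (pi powr m * (4 * m * a) powr (s - 1)) * ennreal I)"
      using nn_integral_one_minus_exp_inverse[OF s] by (subst nn_integral_cmult) (auto simp: I_def)
    also have "\<dots> = ennreal (4 * m * a * (pi powr m * (4 * m * a) powr (s - 1) * I))"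
      using m a by (simp add: ennreal_mult')
    also have "4 * m * a * (pi powr m * (4 * m * a) powr (s - 1) * I) = K * a powr s"
    proof -
      have "4 * m * a * (4 * m * a) powr (s - 1) = (4 * m * a) powr s"
        using m a by (subst powr_mult_base) auto
      also have "\<dots> = (4 * m) powr s * a powr s" by (rule powr_mult)
      finally have "pi powr m * I * (4 * m * a * (4 * m * a) powr (s - 1)) = pi powr m * I * ((4 * m) powr s * a powr s)" by simp
      then show ?thesis unfolding K_def by (simp only: mult_ac)
    qed
    finally have "ennreal G * ?L \<le> ennreal (K * a powr s)" .
    then have "ennreal (1 / G) * (ennreal G * ?L) \<le> ennreal (1 / G) * ennreal (K * a powr s)"
      by (intro mult_left_mono) auto
    also have "ennreal (1 / G) * (ennreal G * ?L) = ?L"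
      using G by (simp add: mult.assoc[symmetric] ennreal_mult'[symmetric])
    also have "ennreal (1 / G) * ennreal (K * a powr s) = ennreal (K / G * a powr s)"
      using G by (subst ennreal_mult'[symmetric]) auto
    finally show ?thesis .
  qed
  then show ?thesis using K G by (intro exI[of _ "K / G"]) auto
qed

lemma min_one_square_le: "min 1 r \<le> 2 * (1 - exp (- r))" if "r \<ge> 0" for r :: real
proof (cases "r \<le> 1")
  case True
  have "1 + r \<le> exp r" by (rule exp_ge_add_one_self)
  then have "exp (- r) \<le> 1 / (1 + r)" using that by (simp add: exp_minus inverse_eq_divide frac_le)
  also have "\<dots> \<le> 1 - r / 2" using that True mult_left_le[of r r] by (simp add: field_simps)
  finally show ?thesis using True by simp
next
  case False
  have "exp (- r) \<le> exp (-1)" using False by simp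
  also have "exp (-1) \<le> 1 / (2::real)"
    using exp_ge_add_one_self[of "1::real"] by (simp add: exp_minus inverse_eq_divide)
  finally show ?thesis using False by simp
qed

text \<open>\<kappa> depends on the dimension and on \<open>s\<close> only, and the Lipschitz
  condition is imposed at the single point \<open>x\<close>. Hence \<open>L\<close> may vary with
  \<open>x\<close>; in \<open>multiplier_kernel_bound\<close> it decays like 1 / |x|.\<close>

lemma lipschitz_kernel_bound:
  assumes s: "0 < s" "s < 1"
  shows "\<exists>\<kappa>\<ge>0. \<forall>(\<psi>::'a::euclidean_space \<Rightarrow> real) x L B. L > 0 \<longrightarrow> (\<forall>y. \<bar>\<psi> y\<bar> \<le> B) \<longrightarrow>
     (\<forall>y. \<bar>\<psi> x - \<psi> y\<bar> \<le> L * norm (x - y)) \<longrightarrow>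
     (\<integral>\<^sup>+y. ennreal (\<bar>\<psi> x - \<psi> y\<bar>\<^sup>2 / norm (x - y) powr (real DIM('a) + 2 * s)) \<partial>lebesgue)
       \<le> ennreal (\<kappa> * (1 + B\<^sup>2) * L powr (2 * s))"
proof -
  let ?N = "real DIM('a)"
  obtain \<kappa> where \<kappa>: "\<kappa> \<ge> 0" and bound: "\<And>a. a > 0 \<Longrightarrow>
    (\<integral>\<^sup>+z. ennreal ((1 - exp (- (a * (norm (z::'a))\<^sup>2))) / norm z powr (?N + 2 * s)) \<partial>lborel) \<le> ennreal (\<kappa> * a powr s)"
    using nn_integral_damped_kernel[OF s, where 'a='a] by blast
  have "(\<integral>\<^sup>+y. ennreal (\<bar>\<psi> x - \<psi> y\<bar>\<^sup>2 / norm (x - y) powr (?N + 2 * s)) \<partial>lebesgue)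
       \<le> ennreal (8 * \<kappa> * (1 + B\<^sup>2) * L powr (2 * s))"
    if L: "L > 0" and B: "\<forall>y. \<bar>\<psi> y\<bar> \<le> B" and lip: "\<forall>y. \<bar>\<psi> x - \<psi> y\<bar> \<le> L * norm (x - y)"
    for \<psi> :: "'a \<Rightarrow> real" and x L B
  proof -
    \<comment> \<open>4 (1 + B^2) min(1, r) dominates the squared difference; the further factor 2
      comes from \<open>min_one_square_le\<close>.\<close>
    define c where "c = 8 * (1 + B\<^sup>2)"
    have c: "c \<ge> 0" by (simp add: c_def)
    let ?h = "\<lambda>z. ennreal ((1 - exp (- (L\<^sup>2 * (norm (z::'a))\<^sup>2))) / norm z powr (?N + 2 * s))"
    have "(\<integral>\<^sup>+y. ennreal (\<bar>\<psi> x - \<psi> y\<bar>\<^sup>2 / norm (x - y) powr (?N + 2 * s)) \<partial>lebesgue)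
      = (\<integral>\<^sup>+y. ennreal (\<bar>\<psi> x - \<psi> y\<bar>\<^sup>2 / norm (x - y) powr (?N + 2 * s)) \<partial>lborel)"
      by (rule nn_integral_completion)
    also have "\<dots> \<le> (\<integral>\<^sup>+y. ennreal c * ?h (x - y) \<partial>lborel)"
    proof (rule nn_integral_mono)
      fix y :: 'a
      define r where "r = L\<^sup>2 * (norm (x - y))\<^sup>2"
      have r: "r \<ge> 0" by (simp add: r_def)
      have p1: "\<bar>\<psi> x - \<psi> y\<bar>\<^sup>2 \<le> r"
        using power_mono[OF lip[rule_format, of y], of 2] by (simp add: r_def power_mult_distrib)
      have "\<bar>\<psi> x - \<psi> y\<bar> \<le> 2 * B" using B[rule_format, of x] B[rule_format, of y] by linarith
      from power_mono[OF this, of 2] have p2: "\<bar>\<psi> x - \<psi> y\<bar>\<^sup>2 \<le> 4 * B\<^sup>2" by (simp add: power_mult_distrib)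
      have "\<bar>\<psi> x - \<psi> y\<bar>\<^sup>2 \<le> 4 * (1 + B\<^sup>2) * min 1 r"
      proof (cases "r \<le> 1")
        case True
        have "1 * r \<le> 4 * (1 + B\<^sup>2) * r" using r by (intro mult_right_mono) auto
        then show ?thesis using p1 True by simp
      next
        case False
        then show ?thesis using p2 by simp
      qed
      also have "\<dots> \<le> 4 * (1 + B\<^sup>2) * (2 * (1 - exp (- r)))"
        by (intro mult_left_mono min_one_square_le r) auto
      finally have "\<bar>\<psi> x - \<psi> y\<bar>\<^sup>2 \<le> c * (1 - exp (- r))" unfolding c_def by argo
      then have "\<bar>\<psi> x - \<psi> y\<bar>\<^sup>2 / norm (x - y) powr (?N + 2 * s) \<le> c * (1 - exp (- r)) / norm (x - y) powr (?N + 2 * s)"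
        by (intro divide_right_mono) auto
      then have "ennreal (\<bar>\<psi> x - \<psi> y\<bar>\<^sup>2 / norm (x - y) powr (?N + 2 * s)) \<le> ennreal (c * ((1 - exp (- r)) / norm (x - y) powr (?N + 2 * s)))"
        by (intro ennreal_leI) simp
      also have "\<dots> = ennreal c * ?h (x - y)"
        unfolding r_def using c by (rule ennreal_mult')
      finally show "ennreal (\<bar>\<psi> x - \<psi> y\<bar>\<^sup>2 / norm (x - y) powr (?N + 2 * s)) \<le> ennreal c * ?h (x - y)" .
    qed
    also have "\<dots> = ennreal c * (\<integral>\<^sup>+y. ?h (x - y) \<partial>lborel)"
      by (rule nn_integral_cmult) measurable
    also have "(\<integral>\<^sup>+y. ?h (x - y) \<partial>lborel) = (\<integral>\<^sup>+y. ?h y \<partial>lborel)"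
      by (rule nn_integral_lborel_reflect[of ?h]) measurable
    also have "ennreal c * (\<integral>\<^sup>+y. ?h y \<partial>lborel) \<le> ennreal c * ennreal (\<kappa> * (L\<^sup>2) powr s)"
      by (intro mult_left_mono bound) (use L in auto)
    also have "\<dots> = ennreal (c * (\<kappa> * (L\<^sup>2) powr s))"
      using c by (rule ennreal_mult'[symmetric])
    also have "(L\<^sup>2) powr s = L powr (2 * s)"
      using L powr_powr[of L 2 s] by simp
    also have "c * (\<kappa> * L powr (2 * s)) = 8 * \<kappa> * (1 + B\<^sup>2) * L powr (2 * s)"
      by (simp add: c_def)
    finally show ?thesis .
  qed
  then show ?thesis using \<kappa> by (intro exI[of _ "8 * \<kappa>"]) auto
qed

text \<open>Young's inequality with a free parameter: letting \<open>d\<close> tend to 0 preserves a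
  sharp constant when a function is approximated in energy.\<close>

lemma gagliardo_add_le:
  fixes f g :: "'a::euclidean_space \<Rightarrow> real"
  assumes [measurable]: "f \<in> borel_measurable lebesgue" "g \<in> borel_measurable lebesgue" and d: "d > 0"
  shows "gagliardo s (\<lambda>x. f x + g x) \<le> ennreal (1 + d) * gagliardo s f + ennreal (1 + 1 / d) * gagliardo s g"
proof -
  let ?w = "\<lambda>x y::'a. norm (x - y) powr (real DIM('a) + 2 * s)"
  have "gagliardo s (\<lambda>x. f x + g x) \<le> (\<integral>\<^sup>+x. (\<integral>\<^sup>+y. ennreal (1 + d) * ennreal (\<bar>f x - f y\<bar>\<^sup>2 / ?w x y)
     + ennreal (1 + 1 / d) * ennreal (\<bar>g x - g y\<bar>\<^sup>2 / ?w x y) \<partial>lebesgue) \<partial>lebesgue)"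
    unfolding gagliardo_def
  proof (intro nn_integral_mono)
    fix x y :: 'a
    define A where "A = f x - f y"
    define B where "B = g x - g y"
    have "0 \<le> (sqrt d * A - B / sqrt d)\<^sup>2" by simp
    also have "\<dots> = d * A\<^sup>2 + B\<^sup>2 / d - 2 * (A * B)"
      using d by (simp add: power2_diff power_mult_distrib power_divide)
    finally have "(A + B)\<^sup>2 \<le> (1 + d) * A\<^sup>2 + (1 + 1 / d) * B\<^sup>2"
      by (simp add: power2_sum algebra_simps)
    then have "\<bar>f x + g x - (f y + g y)\<bar>\<^sup>2 \<le> (1 + d) * \<bar>f x - f y\<bar>\<^sup>2 + (1 + 1 / d) * \<bar>g x - g y\<bar>\<^sup>2"
      by (simp add: A_def B_def algebra_simps)
    then have "\<bar>f x + g x - (f y + g y)\<bar>\<^sup>2 / ?w x y \<le> ((1 + d) * \<bar>f x - f y\<bar>\<^sup>2 + (1 + 1 / d) * \<bar>g x - g y\<bar>\<^sup>2) / ?w x y"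
      by (rule divide_right_mono) simp
    also have "\<dots> = (1 + d) * (\<bar>f x - f y\<bar>\<^sup>2 / ?w x y) + (1 + 1 / d) * (\<bar>g x - g y\<bar>\<^sup>2 / ?w x y)"
      by (simp add: add_divide_distrib)
    finally have "ennreal (\<bar>f x + g x - (f y + g y)\<bar>\<^sup>2 / ?w x y)
        \<le> ennreal ((1 + d) * (\<bar>f x - f y\<bar>\<^sup>2 / ?w x y) + (1 + 1 / d) * (\<bar>g x - g y\<bar>\<^sup>2 / ?w x y))"
      by (rule ennreal_leI)
    also have "\<dots> = ennreal (1 + d) * ennreal (\<bar>f x - f y\<bar>\<^sup>2 / ?w x y) + ennreal (1 + 1 / d) * ennreal (\<bar>g x - g y\<bar>\<^sup>2 / ?w x y)"
      using d by (subst ennreal_plus) (auto intro!: mult_nonneg_nonneg add_nonneg_nonneg divide_nonneg_nonneg simp: ennreal_mult' simp del: ennreal_plus power2_abs times_divide_eq_right)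
    finally show "ennreal (\<bar>f x + g x - (f y + g y)\<bar>\<^sup>2 / ?w x y)
        \<le> ennreal (1 + d) * ennreal (\<bar>f x - f y\<bar>\<^sup>2 / ?w x y) + ennreal (1 + 1 / d) * ennreal (\<bar>g x - g y\<bar>\<^sup>2 / ?w x y)" .
  qed
  also have "\<dots> = ennreal (1 + d) * gagliardo s f + ennreal (1 + 1 / d) * gagliardo s g"
    unfolding gagliardo_def by (simp add: nn_integral_add nn_integral_cmult del: power2_abs)
  finally show ?thesis .
qed

lemma ext_energy_add_le:
  fixes f g :: "'a::euclidean_space \<Rightarrow> real"
  assumes [measurable]: "f \<in> borel_measurable lebesgue" "g \<in> borel_measurable lebesgue" and d: "d > 0"
  shows "ext_energy s (\<lambda>x. f x + g x) \<le> ennreal (1 + d) * ext_energy s f + ennreal (1 + 1 / d) * ext_energy s g"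
proof -
  have "ext_energy s (\<lambda>x. f x + g x) = ennreal (C_const TYPE('a) s / 2) * gagliardo s (\<lambda>x. f x + g x)"
    by (rule ext_energy_eq) measurable
  also have "\<dots> \<le> ennreal (C_const TYPE('a) s / 2) * (ennreal (1 + d) * gagliardo s f + ennreal (1 + 1 / d) * gagliardo s g)"
    by (intro mult_left_mono gagliardo_add_le assms) simp
  also have "\<dots> = ennreal (1 + d) * ext_energy s f + ennreal (1 + 1 / d) * ext_energy s g"
    unfolding ext_energy_eq[OF assms(1)] ext_energy_eq[OF assms(2)] distrib_left by (simp only: mult_ac)
  finally show ?thesis .
qed

lemma ext_energy_swap: "ext_energy s (\<lambda>x. g x - f x) = ext_energy s (\<lambda>x. f x - g x)"
proof -
  have "\<bar>g x - f x - (g y - f y)\<bar> = \<bar>f x - g x - (f y - g y)\<bar>" for x y by linarith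
  then show ?thesis unfolding ext_energy_def by simp
qed

text \<open>The product difference is split as \<psi>(y) (v(x) - v(y)) + v(x) (\<psi>(x) -
  \<psi>(y)). Since v is evaluated at x in the second term, its y-integral involves \<psi> alone,
  and \<open>k\<close> bounds it.\<close>

lemma gagliardo_mult_le:
  fixes v \<psi> :: "'a::euclidean_space \<Rightarrow> real"
  assumes [measurable]: "v \<in> borel_measurable lebesgue" "\<psi> \<in> borel_measurable lebesgue" and k[measurable]: "k \<in> borel_measurable lebesgue"
    and B: "\<And>x. \<bar>\<psi> x\<bar> \<le> B"
    and kb: "AE x in lebesgue. (\<integral>\<^sup>+y. ennreal (\<bar>\<psi> x - \<psi> y\<bar>\<^sup>2 / norm (x - y) powr (real DIM('a) + 2 * s)) \<partial>lebesgue) \<le> k x"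
  shows "gagliardo s (\<lambda>x. \<psi> x * v x) \<le> ennreal (2 * B\<^sup>2) * gagliardo s v + 2 * (\<integral>\<^sup>+x. ennreal ((v x)\<^sup>2) * k x \<partial>lebesgue)"
proof -
  let ?w = "\<lambda>x y::'a. norm (x - y) powr (real DIM('a) + 2 * s)"
  have "gagliardo s (\<lambda>x. \<psi> x * v x) \<le> (\<integral>\<^sup>+x. (\<integral>\<^sup>+y. ennreal (2 * B\<^sup>2) * ennreal (\<bar>v x - v y\<bar>\<^sup>2 / ?w x y)
     + 2 * (ennreal ((v x)\<^sup>2) * ennreal (\<bar>\<psi> x - \<psi> y\<bar>\<^sup>2 / ?w x y)) \<partial>lebesgue) \<partial>lebesgue)"
    unfolding gagliardo_def
  proof (intro nn_integral_mono)
    fix x y :: 'a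
    have sq: "(p + q)\<^sup>2 \<le> 2 * p\<^sup>2 + 2 * q\<^sup>2" for p q :: real
      using sum_squares_bound[of p q] by (simp add: power2_sum)
    have "(\<psi> x * v x - \<psi> y * v y)\<^sup>2 = (\<psi> y * (v x - v y) + v x * (\<psi> x - \<psi> y))\<^sup>2"
      by (simp add: algebra_simps)
    also have "\<dots> \<le> 2 * (\<psi> y * (v x - v y))\<^sup>2 + 2 * (v x * (\<psi> x - \<psi> y))\<^sup>2" by (rule sq)
    also have "(\<psi> y * (v x - v y))\<^sup>2 \<le> B\<^sup>2 * (v x - v y)\<^sup>2"
    proof -
      have "(\<psi> y)\<^sup>2 \<le> B\<^sup>2" using power_mono[OF B[of y], of 2] by simp
      then show ?thesis unfolding power_mult_distrib by (rule mult_right_mono) simp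
    qed
    finally have "\<bar>\<psi> x * v x - \<psi> y * v y\<bar>\<^sup>2 \<le> 2 * B\<^sup>2 * \<bar>v x - v y\<bar>\<^sup>2 + 2 * ((v x)\<^sup>2 * \<bar>\<psi> x - \<psi> y\<bar>\<^sup>2)"
      by (simp add: power_mult_distrib)
    then have "\<bar>\<psi> x * v x - \<psi> y * v y\<bar>\<^sup>2 / ?w x y \<le> (2 * B\<^sup>2 * \<bar>v x - v y\<bar>\<^sup>2 + 2 * ((v x)\<^sup>2 * \<bar>\<psi> x - \<psi> y\<bar>\<^sup>2)) / ?w x y"
      by (rule divide_right_mono) simp
    also have "\<dots> = 2 * B\<^sup>2 * (\<bar>v x - v y\<bar>\<^sup>2 / ?w x y) + 2 * ((v x)\<^sup>2 * (\<bar>\<psi> x - \<psi> y\<bar>\<^sup>2 / ?w x y))"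
      by (simp add: add_divide_distrib)
    finally have "ennreal (\<bar>\<psi> x * v x - \<psi> y * v y\<bar>\<^sup>2 / ?w x y)
        \<le> ennreal (2 * B\<^sup>2 * (\<bar>v x - v y\<bar>\<^sup>2 / ?w x y) + 2 * ((v x)\<^sup>2 * (\<bar>\<psi> x - \<psi> y\<bar>\<^sup>2 / ?w x y)))"
      by (rule ennreal_leI)
    also have "\<dots> = ennreal (2 * B\<^sup>2 * (\<bar>v x - v y\<bar>\<^sup>2 / ?w x y)) + ennreal (2 * ((v x)\<^sup>2 * (\<bar>\<psi> x - \<psi> y\<bar>\<^sup>2 / ?w x y)))"
      by (rule ennreal_plus) simp_all
    also have "\<dots> = ennreal (2 * B\<^sup>2) * ennreal (\<bar>v x - v y\<bar>\<^sup>2 / ?w x y) + 2 * (ennreal ((v x)\<^sup>2) * ennreal (\<bar>\<psi> x - \<psi> y\<bar>\<^sup>2 / ?w x y))"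
      by (simp add: ennreal_mult' del: power2_abs times_divide_eq_right)
    finally show "ennreal (\<bar>\<psi> x * v x - \<psi> y * v y\<bar>\<^sup>2 / ?w x y)
        \<le> ennreal (2 * B\<^sup>2) * ennreal (\<bar>v x - v y\<bar>\<^sup>2 / ?w x y) + 2 * (ennreal ((v x)\<^sup>2) * ennreal (\<bar>\<psi> x - \<psi> y\<bar>\<^sup>2 / ?w x y))" .
  qed
  also have "\<dots> = ennreal (2 * B\<^sup>2) * gagliardo s v
     + 2 * (\<integral>\<^sup>+x. ennreal ((v x)\<^sup>2) * (\<integral>\<^sup>+y. ennreal (\<bar>\<psi> x - \<psi> y\<bar>\<^sup>2 / ?w x y) \<partial>lebesgue) \<partial>lebesgue)"
    unfolding gagliardo_def by (simp add: nn_integral_add nn_integral_cmult del: power2_abs)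
  also have "\<dots> \<le> ennreal (2 * B\<^sup>2) * gagliardo s v + 2 * (\<integral>\<^sup>+x. ennreal ((v x)\<^sup>2) * k x \<partial>lebesgue)"
  proof -
    have "(\<integral>\<^sup>+x. ennreal ((v x)\<^sup>2) * (\<integral>\<^sup>+y. ennreal (\<bar>\<psi> x - \<psi> y\<bar>\<^sup>2 / ?w x y) \<partial>lebesgue) \<partial>lebesgue) \<le> (\<integral>\<^sup>+x. ennreal ((v x)\<^sup>2) * k x \<partial>lebesgue)"
      by (rule nn_integral_mono_AE, use kb in eventually_elim) (auto intro: mult_left_mono)
    then show ?thesis by (intro add_mono mult_left_mono) auto
  qed
  finally show ?thesis .
qed

lemma nn_integral_cball_finite: "(\<integral>\<^sup>+x. ennreal C * indicator (cball a R) x \<partial>lebesgue) < \<infinity>"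
proof -
  have "(\<integral>\<^sup>+x. ennreal C * indicator (cball a R) x \<partial>lebesgue) = ennreal C * emeasure lebesgue (cball a R)"
    by (rule nn_integral_cmult_indicator) auto
  moreover have "emeasure lebesgue (cball a R) < \<infinity>"
    using emeasure_bounded_finite[of "cball a R"] by simp
  ultimately show ?thesis by (simp add: ennreal_mult_less_top)
qed

lemma test_function_measurable: "test_function f \<Longrightarrow> f \<in> borel_measurable lebesgue"
  by (intro measurable_completion) (simp add: borel_measurable_smooth test_function_smooth)

lemma test_function_L2:
  fixes f :: "'a::euclidean_space \<Rightarrow> real"
  assumes f: "test_function f"
  shows "(\<integral>\<^sup>+x. ennreal ((f x)\<^sup>2) \<partial>lebesgue) < \<infinity>"
proof -
  obtain R where R: "\<forall>x. f x \<noteq> 0 \<longrightarrow> norm x \<le> R" using test_function_support[OF f] by blast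
  obtain B where B: "\<forall>x. \<bar>f x\<bar> \<le> B" using test_function_bounds[OF f] by blast
  have "(\<integral>\<^sup>+x. ennreal ((f x)\<^sup>2) \<partial>lebesgue) \<le> (\<integral>\<^sup>+x. ennreal (B\<^sup>2) * indicator (cball (0::'a) R) x \<partial>lebesgue)"
  proof (rule nn_integral_mono)
    fix x
    have "(f x)\<^sup>2 \<le> B\<^sup>2" using power_mono[OF B[rule_format, of x], of 2] by simp
    then show "ennreal ((f x)\<^sup>2) \<le> ennreal (B\<^sup>2) * indicator (cball 0 R) x"
      using R[rule_format, of x] by (cases "f x = 0") (auto intro: ennreal_leI)
  qed
  also have "\<dots> < \<infinity>" by (rule nn_integral_cball_finite)
  finally show ?thesis .
qed

text \<open>The integrand vanishes unless one of the two points lies in the support ball. By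
  symmetry this may be taken to be x, and then the inner integral is bounded by
  \<open>lipschitz_kernel_bound\<close>.\<close>

lemma test_function_energy_finite:
  fixes f :: "'a::euclidean_space \<Rightarrow> real"
  assumes s: "0 < s" "s < 1" and f: "test_function f"
  shows "ext_energy s f < \<infinity>"
proof -
  let ?w = "\<lambda>x y::'a. norm (x - y) powr (real DIM('a) + 2 * s)"
  note [measurable] = test_function_measurable[OF f]
  obtain R where R: "\<forall>x. f x \<noteq> 0 \<longrightarrow> norm x \<le> R" using test_function_support[OF f] by blast
  obtain B where B: "B > 0" "\<forall>x. \<bar>f x\<bar> \<le> B" "\<forall>x y. \<bar>f x - f y\<bar> \<le> B * norm (x - y)"
    using test_function_bounds[OF f] by blast
  obtain C where C: "\<And>x. (\<integral>\<^sup>+y. ennreal (\<bar>f x - f y\<bar>\<^sup>2 / ?w x y) \<partial>lebesgue) \<le> ennreal C"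
    using lipschitz_kernel_bound[OF s, where 'a='a] B by meson
  let ?F = "\<lambda>x y. ennreal (\<bar>f x - f y\<bar>\<^sup>2 / ?w x y)"
  let ?I = "indicator (cball 0 R) :: 'a \<Rightarrow> ennreal"
  have Im [measurable]: "?I \<in> borel_measurable lebesgue"
    by (intro borel_measurable_indicator) auto
  have fin: "(\<integral>\<^sup>+x. (\<integral>\<^sup>+y. ?F x y * ?I x \<partial>lebesgue) \<partial>lebesgue) < \<infinity>"
  proof -
    have "(\<integral>\<^sup>+x. (\<integral>\<^sup>+y. ?F x y * ?I x \<partial>lebesgue) \<partial>lebesgue) = (\<integral>\<^sup>+x. (\<integral>\<^sup>+y. ?F x y \<partial>lebesgue) * ?I x \<partial>lebesgue)"
      by (intro nn_integral_cong nn_integral_multc) measurable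
    also have "\<dots> \<le> (\<integral>\<^sup>+x. ennreal C * ?I x \<partial>lebesgue)"
      by (intro nn_integral_mono mult_right_mono C) auto
    also have "\<dots> < \<infinity>" by (rule nn_integral_cball_finite)
    finally show ?thesis .
  qed
  have "gagliardo s f \<le> (\<integral>\<^sup>+x. (\<integral>\<^sup>+y. ?F x y * ?I x + ?F x y * ?I y \<partial>lebesgue) \<partial>lebesgue)"
    unfolding gagliardo_def
  proof (intro nn_integral_mono)
    fix x y
    show "?F x y \<le> ?F x y * ?I x + ?F x y * ?I y"
    proof (cases "norm x \<le> R \<or> norm y \<le> R")
      case True then show ?thesis by (auto simp: indicator_def)
    next
      case False
      then have "f x = 0" "f y = 0" using R by auto
      then show ?thesis by simp
    qed
  qed
  also have "\<dots> = (\<integral>\<^sup>+x. (\<integral>\<^sup>+y. ?F x y * ?I x \<partial>lebesgue) \<partial>lebesgue) + (\<integral>\<^sup>+x. (\<integral>\<^sup>+y. ?F x y * ?I y \<partial>lebesgue) \<partial>lebesgue)"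
  proof -
    have "(\<integral>\<^sup>+y. ?F x y * ?I x + ?F x y * ?I y \<partial>lebesgue) = (\<integral>\<^sup>+y. ?F x y * ?I x \<partial>lebesgue) + (\<integral>\<^sup>+y. ?F x y * ?I y \<partial>lebesgue)" for x
      by (rule nn_integral_add) measurable
    then have "(\<integral>\<^sup>+x. (\<integral>\<^sup>+y. ?F x y * ?I x + ?F x y * ?I y \<partial>lebesgue) \<partial>lebesgue)
      = (\<integral>\<^sup>+x. (\<integral>\<^sup>+y. ?F x y * ?I x \<partial>lebesgue) + (\<integral>\<^sup>+y. ?F x y * ?I y \<partial>lebesgue) \<partial>lebesgue)"
      by (intro nn_integral_cong)
    also have "\<dots> = (\<integral>\<^sup>+x. (\<integral>\<^sup>+y. ?F x y * ?I x \<partial>lebesgue) \<partial>lebesgue) + (\<integral>\<^sup>+x. (\<integral>\<^sup>+y. ?F x y * ?I y \<partial>lebesgue) \<partial>lebesgue)"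
      by (rule nn_integral_add) measurable
    finally show ?thesis .
  qed
  also have "(\<integral>\<^sup>+x. (\<integral>\<^sup>+y. ?F x y * ?I y \<partial>lebesgue) \<partial>lebesgue) = (\<integral>\<^sup>+y. (\<integral>\<^sup>+x. ?F x y * ?I y \<partial>lebesgue) \<partial>lebesgue)"
    by (rule lebesgue_pair.Fubini') measurable
  also have "\<dots> = (\<integral>\<^sup>+x. (\<integral>\<^sup>+y. ?F x y * ?I x \<partial>lebesgue) \<partial>lebesgue)"
    by (intro nn_integral_cong) (simp add: norm_minus_commute power2_commute)
  also have "(\<integral>\<^sup>+x. (\<integral>\<^sup>+y. ?F x y * ?I x \<partial>lebesgue) \<partial>lebesgue) + (\<integral>\<^sup>+x. (\<integral>\<^sup>+y. ?F x y * ?I x \<partial>lebesgue) \<partial>lebesgue) < \<infinity>"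
    using fin unfolding infinity_ennreal_def by (simp only: ennreal_add_less_top)
  finally have "gagliardo s f < \<infinity>" .
  then show ?thesis unfolding ext_energy_eq[OF test_function_measurable[OF f]]
    by (simp add: ennreal_mult_less_top)
qed

section \<open>The space of functions of finite energy\<close>

lemma lebesgue_shift_measurable [measurable]: "(\<lambda>x::'a::euclidean_space. x + v) \<in> lebesgue \<rightarrow>\<^sub>M lebesgue"
  using lebesgue_affine_measurable[of "\<lambda>_. 1" v] by (simp add: euclidean_representation add.commute)

lemma lebesgue_distr_shift: "distr lebesgue lebesgue (\<lambda>x::'a::euclidean_space. x + v) = lebesgue"
  using lebesgue_affine_euclidean[of "\<lambda>_. 1" v] by (simp add: euclidean_representation add.commute density_1)

lemma nn_integral_lebesgue_shift:
  fixes f :: "'a::euclidean_space \<Rightarrow> ennreal"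
  assumes "f \<in> borel_measurable lebesgue"
  shows "(\<integral>\<^sup>+x. f (x + v) \<partial>lebesgue) = (\<integral>\<^sup>+x. f x \<partial>lebesgue)"
  using nn_integral_distr[of "\<lambda>x. x + v" lebesgue lebesgue f] assms by (simp add: lebesgue_distr_shift)

lemma AE_lebesgue_shift:
  fixes P :: "'a::euclidean_space \<Rightarrow> bool"
  assumes "AE x in lebesgue. P x"
  shows "AE x in lebesgue. P (x + v)"
proof (rule AE_distrD[OF lebesgue_shift_measurable])
  show "AE x in distr lebesgue lebesgue (\<lambda>x. x + v). P x" unfolding lebesgue_distr_shift by fact
qed

lemma gagliardo_shift:
  fixes u :: "'a::euclidean_space \<Rightarrow> real"
  assumes [measurable]: "u \<in> borel_measurable lebesgue"
  shows "gagliardo s (\<lambda>x. u (x + v)) = gagliardo s u"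
proof -
  let ?F = "\<lambda>x y. ennreal (\<bar>u x - u y\<bar>\<^sup>2 / norm (x - y) powr (real DIM('a) + 2 * s))"
  have "gagliardo s (\<lambda>x. u (x + v)) = (\<integral>\<^sup>+x. (\<integral>\<^sup>+y. ?F (x + v) (y + v) \<partial>lebesgue) \<partial>lebesgue)"
    unfolding gagliardo_def by simp
  also have "\<dots> = (\<integral>\<^sup>+x. (\<integral>\<^sup>+y. ?F (x + v) y \<partial>lebesgue) \<partial>lebesgue)"
    by (intro nn_integral_cong nn_integral_lebesgue_shift[where f="?F (_ + v)"]) measurable
  also have "\<dots> = (\<integral>\<^sup>+x. (\<integral>\<^sup>+y. ?F x y \<partial>lebesgue) \<partial>lebesgue)"
    by (rule nn_integral_lebesgue_shift[where f="\<lambda>x. \<integral>\<^sup>+y. ?F x y \<partial>lebesgue"]) measurable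
  finally show ?thesis unfolding gagliardo_def .
qed

lemma ext_energy_shift:
  fixes u :: "'a::euclidean_space \<Rightarrow> real"
  assumes u[measurable]: "u \<in> borel_measurable lebesgue"
  shows "ext_energy s (\<lambda>x. u (x + v)) = ext_energy s u"
proof -
  have "(\<lambda>x. u (x + v)) \<in> borel_measurable lebesgue" by measurable
  then show ?thesis by (simp add: ext_energy_eq u gagliardo_shift)
qed

section \<open>The homogeneous space and its Hardy inequality\<close>

lemma Hdot_measurable: "u \<in> Hdot s \<Longrightarrow> u \<in> borel_measurable lebesgue"
  by (simp add: Hdot_def)

lemma Hdot_shift:
  fixes u :: "'a::euclidean_space \<Rightarrow> real"
  assumes u: "u \<in> Hdot s"
  shows "(\<lambda>x. u (x + v)) \<in> Hdot s"
proof -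
  note m[measurable] = Hdot_measurable[OF u]
  obtain \<phi> where \<phi>: "\<And>n. test_function (\<phi> n)" "((\<lambda>n. ext_energy s (\<lambda>x. \<phi> n x - u x)) \<longlongrightarrow> 0) sequentially"
    "AE x in lebesgue. (\<lambda>n::nat. \<phi> n x) \<longlonglongrightarrow> u x"
    using u unfolding Hdot_def by blast
  have [measurable]: "\<phi> n \<in> borel_measurable lebesgue" for n by (rule test_function_measurable[OF \<phi>(1)])
  have "ext_energy s (\<lambda>x. \<phi> n (x + v) - u (x + v)) = ext_energy s (\<lambda>x. \<phi> n x - u x)" for n
    by (rule ext_energy_shift[where u="\<lambda>x. \<phi> n x - u x"]) measurable
  then have "((\<lambda>n. ext_energy s (\<lambda>x. \<phi> n (x + v) - u (x + v))) \<longlongrightarrow> 0) sequentially" using \<phi>(2) by simp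
  moreover have "(\<lambda>x. u (x + v)) \<in> borel_measurable lebesgue" by measurable
  ultimately show ?thesis unfolding Hdot_def
    using AE_lebesgue_shift[OF \<phi>(3)] test_function_shift[OF \<phi>(1)]
    by (intro CollectI conjI exI[of _ "\<lambda>n x. \<phi> n (x + v)"]) auto
qed

lemma Hdot_finite:
  fixes u :: "'a::euclidean_space \<Rightarrow> real"
  assumes s: "0 < s" "s < 1" and u: "u \<in> Hdot s"
  shows "ext_energy s u < \<infinity>"
proof -
  note m[measurable] = Hdot_measurable[OF u]
  obtain \<phi> where \<phi>: "\<And>n. test_function (\<phi> n)" "((\<lambda>n. ext_energy s (\<lambda>x. \<phi> n x - u x)) \<longlongrightarrow> 0) sequentially"
    using u unfolding Hdot_def by blast
  have "eventually (\<lambda>n. ext_energy s (\<lambda>x. \<phi> n x - u x) < 1) sequentially"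
    using \<phi>(2) by (rule order_tendstoD) simp
  then obtain n where n: "ext_energy s (\<lambda>x. \<phi> n x - u x) < 1" by (auto simp: eventually_sequentially)
  note [measurable] = test_function_measurable[OF \<phi>(1)[of n]]
  have "ext_energy s (\<lambda>x. \<phi> n x + (u x - \<phi> n x)) \<le> ennreal (1 + 1) * ext_energy s (\<phi> n) + ennreal (1 + 1 / 1) * ext_energy s (\<lambda>x. u x - \<phi> n x)"
    by (rule ext_energy_add_le) auto
  also have "ext_energy s (\<lambda>x. u x - \<phi> n x) = ext_energy s (\<lambda>x. \<phi> n x - u x)" by (rule ext_energy_swap)
  also have "ennreal (1 + 1) * ext_energy s (\<phi> n) + ennreal (1 + 1 / 1) * ext_energy s (\<lambda>x. \<phi> n x - u x) < \<infinity>"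
    using test_function_energy_finite[OF s \<phi>(1)[of n]] less_trans[OF n ennreal_one_less_top]
    by (simp add: ennreal_mult_less_top)
  finally show ?thesis by simp
qed

lemma Hardy_const_pos: "2 * s < real DIM('a::euclidean_space) \<Longrightarrow> 0 < s \<Longrightarrow> Hardy_const TYPE('a) s > 0"
proof -
  assume "2 * s < real DIM('a)" "0 < s"
  then have "Gamma ((real DIM('a) + 2 * s) / 4) > 0" "Gamma ((real DIM('a) - 2 * s) / 4) > 0"
    by (auto intro!: Gamma_real_pos add_nonneg_pos)
  then show ?thesis by (simp add: Hardy_const_def)
qed

text \<open>\<open>hardy_L2\<close> covers the approximating test functions, while elements of
  \<open>Hdot\<close> need not be square integrable. Fatou's lemma passes to the limit in the
  weighted integral; on the energy side the approximation costs a factor 1 + d, and d tends to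
  0.\<close>

lemma Hdot_hardy:
  fixes u :: "'a::euclidean_space \<Rightarrow> real"
  assumes s: "0 < s" "s < 1" and N: "real DIM('a) > 2 * s" and u: "u \<in> Hdot s"
  shows "ennreal (Hardy_const TYPE('a) s) * (\<integral>\<^sup>+x. ennreal ((u x)\<^sup>2 / norm x powr (2 * s)) \<partial>lebesgue) \<le> ext_energy s u"
proof -
  note m[measurable] = Hdot_measurable[OF u]
  let ?\<Lambda> = "Hardy_const TYPE('a) s"
  define H where "H v = (\<integral>\<^sup>+x. ennreal ((v x)\<^sup>2 / norm x powr (2 * s)) \<partial>lebesgue)" for v :: "'a \<Rightarrow> real"
  obtain \<phi> where \<phi>: "\<And>n. test_function (\<phi> n)" "((\<lambda>n. ext_energy s (\<lambda>x. \<phi> n x - u x)) \<longlongrightarrow> 0) sequentially"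
    "AE x in lebesgue. (\<lambda>n::nat. \<phi> n x) \<longlonglongrightarrow> u x"
    using u unfolding Hdot_def by blast
  have m2[measurable]: "\<phi> n \<in> borel_measurable lebesgue" for n by (rule test_function_measurable[OF \<phi>(1)])
  have \<Lambda>: "?\<Lambda> \<ge> 0" using Hardy_const_pos[OF N s(1)] by simp
  have \<Lambda>H: "ennreal ?\<Lambda> * H v = (\<integral>\<^sup>+x. ennreal (?\<Lambda> * ((v x)\<^sup>2 / norm x powr (2 * s))) \<partial>lebesgue)"
    if [measurable]: "v \<in> borel_measurable lebesgue" for v
    unfolding H_def ennreal_mult'[OF \<Lambda>] by (rule nn_integral_cmult[symmetric]) measurable
  have fatou: "ennreal ?\<Lambda> * H u \<le> liminf (\<lambda>n. ennreal ?\<Lambda> * H (\<phi> n))"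
  proof -
    have "ennreal ?\<Lambda> * H u = (\<integral>\<^sup>+x. liminf (\<lambda>n. ennreal (?\<Lambda> * ((\<phi> n x)\<^sup>2 / norm x powr (2 * s)))) \<partial>lebesgue)"
      unfolding \<Lambda>H[OF m]
    proof (rule nn_integral_cong_AE, use \<phi>(3) in eventually_elim)
      fix x assume x: "(\<lambda>n. \<phi> n x) \<longlonglongrightarrow> u x"
      have "(\<lambda>n. ?\<Lambda> * ((\<phi> n x)\<^sup>2 / norm x powr (2 * s))) \<longlonglongrightarrow> ?\<Lambda> * ((u x)\<^sup>2 / norm x powr (2 * s))"
        unfolding divide_inverse by (intro tendsto_intros x)
      then have "(\<lambda>n. ennreal (?\<Lambda> * ((\<phi> n x)\<^sup>2 / norm x powr (2 * s)))) \<longlonglongrightarrow> ennreal (?\<Lambda> * ((u x)\<^sup>2 / norm x powr (2 * s)))"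
        by (rule tendsto_ennrealI)
      then show "ennreal (?\<Lambda> * ((u x)\<^sup>2 / norm x powr (2 * s))) = liminf (\<lambda>n. ennreal (?\<Lambda> * ((\<phi> n x)\<^sup>2 / norm x powr (2 * s))))"
        by (intro lim_imp_Liminf[symmetric]) auto
    qed
    also have "\<dots> \<le> liminf (\<lambda>n. ennreal ?\<Lambda> * H (\<phi> n))"
      unfolding \<Lambda>H[OF m2] by (rule nn_integral_liminf) measurable
    finally show ?thesis .
  qed
  have step: "ennreal ?\<Lambda> * H u \<le> ennreal (1 + d) * ext_energy s u" if d: "d > 0" for d
  proof -
    note fatou
    also have "\<dots> \<le> liminf (\<lambda>n. ennreal (1 + d) * ext_energy s u + ennreal (1 + 1 / d) * ext_energy s (\<lambda>x. \<phi> n x - u x))"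
    proof (intro Liminf_mono always_eventually allI)
      fix n
      have "ennreal ?\<Lambda> * H (\<phi> n) \<le> ext_energy s (\<lambda>x. u x + (\<phi> n x - u x))"
        using hardy_L2[OF s N m2 test_function_L2[OF \<phi>(1)], of n] by (simp add: H_def)
      also have "\<dots> \<le> ennreal (1 + d) * ext_energy s u + ennreal (1 + 1 / d) * ext_energy s (\<lambda>x. \<phi> n x - u x)"
        using d by (intro ext_energy_add_le) auto
      finally show "ennreal ?\<Lambda> * H (\<phi> n) \<le> ennreal (1 + d) * ext_energy s u + ennreal (1 + 1 / d) * ext_energy s (\<lambda>x. \<phi> n x - u x)" .
    qed
    also have "\<dots> = ennreal (1 + d) * ext_energy s u + ennreal (1 + 1 / d) * 0"
      by (intro lim_imp_Liminf tendsto_add tendsto_const ennreal_tendsto_cmult \<phi>(2)) auto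
    finally show ?thesis by simp
  qed
  show ?thesis
  proof -
    obtain e where e: "e \<ge> 0" "ext_energy s u = ennreal e"
      using Hdot_finite[OF s u] by (cases "ext_energy s u") auto
    have "ennreal ?\<Lambda> * H u \<le> ennreal ((1 + 1) * e)" using step[of 1] e by (simp add: ennreal_mult')
    then obtain h where h: "h \<ge> 0" "ennreal ?\<Lambda> * H u = ennreal h"
      by (cases "ennreal ?\<Lambda> * H u") (auto simp: top_unique)
    have le: "h \<le> (1 + d) * e" if "d > 0" for d
    proof -
      have "ennreal h \<le> ennreal ((1 + d) * e)" using step[OF that] h e that by (simp add: ennreal_mult')
      then show ?thesis using e that by (subst (asm) ennreal_le_iff) auto
    qed
    have "h \<le> e"
    proof (rule field_le_epsilon)
      fix t :: real assume t: "t > 0"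
      \<comment> \<open>\<open>e + 1\<close> avoids dividing by an energy that may vanish.\<close>
      have "h \<le> (1 + t / (e + 1)) * e" using e t by (intro le) auto
      also have "\<dots> \<le> e + t" using e t by (simp add: field_simps)
      finally show "h \<le> e + t" .
    qed
    then show ?thesis using h e by (simp add: H_def ennreal_leI)
  qed
qed

text \<open>Lets \<open>Hdot_mult\<close> apply \<open>multiplier_energy_le\<close> to the error of
  an approximating sequence.\<close>

lemma Hdot_diff_test:
  fixes u :: "'a::euclidean_space \<Rightarrow> real"
  assumes u: "u \<in> Hdot s" and f: "test_function f"
  shows "(\<lambda>x. f x - u x) \<in> Hdot s"
proof -
  note m[measurable] = Hdot_measurable[OF u]
  note [measurable] = test_function_measurable[OF f]
  obtain \<phi> where \<phi>: "\<And>n. test_function (\<phi> n)" "((\<lambda>n. ext_energy s (\<lambda>x. \<phi> n x - u x)) \<longlongrightarrow> 0) sequentially"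
    "AE x in lebesgue. (\<lambda>n::nat. \<phi> n x) \<longlonglongrightarrow> u x"
    using u unfolding Hdot_def by blast
  have "(\<lambda>x. (f x - \<phi> n x) - (f x - u x)) = (\<lambda>x. u x - \<phi> n x)" for n by auto
  then have "ext_energy s (\<lambda>x. (f x - \<phi> n x) - (f x - u x)) = ext_energy s (\<lambda>x. \<phi> n x - u x)" for n
    by (simp add: ext_energy_swap)
  then have 1: "((\<lambda>n. ext_energy s (\<lambda>x. (f x - \<phi> n x) - (f x - u x))) \<longlongrightarrow> 0) sequentially" using \<phi>(2) by simp
  have 2: "AE x in lebesgue. (\<lambda>n. f x - \<phi> n x) \<longlonglongrightarrow> f x - u x"
    using \<phi>(3) by eventually_elim (intro tendsto_intros)
  have "(\<lambda>x. f x - u x) \<in> borel_measurable lebesgue" by measurable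
  then show ?thesis unfolding Hdot_def
    using 1 2 test_function_diff[OF f \<phi>(1)]
    by (intro CollectI conjI exI[of _ "\<lambda>n x. f x - \<phi> n x"]) auto
qed

section \<open>Multiplication operators on the homogeneous space\<close>

text \<open>Besides being bounded and Lipschitz, a multiplier must oscillate slowly at infinity: this makes
  the commutator kernel decay like the Hardy weight.\<close>
definition multiplier :: "('a::euclidean_space \<Rightarrow> real) \<Rightarrow> bool" where
  "multiplier \<psi> \<longleftrightarrow> smooth_fun \<psi> \<and> (\<exists>C>0. (\<forall>x. \<bar>\<psi> x\<bar> \<le> C) \<and> (\<forall>x y. \<bar>\<psi> x - \<psi> y\<bar> * (1 + norm x) \<le> C * norm (x - y)))"

text \<open>\<open>lipschitz_kernel_bound\<close> with two choices of \<open>L\<close>, namely C and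
  C / |x|. The uniform bound yields the L^2 error of the localization; the decaying one is dominated
  by the Hardy weight.\<close>

lemma multiplier_kernel_bound:
  fixes \<psi> :: "'a::euclidean_space \<Rightarrow> real"
  assumes s: "0 < s" "s < 1" and \<psi>: "multiplier \<psi>"
  shows "\<exists>K\<ge>0. \<forall>x. (\<integral>\<^sup>+y. ennreal (\<bar>\<psi> x - \<psi> y\<bar>\<^sup>2 / norm (x - y) powr (real DIM('a) + 2 * s)) \<partial>lebesgue) \<le> ennreal K \<and>
     (x \<noteq> 0 \<longrightarrow> (\<integral>\<^sup>+y. ennreal (\<bar>\<psi> x - \<psi> y\<bar>\<^sup>2 / norm (x - y) powr (real DIM('a) + 2 * s)) \<partial>lebesgue) \<le> ennreal (K / norm x powr (2 * s)))"
proof -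
  obtain C where C: "C > 0" "\<And>x. \<bar>\<psi> x\<bar> \<le> C" "\<And>x y. \<bar>\<psi> x - \<psi> y\<bar> * (1 + norm x) \<le> C * norm (x - y)"
    using \<psi> unfolding multiplier_def by blast
  obtain \<kappa> where \<kappa>: "\<kappa> \<ge> 0" and bound: "\<And>x L. L > 0 \<Longrightarrow> (\<forall>y. \<bar>\<psi> x - \<psi> y\<bar> \<le> L * norm (x - y)) \<Longrightarrow>
     (\<integral>\<^sup>+y. ennreal (\<bar>\<psi> x - \<psi> y\<bar>\<^sup>2 / norm (x - y) powr (real DIM('a) + 2 * s)) \<partial>lebesgue) \<le> ennreal (\<kappa> * (1 + C\<^sup>2) * L powr (2 * s))"
    using lipschitz_kernel_bound[OF s, where 'a='a] C(2) by blast
  let ?J = "\<lambda>x. (\<integral>\<^sup>+y. ennreal (\<bar>\<psi> x - \<psi> y\<bar>\<^sup>2 / norm (x - y) powr (real DIM('a) + 2 * s)) \<partial>lebesgue)"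
  define K where "K = \<kappa> * (1 + C\<^sup>2) * C powr (2 * s)"
  have K: "K \<ge> 0" using \<kappa> by (simp add: K_def)
  have 1: "?J x \<le> ennreal K" for x
    unfolding K_def
  proof (rule bound[OF C(1)], intro allI)
    fix y
    have "\<bar>\<psi> x - \<psi> y\<bar> \<le> \<bar>\<psi> x - \<psi> y\<bar> * (1 + norm x)" by (simp add: distrib_left)
    then show "\<bar>\<psi> x - \<psi> y\<bar> \<le> C * norm (x - y)" using C(3)[of x y] by linarith
  qed
  have 2: "?J x \<le> ennreal (K / norm x powr (2 * s))" if x: "x \<noteq> 0" for x
  proof -
    have "?J x \<le> ennreal (\<kappa> * (1 + C\<^sup>2) * (C / norm x) powr (2 * s))"
    proof (rule bound, use C(1) x in simp, intro allI)
      fix y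
      have "\<bar>\<psi> x - \<psi> y\<bar> * norm x \<le> \<bar>\<psi> x - \<psi> y\<bar> * (1 + norm x)" by (intro mult_left_mono) auto
      then have "\<bar>\<psi> x - \<psi> y\<bar> * norm x \<le> C * norm (x - y)" using C(3)[of x y] by linarith
      then show "\<bar>\<psi> x - \<psi> y\<bar> \<le> C / norm x * norm (x - y)" using x by (simp add: field_simps)
    qed
    then show ?thesis using x by (simp add: K_def powr_divide)
  qed
  show ?thesis using K 1 2 by blast
qed

text \<open>The commutator term of \<open>gagliardo_mult_le\<close> cannot be estimated by an L^2
  norm, which may be infinite here. Its kernel is at most K |x|^(-2s), so the Hardy inequality
  returns it to the energy.\<close>

lemma multiplier_energy_le:
  fixes \<psi> :: "'a::euclidean_space \<Rightarrow> real"
  assumes s: "0 < s" "s < 1" and N: "real DIM('a) > 2 * s" and \<psi>: "multiplier \<psi>"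
  shows "\<exists>C. \<forall>v\<in>Hdot s. ext_energy s (\<lambda>x. \<psi> x * v x) \<le> ennreal C * ext_energy s v"
proof -
  obtain B where B: "B > 0" "\<And>x. \<bar>\<psi> x\<bar> \<le> B" using \<psi> unfolding multiplier_def by blast
  have [measurable]: "\<psi> \<in> borel_measurable lebesgue"
    using \<psi> unfolding multiplier_def by (intro measurable_completion) (simp add: borel_measurable_smooth)
  obtain K where K: "K \<ge> 0" "\<And>x. x \<noteq> 0 \<Longrightarrow> (\<integral>\<^sup>+y. ennreal (\<bar>\<psi> x - \<psi> y\<bar>\<^sup>2 / norm (x - y) powr (real DIM('a) + 2 * s)) \<partial>lebesgue) \<le> ennreal (K / norm x powr (2 * s))"
    using multiplier_kernel_bound[OF s \<psi>] by blast
  have ae0: "AE x in lebesgue. x \<noteq> (0::'a)"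
    by (rule AE_completion) (rule AE_lborel_singleton)
  let ?\<Lambda> = "Hardy_const TYPE('a) s" and ?c = "C_const TYPE('a) s / 2"
  have \<Lambda>: "?\<Lambda> > 0" using Hardy_const_pos[OF N s(1)] .
  have c: "?c > 0" using C_const_pos[OF s, where 'a='a] by simp
  have "ext_energy s (\<lambda>x. \<psi> x * v x) \<le> ennreal (2 * B\<^sup>2 + ?c * (2 * K) / ?\<Lambda>) * ext_energy s v" if v: "v \<in> Hdot s" for v
  proof -
    note vm[measurable] = Hdot_measurable[OF v]
    let ?H = "\<integral>\<^sup>+x. ennreal ((v x)\<^sup>2 / norm x powr (2 * s)) \<partial>lebesgue"
    have g: "gagliardo s (\<lambda>x. \<psi> x * v x) \<le> ennreal (2 * B\<^sup>2) * gagliardo s v + 2 * (\<integral>\<^sup>+x. ennreal ((v x)\<^sup>2) * ennreal (K / norm x powr (2 * s)) \<partial>lebesgue)"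
      by (rule gagliardo_mult_le) (use B ae0 K in \<open>auto elim: eventually_mono\<close>)
    have "(\<integral>\<^sup>+x. ennreal ((v x)\<^sup>2) * ennreal (K / norm x powr (2 * s)) \<partial>lebesgue) = (\<integral>\<^sup>+x. ennreal K * ennreal ((v x)\<^sup>2 / norm x powr (2 * s)) \<partial>lebesgue)"
      using K(1) by (intro nn_integral_cong) (simp add: ennreal_mult'[symmetric] mult_ac)
    also have "\<dots> = ennreal K * ?H" by (rule nn_integral_cmult) measurable
    also have "\<dots> = ennreal (K / ?\<Lambda>) * (ennreal ?\<Lambda> * ?H)"
      using \<Lambda> K(1) by (simp add: mult.assoc[symmetric] ennreal_mult'[symmetric])
    also have "\<dots> \<le> ennreal (K / ?\<Lambda>) * ext_energy s v"
      by (intro mult_left_mono Hdot_hardy[OF s N v]) simp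
    finally have h: "(\<integral>\<^sup>+x. ennreal ((v x)\<^sup>2) * ennreal (K / norm x powr (2 * s)) \<partial>lebesgue) \<le> ennreal (K / ?\<Lambda>) * ext_energy s v" .
    have "ext_energy s (\<lambda>x. \<psi> x * v x) = ennreal ?c * gagliardo s (\<lambda>x. \<psi> x * v x)"
      by (rule ext_energy_eq) measurable
    also have "\<dots> \<le> ennreal ?c * (ennreal (2 * B\<^sup>2) * gagliardo s v + 2 * (ennreal (K / ?\<Lambda>) * ext_energy s v))"
      by (intro mult_left_mono order.trans[OF g] add_left_mono h) auto
    also have "\<dots> = ennreal (2 * B\<^sup>2) * (ennreal ?c * gagliardo s v) + (ennreal ?c * (ennreal 2 * ennreal (K / ?\<Lambda>))) * ext_energy s v"
      unfolding distrib_left by (simp add: mult_ac)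
    also have "ennreal ?c * gagliardo s v = ext_energy s v" by (rule ext_energy_eq[symmetric]) measurable
    also have "ennreal ?c * (ennreal 2 * ennreal (K / ?\<Lambda>)) = ennreal (?c * (2 * K) / ?\<Lambda>)"
    proof -
      have "ennreal (?c * (2 * (K / ?\<Lambda>))) = ennreal ?c * (ennreal 2 * ennreal (K / ?\<Lambda>))"
        using c by (simp only: ennreal_mult' less_imp_le zero_le_numeral)
      then show ?thesis by (simp only: times_divide_eq_right)
    qed
    also have "ennreal (2 * B\<^sup>2) * ext_energy s v + ennreal (?c * (2 * K) / ?\<Lambda>) * ext_energy s v = ennreal (2 * B\<^sup>2 + ?c * (2 * K) / ?\<Lambda>) * ext_energy s v"
      using c K \<Lambda> by (subst ennreal_plus) (auto simp: distrib_right)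
    finally show ?thesis .
  qed
  then show ?thesis by blast
qed

text \<open>The products of \<psi> with the approximating test functions are again test functions,
  and \<open>multiplier_energy_le\<close>, applied to the errors, makes them converge in
  energy.\<close>

lemma Hdot_mult:
  fixes \<psi> :: "'a::euclidean_space \<Rightarrow> real"
  assumes s: "0 < s" "s < 1" and N: "real DIM('a) > 2 * s" and \<psi>: "multiplier \<psi>" and u: "u \<in> Hdot s"
  shows "(\<lambda>x. \<psi> x * u x) \<in> Hdot s"
proof -
  note m[measurable] = Hdot_measurable[OF u]
  have sm: "smooth_fun \<psi>" using \<psi> by (simp add: multiplier_def)
  have [measurable]: "\<psi> \<in> borel_measurable lebesgue"
    using sm by (intro measurable_completion) (simp add: borel_measurable_smooth)
  obtain \<phi> where \<phi>: "\<And>n. test_function (\<phi> n)" "((\<lambda>n. ext_energy s (\<lambda>x. \<phi> n x - u x)) \<longlongrightarrow> 0) sequentially"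
    "AE x in lebesgue. (\<lambda>n::nat. \<phi> n x) \<longlonglongrightarrow> u x"
    using u unfolding Hdot_def by blast
  obtain C where C: "\<And>v. v \<in> Hdot s \<Longrightarrow> ext_energy s (\<lambda>x. \<psi> x * v x) \<le> ennreal C * ext_energy s v"
    using multiplier_energy_le[OF s N \<psi>] by blast
  have le: "ext_energy s (\<lambda>x. \<psi> x * \<phi> n x - \<psi> x * u x) \<le> ennreal C * ext_energy s (\<lambda>x. \<phi> n x - u x)" for n
    using C[OF Hdot_diff_test[OF u \<phi>(1)], of n] by (simp add: right_diff_distrib)
  have "((\<lambda>n. ennreal C * ext_energy s (\<lambda>x. \<phi> n x - u x)) \<longlongrightarrow> ennreal C * 0) sequentially"
    by (intro ennreal_tendsto_cmult \<phi>(2)) simp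
  then have 1: "((\<lambda>n. ext_energy s (\<lambda>x. \<psi> x * \<phi> n x - \<psi> x * u x)) \<longlongrightarrow> 0) sequentially"
    unfolding mult_zero_right
    by (rule tendsto_sandwich[OF always_eventually[OF allI[OF zero_le]] always_eventually[OF allI[OF le]] tendsto_const])
  have 2: "AE x in lebesgue. (\<lambda>n. \<psi> x * \<phi> n x) \<longlonglongrightarrow> \<psi> x * u x"
    using \<phi>(3) by eventually_elim (intro tendsto_intros)
  have "(\<lambda>x. \<psi> x * u x) \<in> borel_measurable lebesgue" by measurable
  then show ?thesis unfolding Hdot_def
    using 1 2 test_function_mult_smooth[OF \<phi>(1) sm]
    by (intro CollectI conjI exI[of _ "\<lambda>n x. \<psi> x * \<phi> n x"]) auto
qed

section \<open>Partitions of unity and Minkowski's inequality\<close>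

lemma multiplier_smooth: "multiplier f \<Longrightarrow> smooth_fun f"
  by (simp add: multiplier_def)

lemma multiplier_const: "multiplier (\<lambda>_. c)"
  unfolding multiplier_def by (intro conjI smooth_const exI[of _ "\<bar>c\<bar> + 1"]) auto

lemma multiplier_add:
  assumes "multiplier f" "multiplier g"
  shows "multiplier (\<lambda>x. f x + g x)"
proof -
  obtain B where B: "B > 0" "\<And>x. \<bar>f x\<bar> \<le> B" "\<And>x y. \<bar>f x - f y\<bar> * (1 + norm x) \<le> B * norm (x - y)"
    using assms(1) unfolding multiplier_def by blast
  obtain C where C: "C > 0" "\<And>x. \<bar>g x\<bar> \<le> C" "\<And>x y. \<bar>g x - g y\<bar> * (1 + norm x) \<le> C * norm (x - y)"
    using assms(2) unfolding multiplier_def by blast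
  have "\<bar>f x + g x - (f y + g y)\<bar> * (1 + norm x) \<le> (B + C) * norm (x - y)" for x y
  proof -
    have "\<bar>f x + g x - (f y + g y)\<bar> \<le> \<bar>f x - f y\<bar> + \<bar>g x - g y\<bar>" by linarith
    then have "\<bar>f x + g x - (f y + g y)\<bar> * (1 + norm x) \<le> (\<bar>f x - f y\<bar> + \<bar>g x - g y\<bar>) * (1 + norm x)"
      by (intro mult_right_mono) auto
    then show ?thesis using B(3)[of x y] C(3)[of x y] by (simp add: distrib_right)
  qed
  moreover have "\<bar>f x + g x\<bar> \<le> B + C" for x using B(2)[of x] C(2)[of x] by linarith
  ultimately show ?thesis
    unfolding multiplier_def using smooth_add[OF multiplier_smooth[OF assms(1)] multiplier_smooth[OF assms(2)]] B(1) C(1)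
    by (intro conjI exI[of _ "B + C"]) auto
qed

lemma multiplier_mult:
  assumes "multiplier f" "multiplier g"
  shows "multiplier (\<lambda>x. f x * g x)"
proof -
  obtain B where B: "B > 0" "\<And>x. \<bar>f x\<bar> \<le> B" "\<And>x y. \<bar>f x - f y\<bar> * (1 + norm x) \<le> B * norm (x - y)"
    using assms(1) unfolding multiplier_def by blast
  obtain C where C: "C > 0" "\<And>x. \<bar>g x\<bar> \<le> C" "\<And>x y. \<bar>g x - g y\<bar> * (1 + norm x) \<le> C * norm (x - y)"
    using assms(2) unfolding multiplier_def by blast
  have "\<bar>f x * g x - f y * g y\<bar> * (1 + norm x) \<le> (2 * B * C) * norm (x - y)" for x y
  proof -
    have "f x * g x - f y * g y = (f x - f y) * g x + f y * (g x - g y)" by (simp add: algebra_simps)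
    then have "\<bar>f x * g x - f y * g y\<bar> \<le> \<bar>f x - f y\<bar> * \<bar>g x\<bar> + \<bar>f y\<bar> * \<bar>g x - g y\<bar>"
      using abs_triangle_ineq[of "(f x - f y) * g x" "f y * (g x - g y)"] by (simp add: abs_mult)
    also have "\<dots> \<le> \<bar>f x - f y\<bar> * C + B * \<bar>g x - g y\<bar>"
      by (intro add_mono mult_left_mono mult_right_mono B C) auto
    finally have "\<bar>f x * g x - f y * g y\<bar> * (1 + norm x) \<le> (\<bar>f x - f y\<bar> * C + B * \<bar>g x - g y\<bar>) * (1 + norm x)"
      by (intro mult_right_mono) auto
    also have "\<dots> = C * (\<bar>f x - f y\<bar> * (1 + norm x)) + B * (\<bar>g x - g y\<bar> * (1 + norm x))" by (simp add: algebra_simps)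
    also have "\<dots> \<le> C * (B * norm (x - y)) + B * (C * norm (x - y))"
      using B(1) C(1) by (intro add_mono mult_left_mono B(3) C(3)) auto
    finally show ?thesis by (simp add: algebra_simps)
  qed
  moreover have "\<bar>f x * g x\<bar> \<le> 2 * B * C" for x
  proof -
    have "\<bar>f x * g x\<bar> \<le> B * C" unfolding abs_mult using B(1) by (intro mult_mono B(2) C(2)) auto
    moreover have "0 \<le> B * C" using B(1) C(1) by simp
    ultimately show ?thesis by linarith
  qed
  ultimately show ?thesis
    unfolding multiplier_def using smooth_mult[OF multiplier_smooth[OF assms(1)] multiplier_smooth[OF assms(2)]] B(1) C(1)
    by (intro conjI exI[of _ "2 * B * C"]) auto
qed

lemma multiplier_sum: "(\<And>i. i \<in> I \<Longrightarrow> multiplier (f i)) \<Longrightarrow> multiplier (\<lambda>x. \<Sum>i\<in>I. f i x)"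
  by (induction I rule: infinite_finite_induct) (auto intro: multiplier_const multiplier_add)

lemma multiplier_prod: "(\<And>i. i \<in> I \<Longrightarrow> multiplier (f i)) \<Longrightarrow> multiplier (\<lambda>x. \<Prod>i\<in>I. f i x)"
  by (induction I rule: infinite_finite_induct) (auto intro: multiplier_const multiplier_mult)

text \<open>Serves to normalise the partition of unity. The lower bound \<open>c\<close> keeps the
  inverse square root Lipschitz on the range of \<open>f\<close>, with constant at most 1 / m^3 for
  m = sqrt c.\<close>

lemma multiplier_inverse_sqrt:
  assumes f: "multiplier f" and c: "c > 0" "\<And>x. f x \<ge> c"
  shows "multiplier (\<lambda>x. 1 / sqrt (f x))"
proof -
  obtain B where B: "B > 0" "\<And>x y. \<bar>f x - f y\<bar> * (1 + norm x) \<le> B * norm (x - y)"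
    using f unfolding multiplier_def by blast
  have pos: "f x > 0" for x using c(2)[of x] c(1) by linarith
  define m where "m = sqrt c"
  have m: "m > 0" "\<And>x. m \<le> sqrt (f x)" using c by (auto simp: m_def)
  have lip: "\<bar>1 / sqrt (f x) - 1 / sqrt (f y)\<bar> \<le> \<bar>f x - f y\<bar> / (m * m * m)" for x y
  proof -
    define p where "p = sqrt (f x)"
    define q where "q = sqrt (f y)"
    have pq: "p > 0" "q > 0" "m \<le> p" "m \<le> q" "f x = p * p" "f y = q * q"
      using pos m(2) by (auto simp: p_def q_def less_imp_le)
    have "1 / p - 1 / q = (q * q - p * p) / (p * q * (p + q))"
      using pq(1,2) by (simp add: divide_simps) (simp add: algebra_simps)
    then have "\<bar>1 / p - 1 / q\<bar> = \<bar>f x - f y\<bar> / (p * q * (p + q))"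
      using pq by (simp add: abs_divide abs_minus_commute abs_mult)
    also have "\<dots> \<le> \<bar>f x - f y\<bar> / (m * m * m)"
    proof (rule divide_left_mono)
      have "m * m * m \<le> p * q * p" using pq m(1) by (intro mult_mono) auto
      also have "\<dots> \<le> p * q * (p + q)" using pq by (intro mult_left_mono) auto
      finally show "m * m * m \<le> p * q * (p + q)" .
    qed (use pq m in \<open>auto intro!: mult_pos_pos add_pos_pos\<close>)
    finally show ?thesis by (simp add: p_def q_def)
  qed
  define C where "C = B / (m * m * m) + 1 / m"
  have C: "C > 0" using B m by (simp add: C_def add_pos_pos)
  have "\<bar>1 / sqrt (f x) - 1 / sqrt (f y)\<bar> * (1 + norm x) \<le> C * norm (x - y)" for x y
  proof -
    have "\<bar>1 / sqrt (f x) - 1 / sqrt (f y)\<bar> * (1 + norm x) \<le> \<bar>f x - f y\<bar> / (m * m * m) * (1 + norm x)"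
      by (intro mult_right_mono lip) auto
    also have "\<dots> = (\<bar>f x - f y\<bar> * (1 + norm x)) / (m * m * m)" by simp
    also have "\<dots> \<le> (B * norm (x - y)) / (m * m * m)" using m(1) by (intro divide_right_mono B(2)) auto
    also have "\<dots> \<le> C * norm (x - y)" using m(1) by (simp add: C_def distrib_right)
    finally show ?thesis .
  qed
  moreover have "\<bar>1 / sqrt (f x)\<bar> \<le> C" for x
  proof -
    have "1 / sqrt (f x) \<le> 1 / m" using m pos by (intro divide_left_mono) auto
    also have "\<dots> \<le> C" using B m by (simp add: C_def)
    finally show ?thesis using pos[of x] by simp
  qed
  moreover have "smooth_fun (\<lambda>x. 1 / sqrt (f x))"
  proof -
    have "(\<lambda>x. 1 / sqrt (f x)) = (\<lambda>x. f x powr (- (1/2)))"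
      using pos by (simp add: powr_minus_divide powr_half_sqrt less_imp_le)
    then show ?thesis using smooth_powr[OF multiplier_smooth[OF f] pos] by simp
  qed
  ultimately show ?thesis unfolding multiplier_def using C by blast
qed

text \<open>It vanishes at \<open>a\<close> only and tends to 1 at infinity with a gradient of order
  |x|^(-3), fast enough for a multiplier. Being rational in the coordinates, it is smooth by
  \<open>smooth_powr\<close>.\<close>

definition bump :: "'a::euclidean_space \<Rightarrow> 'a \<Rightarrow> real" where
  "bump a x = 1 - 1 / (1 + (norm (x - a))\<^sup>2)"

lemma multiplier_bump: "multiplier (bump a)"
proof -
  have sm: "smooth_fun (bump a)"
  proof -
    have q: "smooth_fun (\<lambda>x. 1 + (norm (x - a))\<^sup>2)"
    proof -
      have eq: "1 + (norm (x - a))\<^sup>2 = 1 + (\<Sum>b\<in>Basis. (x \<bullet> b + - (a \<bullet> b)) * (x \<bullet> b + - (a \<bullet> b)))" for x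
        unfolding power2_norm_eq_inner euclidean_inner[of "x - a" "x - a"] by (simp add: inner_diff_left)
      show ?thesis unfolding eq by (intro smooth_add smooth_sum smooth_mult smooth_const smooth_coord)
    qed
    have "smooth_fun (\<lambda>x. 1 + (-1) * (1 + (norm (x - a))\<^sup>2) powr (-1))"
      by (intro smooth_add smooth_mult smooth_const smooth_powr q) (simp add: add_pos_nonneg)
    moreover have "(\<lambda>x. 1 + (-1) * (1 + (norm (x - a))\<^sup>2) powr (-1)) = bump a"
      by (rule ext) (simp add: bump_def powr_minus_divide)
    ultimately show ?thesis by simp
  qed
  \<comment> \<open>The 4 comes from the bound on (q + p) (1 + q) below, the factor 1 + |a| from
    replacing 1 + |x| by 1 + |x - a|.\<close>
  define C where "C = 4 * (1 + norm a)"
  have C: "C \<ge> 1" by (simp add: C_def)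
  have "\<bar>bump a x - bump a y\<bar> * (1 + norm x) \<le> C * norm (x - y)" for x y
  proof -
    define q where "q = norm (x - a)"
    define p where "p = norm (y - a)"
    have q: "q \<ge> 0" "p \<ge> 0" by (auto simp: q_def p_def)
    have P: "1 + q\<^sup>2 > 0" "1 + p\<^sup>2 > 0" by (auto simp: add_pos_nonneg)
    have pq: "\<bar>q - p\<bar> \<le> norm (x - y)"
      using norm_triangle_ineq3[of "x - a" "y - a"] by (simp add: q_def p_def)
    have "bump a x - bump a y = (q - p) * ((q + p) / ((1 + q\<^sup>2) * (1 + p\<^sup>2)))"
      using P by (simp add: bump_def q_def[symmetric] p_def[symmetric] divide_simps) (simp add: algebra_simps power2_eq_square)
    then have "\<bar>bump a x - bump a y\<bar> = \<bar>q - p\<bar> * ((q + p) / ((1 + q\<^sup>2) * (1 + p\<^sup>2)))"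
      using P q by (simp add: abs_mult)
    also have "\<dots> \<le> norm (x - y) * (4 / (1 + q))"
    proof (intro mult_mono pq)
      have sq: "2 * r \<le> 1 + r\<^sup>2" for r :: real
        using zero_le_power2[of "r - 1"] by (simp add: power2_eq_square algebra_simps)
      have nn: "0 \<le> q\<^sup>2" "0 \<le> p\<^sup>2" by simp_all
      have h1: "p \<le> 1 + p\<^sup>2" using sq[of p] nn q by linarith
      have e2: "2 * (1 + q\<^sup>2) = 2 + 2 * q\<^sup>2" by simp
      have h2: "1 + q \<le> 2 * (1 + q\<^sup>2)" unfolding e2 using sq[of q] nn(1) q(1) by argo
      have "q * (1 + q) = q + q\<^sup>2" by (simp add: power2_eq_square algebra_simps)
      then have h3: "q * (1 + q) \<le> 2 * (1 + q\<^sup>2)" unfolding e2 using sq[of q] nn(1) q(1) by argo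
      note h = h1 h2 h3
      have "q * (1 + q) * 1 \<le> 2 * (1 + q\<^sup>2) * (1 + p\<^sup>2)" by (rule mult_mono) (use h q in auto)
      moreover have "p * (1 + q) \<le> (1 + p\<^sup>2) * (2 * (1 + q\<^sup>2))" by (rule mult_mono) (use h q in auto)
      ultimately have le: "(q + p) * (1 + q) \<le> 4 * ((1 + q\<^sup>2) * (1 + p\<^sup>2))" by (simp add: algebra_simps)
      define X where "X = (1 + q\<^sup>2) * (1 + p\<^sup>2)"
      have X: "X > 0" using P by (simp add: X_def)
      have "q + p \<le> 4 * X / (1 + q)" using le q by (simp add: X_def[symmetric] pos_le_divide_eq)
      then have "(q + p) / X \<le> 4 / (1 + q)" using X by (simp add: pos_divide_le_eq)
      then show "(q + p) / ((1 + q\<^sup>2) * (1 + p\<^sup>2)) \<le> 4 / (1 + q)" by (simp only: X_def)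
    qed (use q P in auto)
    finally have "\<bar>bump a x - bump a y\<bar> * (1 + norm x) \<le> norm (x - y) * (4 / (1 + q)) * (1 + norm x)"
      by (intro mult_right_mono) auto
    also have "\<dots> \<le> norm (x - y) * (4 / (1 + q)) * ((1 + norm a) * (1 + q))"
    proof (intro mult_left_mono)
      have "norm x \<le> q + norm a" using norm_triangle_ineq[of "x - a" a] by (simp add: q_def)
      moreover have "0 \<le> norm a * q" using q by simp
      ultimately show "1 + norm x \<le> (1 + norm a) * (1 + q)" by (simp add: algebra_simps)
    qed (use q in auto)
    also have "\<dots> = C * norm (x - y)"
      using q by (simp add: C_def)
    finally show ?thesis .
  qed
  moreover have "\<bar>bump a x\<bar> \<le> C" for x
  proof -
    have "0 \<le> 1 / (1 + (norm (x - a))\<^sup>2)" "1 / (1 + (norm (x - a))\<^sup>2) \<le> 1" by (auto simp: divide_le_eq_1 add_pos_nonneg)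
    then have "\<bar>bump a x\<bar> \<le> 1" by (auto simp: bump_def)
    then show ?thesis using C by linarith
  qed
  ultimately show ?thesis unfolding multiplier_def using C sm by (intro conjI exI[of _ C]) auto
qed

lemma bump_self: "bump a a = 0"
  by (simp add: bump_def)

lemma bump_lower: "r \<ge> 0 \<Longrightarrow> norm (x - a) \<ge> r \<Longrightarrow> bump a x \<ge> 1 - 1 / (1 + r\<^sup>2)"
  unfolding bump_def by (intro diff_left_mono divide_left_mono add_left_mono power_mono) (auto simp: add_pos_nonneg)

text \<open>\<open>\<rho> i\<close> is zero at all the points other than \<open>a i\<close>, and
  dividing by the root of the sum of squares normalises. That sum is bounded below: at any x take
  the index of the nearest point; the other points are then at distance at least d / 2, so every
  bump in the product for this index exceeds a fixed constant.\<close>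

lemma partition_at_points:
  fixes a :: "'i \<Rightarrow> 'a::euclidean_space"
  assumes I: "finite I" "I \<noteq> {}" and inj: "inj_on a I"
  shows "\<exists>\<psi>. (\<forall>i\<in>I. multiplier (\<psi> i)) \<and> (\<forall>x. (\<Sum>i\<in>I. (\<psi> i x)\<^sup>2) = 1) \<and> (\<forall>i\<in>I. \<forall>j\<in>I. i \<noteq> j \<longrightarrow> \<psi> j (a i) = 0)"
proof -
  define \<rho> where "\<rho> i x = (\<Prod>j\<in>I - {i}. bump (a j) x)" for i x
  define D where "D x = (\<Sum>i\<in>I. \<rho> i x * \<rho> i x)" for x
  have m\<rho>: "multiplier (\<rho> i)" for i unfolding \<rho>_def[abs_def] by (intro multiplier_prod multiplier_bump)
  have mD: "multiplier D" unfolding D_def[abs_def] by (intro multiplier_sum multiplier_mult m\<rho>)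
  obtain d where d: "d > 0" "\<And>i j. i \<in> I \<Longrightarrow> j \<in> I \<Longrightarrow> i \<noteq> j \<Longrightarrow> d \<le> norm (a i - a j)"
  proof -
    \<comment> \<open>The element 1 keeps the set nonempty when there is a single point.\<close>
    let ?S = "insert 1 ((\<lambda>(i, j). norm (a i - a j)) ` {(i, j) \<in> I \<times> I. i \<noteq> j})"
    have "finite {(i, j) \<in> I \<times> I. i \<noteq> j}" using I(1) by (intro finite_subset[OF _ finite_cartesian_product[OF I(1) I(1)]]) auto
    then have fin: "finite ?S" by simp
    have "Min ?S > 0" using fin inj by (subst Min_gr_iff) (auto simp: inj_on_def)
    moreover have "Min ?S \<le> norm (a i - a j)" if "i \<in> I" "j \<in> I" "i \<noteq> j" for i j
      using that by (intro Min_le[OF fin]) force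
    ultimately show ?thesis using that by blast
  qed
  define c0 where "c0 = 1 - 1 / (1 + (d / 2)\<^sup>2)"
  have c0: "0 < c0" "c0 \<le> 1" using d(1) by (auto simp: c0_def add_pos_pos divide_less_eq_1)
  define c where "c = c0 ^ card I * c0 ^ card I"
  have c: "c > 0" using c0 by (simp add: c_def)
  have Dc: "D x \<ge> c" for x
  proof -
    have "\<exists>i\<in>I. \<forall>j\<in>I. norm (x - a i) \<le> norm (x - a j)"
      using I ex_min_if_finite[of "(\<lambda>i. norm (x - a i)) ` I"] by (auto simp: not_less)
    then obtain i where i: "i \<in> I" "\<And>j. j \<in> I \<Longrightarrow> norm (x - a i) \<le> norm (x - a j)" by blast
    have far: "d / 2 \<le> norm (x - a j)" if j: "j \<in> I - {i}" for j
    proof -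
      have "d \<le> norm (a i - a j)" using d(2)[of i j] i(1) j by auto
      also have "\<dots> \<le> norm (x - a i) + norm (x - a j)"
        using norm_triangle_ineq4[of "x - a j" "x - a i"] by simp
      also have "\<dots> \<le> 2 * norm (x - a j)" using i(2)[of j] j by simp
      finally show ?thesis by simp
    qed
    have "c0 ^ card I \<le> c0 ^ card (I - {i})"
      using c0 I(1) by (intro power_decreasing) (auto intro: card_mono)
    also have "\<dots> = (\<Prod>j\<in>I - {i}. c0)" by simp
    also have "\<dots> \<le> \<rho> i x"
      unfolding \<rho>_def c0_def using c0 d(1) by (intro prod_mono conjI bump_lower far) (auto simp: c0_def)
    finally have lo: "c0 ^ card I \<le> \<rho> i x" .
    moreover have "0 \<le> c0 ^ card I" using c0 by simp
    ultimately have "0 \<le> \<rho> i x" by linarith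
    with lo have "c \<le> \<rho> i x * \<rho> i x" unfolding c_def using c0 by (intro mult_mono) auto
    also have "\<dots> \<le> D x"
      unfolding D_def using I(1) i(1) by (intro member_le_sum[of i I "\<lambda>i. \<rho> i x * \<rho> i x"]) auto
    finally show ?thesis .
  qed
  define \<psi> where "\<psi> i x = \<rho> i x * (1 / sqrt (D x))" for i x
  have "multiplier (\<psi> i)" for i
    unfolding \<psi>_def[abs_def] by (intro multiplier_mult m\<rho> multiplier_inverse_sqrt[OF mD c] Dc)
  moreover have "(\<Sum>i\<in>I. (\<psi> i x)\<^sup>2) = 1" for x
  proof -
    have D0: "D x > 0" using Dc[of x] c by linarith
    have "(\<Sum>i\<in>I. (\<psi> i x)\<^sup>2) = (\<Sum>i\<in>I. \<rho> i x * \<rho> i x / D x)"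
      using D0 by (intro sum.cong) (auto simp: \<psi>_def power_mult_distrib power_divide power2_eq_square)
    also have "\<dots> = (\<Sum>i\<in>I. \<rho> i x * \<rho> i x) / D x" by (rule sum_divide_distrib[symmetric])
    also have "\<dots> = D x / D x" by (simp only: D_def)
    finally show ?thesis using D0 by simp
  qed
  moreover have "\<psi> j (a i) = 0" if "i \<in> I" "j \<in> I" "i \<noteq> j" for i j
  proof -
    have "\<rho> j (a i) = 0" unfolding \<rho>_def using that I(1) by (intro prod_zero) (auto intro!: bexI[of _ i] simp: bump_self)
    then show ?thesis by (simp add: \<psi>_def)
  qed
  ultimately show ?thesis by (intro exI[of _ \<psi>]) auto
qed

section \<open>Minkowski's inequality for finite sums\<close>

lemma convex_on_powr_nonneg:
  assumes q: "q \<ge> (1::real)"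
  shows "convex_on {0..} (\<lambda>x. x powr q)"
proof (rule convex_onI)
  fix t x y :: real
  assume t: "0 < t" "t < 1" and xy: "x \<in> {0..}" "y \<in> {0..}"
  \<comment> \<open>When an endpoint is 0, convexity reduces to this inequality, which holds since 0
    < r < 1 and q is at least 1.\<close>
  have scale: "(r * z) powr q \<le> r * z powr q" if "0 < r" "r < 1" "z \<ge> 0" for r z :: real
  proof -
    have "r powr q \<le> r powr 1" using that q by (intro powr_mono') auto
    then show ?thesis using that by (simp add: powr_mult mult_right_mono)
  qed
  show "((1 - t) *\<^sub>R x + t *\<^sub>R y) powr q \<le> (1 - t) * x powr q + t * y powr q"
  proof (cases "x = 0 \<or> y = 0")
    case True
    then show ?thesis
    proof
      assume "x = 0" then show ?thesis using scale[of t y] t xy by simp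
    next
      assume "y = 0" then show ?thesis using scale[of "1 - t" x] t xy by simp
    qed
  next
    case False
    then show ?thesis using convex_onD[OF powr_convex[OF q], of t x y] t xy by auto
  qed
qed auto

text \<open>Convexity of the power with weights \<open>l i\<close> proportional to the individual
  norms; for these weights the sum of the convexity bounds collapses to a power of the sum of the
  norms.\<close>

lemma minkowski_integral:
  fixes f :: "'i \<Rightarrow> 'a \<Rightarrow> real"
  assumes I: "finite I" "I \<noteq> {}" and q: "q \<ge> 1"
    and nn: "\<And>i x. i \<in> I \<Longrightarrow> f i x \<ge> 0"
    and int: "\<And>i. i \<in> I \<Longrightarrow> integrable M (\<lambda>x. f i x powr q)"
    and intF: "integrable M (\<lambda>x. (\<Sum>i\<in>I. f i x) powr q)"
  shows "(\<integral>x. (\<Sum>i\<in>I. f i x) powr q \<partial>M) powr (1 / q) \<le> (\<Sum>i\<in>I. (\<integral>x. f i x powr q \<partial>M) powr (1 / q))"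
proof -
  define A where "A i = (\<integral>x. f i x powr q \<partial>M) powr (1 / q)" for i
  have A0: "A i \<ge> 0" for i by (simp add: A_def)
  have Aq: "A i powr q = (\<integral>x. f i x powr q \<partial>M)" for i
    using q by (simp add: A_def powr_powr)
  show ?thesis
    unfolding A_def[symmetric]
  proof (rule field_le_epsilon)
    fix e :: real assume e: "e > 0"
    \<comment> \<open>Added to every norm so that the weights stay positive when a norm vanishes;
      the total excess is \<open>e\<close>.\<close>
    define \<epsilon> where "\<epsilon> = e / real (card I)"
    have \<epsilon>: "\<epsilon> > 0" using e I by (simp add: \<epsilon>_def card_gt_0_iff)
    define T where "T = (\<Sum>i\<in>I. A i + \<epsilon>)"
    have T: "T > 0" unfolding T_def using I A0 \<epsilon> by (intro sum_pos) (auto intro: add_nonneg_pos)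
    define l where "l i = (A i + \<epsilon>) / T" for i
    have l0: "l i > 0" for i using A0[of i] \<epsilon> T by (simp add: l_def add_nonneg_pos)
    have l1: "(\<Sum>i\<in>I. l i) = 1" using T by (simp add: l_def sum_divide_distrib[symmetric] T_def[symmetric])
    have pt: "(\<Sum>i\<in>I. f i x) powr q \<le> (\<Sum>i\<in>I. l i powr (1 - q) * f i x powr q)" for x
    proof -
      have "(\<Sum>i\<in>I. f i x) = (\<Sum>i\<in>I. l i *\<^sub>R (f i x / l i))" using l0 by (intro sum.cong) (auto simp: less_imp_neq[symmetric])
      then have "(\<Sum>i\<in>I. f i x) powr q = (\<Sum>i\<in>I. l i *\<^sub>R (f i x / l i)) powr q" by simp
      also have "\<dots> \<le> (\<Sum>i\<in>I. l i * (f i x / l i) powr q)"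
        using l0 nn by (intro convex_on_sum[OF I convex_on_powr_nonneg[OF q] l1]) (auto intro: less_imp_le divide_nonneg_pos)
      also have "\<dots> = (\<Sum>i\<in>I. l i powr (1 - q) * f i x powr q)"
        using l0 by (intro sum.cong) (auto simp: powr_divide powr_diff less_imp_le)
      finally show ?thesis .
    qed
    have "(\<integral>x. (\<Sum>i\<in>I. f i x) powr q \<partial>M) \<le> (\<integral>x. (\<Sum>i\<in>I. l i powr (1 - q) * f i x powr q) \<partial>M)"
      by (intro integral_mono intF Bochner_Integration.integrable_sum Bochner_Integration.integrable_mult_right int pt)
    also have "\<dots> = (\<Sum>i\<in>I. l i powr (1 - q) * A i powr q)"
      using int by (simp add: Aq Bochner_Integration.integral_sum)
    also have "\<dots> \<le> (\<Sum>i\<in>I. l i * T powr q)"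
    proof (rule sum_mono)
      fix i assume "i \<in> I"
      have "A i \<le> l i * T" using T \<epsilon> by (simp add: l_def)
      then have "A i powr q \<le> (l i * T) powr q" using q A0 by (intro powr_mono2) auto
      then have "l i powr (1 - q) * A i powr q \<le> l i powr (1 - q) * (l i powr q * T powr q)"
        by (intro mult_left_mono) (auto simp: powr_mult)
      also have "\<dots> = l i * T powr q"
        using l0[of i] by (simp add: mult.assoc[symmetric] powr_add[symmetric])
      finally show "l i powr (1 - q) * A i powr q \<le> l i * T powr q" .
    qed
    also have "\<dots> = T powr q" by (simp add: sum_distrib_right[symmetric] l1)
    finally have "(\<integral>x. (\<Sum>i\<in>I. f i x) powr q \<partial>M) \<le> T powr q" .
    then have "(\<integral>x. (\<Sum>i\<in>I. f i x) powr q \<partial>M) powr (1 / q) \<le> (T powr q) powr (1 / q)"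
      using q by (intro powr_mono2) auto
    also have "\<dots> = T" using T q by (simp add: powr_powr)
    also have "T = (\<Sum>i\<in>I. A i) + e" using I by (simp add: T_def sum.distrib \<epsilon>_def)
    finally show "(\<integral>x. (\<Sum>i\<in>I. f i x) powr q \<partial>M) powr (1 / q) \<le> (\<Sum>i\<in>I. A i) + e" .
  qed
qed

section \<open>Localization of the quadratic form\<close>

text \<open>Whole-space Hardy integral with values in \<open>ennreal\<close>, which can be estimated
  before its finiteness is known.\<close>

definition hardy_nn :: "real \<Rightarrow> 'a::euclidean_space \<Rightarrow> ('a \<Rightarrow> real) \<Rightarrow> ennreal" where
  "hardy_nn s a u = (\<integral>\<^sup>+x. ennreal ((u x)\<^sup>2 / norm (x - a) powr (2 * s)) \<partial>lebesgue)"

lemma hardy_nn_shift: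
  fixes u :: "'a::euclidean_space \<Rightarrow> real"
  assumes [measurable]: "u \<in> borel_measurable lebesgue"
  shows "hardy_nn s 0 (\<lambda>x. u (x + a)) = hardy_nn s a u"
proof -
  have "(\<integral>\<^sup>+x. ennreal ((u (x + a))\<^sup>2 / norm (x + a - a) powr (2 * s)) \<partial>lebesgue)
      = (\<integral>\<^sup>+x. ennreal ((u x)\<^sup>2 / norm (x - a) powr (2 * s)) \<partial>lebesgue)"
    by (rule nn_integral_lebesgue_shift[where f="\<lambda>x. ennreal ((u x)\<^sup>2 / norm (x - a) powr (2 * s))"]) measurable
  then show ?thesis by (simp add: hardy_nn_def)
qed

lemma hardy_nn_le:
  fixes u :: "'a::euclidean_space \<Rightarrow> real"
  assumes s: "0 < s" "s < 1" and N: "real DIM('a) > 2 * s" and u: "u \<in> Hdot s"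
  shows "ennreal (Hardy_const TYPE('a) s) * hardy_nn s a u \<le> ext_energy s u"
  using Hdot_hardy[OF s N Hdot_shift[OF u, of a]] hardy_nn_shift[OF Hdot_measurable[OF u], of s a]
  by (simp add: hardy_nn_def ext_energy_shift[OF Hdot_measurable[OF u]])

lemma hardy_nn_finite:
  fixes u :: "'a::euclidean_space \<Rightarrow> real"
  assumes s: "0 < s" "s < 1" and N: "real DIM('a) > 2 * s" and u: "u \<in> Hdot s"
  shows "hardy_nn s a u < \<infinity>"
proof -
  have "ennreal (Hardy_const TYPE('a) s) * hardy_nn s a u < \<infinity>"
    using hardy_nn_le[OF s N u, of a] Hdot_finite[OF s u] by (rule le_less_trans)
  then show ?thesis using Hardy_const_pos[OF N s(1)] by (auto simp: ennreal_mult_less_top)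
qed

text \<open>Finiteness is not assumed: if the integral diverges, the Bochner integral and
  \<open>enn2real\<close> both take the value 0.\<close>

lemma Hardy_term_eq:
  fixes u :: "'a::euclidean_space \<Rightarrow> real"
  assumes [measurable]: "u \<in> borel_measurable lebesgue" "A \<in> sets lebesgue"
    and AE0: "AE x in lebesgue. x \<notin> A \<longrightarrow> u x = 0"
  shows "Hardy_term s a A u = enn2real (hardy_nn s a u)"
proof -
  have "Hardy_term s a A u = (\<integral>x. indicat_real A x * ((u x)\<^sup>2 / norm (x - a) powr (2 * s)) \<partial>lebesgue)"
    by (simp add: Hardy_term_def set_lebesgue_integral_def)
  also have "\<dots> = enn2real (\<integral>\<^sup>+x. ennreal (indicat_real A x * ((u x)\<^sup>2 / norm (x - a) powr (2 * s))) \<partial>lebesgue)"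
    by (rule integral_eq_nn_integral) auto
  also have "(\<integral>\<^sup>+x. ennreal (indicat_real A x * ((u x)\<^sup>2 / norm (x - a) powr (2 * s))) \<partial>lebesgue) = hardy_nn s a u"
    unfolding hardy_nn_def
    by (rule nn_integral_cong_AE, use AE0 in eventually_elim) (auto simp: indicator_def)
  finally show ?thesis .
qed

lemma energy_ennreal:
  assumes "0 < s" "s < 1" "u \<in> Hdot s"
  shows "ext_energy s u = ennreal (energy s u)"
  using Hdot_finite[OF assms] by (simp add: energy_def less_top)

lemma energy_nonneg: "energy s u \<ge> 0"
  by (simp add: energy_def)

lemma hardy_real:
  fixes u :: "'a::euclidean_space \<Rightarrow> real"
  assumes s: "0 < s" "s < 1" and N: "real DIM('a) > 2 * s" and u: "u \<in> Hdot s"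
  shows "Hardy_const TYPE('a) s * enn2real (hardy_nn s a u) \<le> energy s u"
proof -
  have "ennreal (Hardy_const TYPE('a) s * enn2real (hardy_nn s a u)) = ennreal (Hardy_const TYPE('a) s) * hardy_nn s a u"
    using hardy_nn_finite[OF s N u, of a] Hardy_const_pos[OF N s(1)]
    by (simp add: ennreal_mult less_top)
  also have "\<dots> \<le> ennreal (energy s u)" using hardy_nn_le[OF s N u, of a] energy_ennreal[OF s u] by simp
  finally show ?thesis by (simp add: energy_nonneg)
qed

lemma hardy_quotient_nonneg:
  fixes u :: "'a::euclidean_space \<Rightarrow> real"
  assumes s: "0 < s" "s < 1" and N: "real DIM('a) > 2 * s" and u: "u \<in> Hdot s" and \<mu>: "\<mu> \<le> Hardy_const TYPE('a) s"
  shows "0 \<le> energy s u - \<mu> * Hardy_term s 0 UNIV u"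
proof -
  have "\<mu> * enn2real (hardy_nn s 0 u) \<le> Hardy_const TYPE('a) s * enn2real (hardy_nn s 0 u)"
    using \<mu> by (intro mult_right_mono) auto
  then show ?thesis
    using hardy_real[OF s N u, of 0] Hardy_term_eq[OF Hdot_measurable[OF u], of UNIV s 0] by simp
qed

text \<open>\<open>cINF_lower\<close> asks for quotients bounded below, and this is the sharp Hardy
  inequality. If the norm is 0, in particular if its integral diverges and takes the default value
  0, there is no quotient to use, but the right side is still nonnegative.\<close>

lemma S_mu_le:
  fixes u :: "'a::euclidean_space \<Rightarrow> real"
  assumes s: "0 < s" "s < 1" and N: "real DIM('a) > 2 * s" and u: "u \<in> Hdot s"
    and \<mu>: "\<mu> \<le> Hardy_const TYPE('a) s"
  shows "S_mu TYPE('a) s \<mu> * (Lp_norm (crit_exp TYPE('a) s) UNIV u)\<^sup>2 \<le> energy s u - \<mu> * Hardy_term s 0 UNIV u"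
proof (cases "Lp_norm (crit_exp TYPE('a) s) UNIV u = 0")
  case True
  then show ?thesis using hardy_quotient_nonneg[OF s N u \<mu>] by simp
next
  case False
  have nz: "\<not> (AE x in lebesgue. u x = 0)"
  proof
    assume "AE x in lebesgue. u x = 0"
    then have "(LINT x:UNIV|lebesgue. \<bar>u x\<bar> powr crit_exp TYPE('a) s) = 0"
      unfolding set_lebesgue_integral_def by (intro integral_eq_zero_AE) (auto elim: eventually_mono)
    then show False using False by (simp add: Lp_norm_def)
  qed
  let ?q = "\<lambda>u::'a \<Rightarrow> real. (energy s u - \<mu> * Hardy_term s 0 UNIV u) / (Lp_norm (crit_exp TYPE('a) s) UNIV u)\<^sup>2"
  have "S_mu TYPE('a) s \<mu> \<le> ?q u"
    unfolding S_mu_def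
  proof (rule cINF_lower)
    show "bdd_below (?q ` {u. u \<in> Hdot s \<and> \<not> (AE x in lebesgue. u x = 0)})"
      by (rule bdd_belowI2[of _ 0]) (auto intro!: divide_nonneg_nonneg hardy_quotient_nonneg[OF s N _ \<mu>])
  qed (use u nz in auto)
  then show ?thesis using False by (simp add: pos_le_divide_eq)
qed

text \<open>\<open>u\<close> witnesses that the infimum is taken over a nonempty set; the real
  infimum of the empty set would carry no information.\<close>

lemma S_mu_nonneg:
  fixes u :: "'a::euclidean_space \<Rightarrow> real"
  assumes s: "0 < s" "s < 1" and N: "real DIM('a) > 2 * s"
    and u: "u \<in> Hdot s" "\<not> (AE x in lebesgue. u x = 0)"
    and \<mu>: "\<mu> \<le> Hardy_const TYPE('a) s"
  shows "0 \<le> S_mu TYPE('a) s \<mu>"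
  unfolding S_mu_def
  by (rule cINF_greatest) (use u in \<open>auto intro!: divide_nonneg_nonneg hardy_quotient_nonneg[OF s N _ \<mu>]\<close>)

lemma Lp_norm_shift:
  fixes u :: "'a::euclidean_space \<Rightarrow> real"
  assumes [measurable]: "u \<in> borel_measurable lebesgue"
  shows "Lp_norm p UNIV (\<lambda>x. u (x + a)) = Lp_norm p UNIV u"
proof -
  have "(\<integral>x. \<bar>u x\<bar> powr p \<partial>distr lebesgue lebesgue (\<lambda>x. x + a)) = (\<integral>x. \<bar>u (x + a)\<bar> powr p \<partial>lebesgue)"
    by (rule integral_distr) measurable
  then show ?thesis
    unfolding lebesgue_distr_shift by (simp add: Lp_norm_def set_lebesgue_integral_def)
qed

text \<open>The energy and the L^p norm are invariant under translation, so the pole can be moved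
  from 0 to \<open>a\<close>.\<close>

lemma S_mu_le_at:
  fixes u :: "'a::euclidean_space \<Rightarrow> real"
  assumes s: "0 < s" "s < 1" and N: "real DIM('a) > 2 * s" and u: "u \<in> Hdot s"
    and \<mu>: "\<mu> \<le> Hardy_const TYPE('a) s"
  shows "S_mu TYPE('a) s \<mu> * (Lp_norm (crit_exp TYPE('a) s) UNIV u)\<^sup>2 \<le> energy s u - \<mu> * enn2real (hardy_nn s a u)"
proof -
  note m = Hdot_measurable[OF u]
  note m' = Hdot_measurable[OF Hdot_shift[OF u, of a]]
  have "Hardy_term s 0 UNIV (\<lambda>x. u (x + a)) = enn2real (hardy_nn s a u)"
    using Hardy_term_eq[OF m', of UNIV s 0] hardy_nn_shift[OF m, of s a] by simp
  moreover have "energy s (\<lambda>x. u (x + a)) = energy s u"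
    by (simp add: energy_def ext_energy_shift[OF m])
  ultimately show ?thesis
    using S_mu_le[OF s N Hdot_shift[OF u, of a] \<mu>] by (simp add: Lp_norm_shift[OF m])
qed

section \<open>Localization by a quadratic partition of unity\<close>

text \<open>IMS localization: for a quadratic partition of unity
  \<open>\<Sum>\<^sub>i |\<psi>\<^sub>i(x)w(x) - \<psi>\<^sub>i(y)w(y)|\<^sup>2 = |w(x) - w(y)|\<^sup>2 + w(x)w(y) \<Sum>\<^sub>i |\<psi>\<^sub>i(x) - \<psi>\<^sub>i(y)|\<^sup>2\<close>.\<close>
lemma ims_localization:
  fixes \<psi> :: "'i \<Rightarrow> 'a::euclidean_space \<Rightarrow> real"
  assumes s: "0 < s" "s < 1" and I: "finite I" and \<psi>: "\<And>i. i \<in> I \<Longrightarrow> multiplier (\<psi> i)"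
    and one: "\<And>x. (\<Sum>i\<in>I. (\<psi> i x)\<^sup>2) = 1"
  shows "\<exists>C\<ge>0. \<forall>w\<in>borel_measurable lebesgue.
     (\<Sum>i\<in>I. ext_energy s (\<lambda>x. \<psi> i x * w x)) \<le> ext_energy s w + ennreal C * (\<integral>\<^sup>+x. ennreal ((w x)\<^sup>2) \<partial>lebesgue)"
proof -
  let ?wt = "\<lambda>x y::'a. norm (x - y) powr (real DIM('a) + 2 * s)"
  define J where "J i x = (\<integral>\<^sup>+y. ennreal (\<bar>\<psi> i x - \<psi> i y\<bar>\<^sup>2 / ?wt x y) \<partial>lebesgue)" for i x
  have "\<forall>i\<in>I. \<exists>K. K \<ge> 0 \<and> (\<forall>x. J i x \<le> ennreal K)"
  proof
    fix i assume "i \<in> I"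
    \<comment> \<open>Of the two kernel bounds the uniform one is taken, since the error is to be an
      L^2 norm.\<close>
    from multiplier_kernel_bound[OF s \<psi>[OF this]] show "\<exists>K. K \<ge> 0 \<and> (\<forall>x. J i x \<le> ennreal K)"
      unfolding J_def[symmetric] by blast
  qed
  from bchoice[OF this] obtain K where K0: "\<forall>i\<in>I. K i \<ge> 0 \<and> (\<forall>x. J i x \<le> ennreal (K i))" ..
  have K: "\<And>i. i \<in> I \<Longrightarrow> K i \<ge> 0" "\<And>i x. i \<in> I \<Longrightarrow> (\<integral>\<^sup>+y. ennreal (\<bar>\<psi> i x - \<psi> i y\<bar>\<^sup>2 / ?wt x y) \<partial>lebesgue) \<le> ennreal (K i)"
    unfolding J_def[symmetric] using K0 by simp_all
  have m\<psi>: "\<psi> i \<in> borel_measurable lebesgue" if "i \<in> I" for i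
    using multiplier_smooth[OF \<psi>[OF that]] by (intro measurable_completion) (simp add: borel_measurable_smooth)
  let ?c = "C_const TYPE('a) s / 2"
  define C where "C = ?c * (\<Sum>i\<in>I. K i)"
  have c: "?c > 0" using C_const_pos[OF s, where 'a='a] by simp
  have C: "C \<ge> 0" unfolding C_def using c K(1) by (intro mult_nonneg_nonneg sum_nonneg) auto
  have "(\<Sum>i\<in>I. ext_energy s (\<lambda>x. \<psi> i x * w x)) \<le> ext_energy s w + ennreal C * (\<integral>\<^sup>+x. ennreal ((w x)\<^sup>2) \<partial>lebesgue)"
    if w[measurable]: "w \<in> borel_measurable lebesgue" for w
  proof -
    \<comment> \<open>The sum of the commutator kernels. It is symmetric, so the weights w(x)^2 and
      w(y)^2 contribute equally.\<close>
    define S where "S x y = (\<Sum>i\<in>I. \<bar>\<psi> i x - \<psi> i y\<bar>\<^sup>2 / ?wt x y)" for x y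
    have Sm [measurable]: "(\<lambda>p. S (fst p) (snd p)) \<in> borel_measurable (lebesgue \<Otimes>\<^sub>M lebesgue)"
      unfolding S_def by (intro borel_measurable_sum) (use m\<psi> in measurable)
    have Sm' [measurable]: "(\<lambda>p. S (snd p) (fst p)) \<in> borel_measurable (lebesgue \<Otimes>\<^sub>M lebesgue)"
      unfolding S_def by (intro borel_measurable_sum) (use m\<psi> in measurable)
    have S2 [measurable]: "(\<lambda>y. S x y) \<in> borel_measurable lebesgue" for x
      unfolding S_def by (intro borel_measurable_sum) (use m\<psi> in measurable)
    have S0: "S x y \<ge> 0" for x y unfolding S_def by (intro sum_nonneg) auto
    have Ssym: "S x y = S y x" for x y
      unfolding S_def by (simp add: norm_minus_commute[of x y] power2_commute[of "\<psi> _ x"])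
    let ?W = "\<integral>\<^sup>+x. ennreal ((w x)\<^sup>2) \<partial>lebesgue"
    have half1: "(\<integral>\<^sup>+x. (\<integral>\<^sup>+y. ennreal ((w x)\<^sup>2) * ennreal (S x y) \<partial>lebesgue) \<partial>lebesgue) \<le> ennreal (\<Sum>i\<in>I. K i) * ?W"
    proof -
      have "(\<integral>\<^sup>+x. (\<integral>\<^sup>+y. ennreal ((w x)\<^sup>2) * ennreal (S x y) \<partial>lebesgue) \<partial>lebesgue) \<le> (\<integral>\<^sup>+x. ennreal ((w x)\<^sup>2) * ennreal (\<Sum>i\<in>I. K i) \<partial>lebesgue)"
      proof (rule nn_integral_mono)
        fix x :: 'a
        have "(\<integral>\<^sup>+y. ennreal (S x y) \<partial>lebesgue) = (\<integral>\<^sup>+y. (\<Sum>i\<in>I. ennreal (\<bar>\<psi> i x - \<psi> i y\<bar>\<^sup>2 / ?wt x y)) \<partial>lebesgue)"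
          unfolding S_def by (intro nn_integral_cong sum_ennreal[symmetric]) auto
        also have "\<dots> = (\<Sum>i\<in>I. (\<integral>\<^sup>+y. ennreal (\<bar>\<psi> i x - \<psi> i y\<bar>\<^sup>2 / ?wt x y) \<partial>lebesgue))"
          by (rule nn_integral_sum) (use m\<psi> in measurable)
        also have "\<dots> \<le> (\<Sum>i\<in>I. ennreal (K i))" by (intro sum_mono K(2))
        also have "\<dots> = ennreal (\<Sum>i\<in>I. K i)" using K(1) by (rule sum_ennreal)
        finally have "(\<integral>\<^sup>+y. ennreal (S x y) \<partial>lebesgue) \<le> ennreal (\<Sum>i\<in>I. K i)" .
        then show "(\<integral>\<^sup>+y. ennreal ((w x)\<^sup>2) * ennreal (S x y) \<partial>lebesgue) \<le> ennreal ((w x)\<^sup>2) * ennreal (\<Sum>i\<in>I. K i)"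
          using S2[of x] by (subst nn_integral_cmult) (auto intro: mult_left_mono)
      qed
      also have "\<dots> = ?W * ennreal (\<Sum>i\<in>I. K i)" by (rule nn_integral_multc) measurable
      finally show ?thesis by (simp only: mult.commute)
    qed
    have half2: "(\<integral>\<^sup>+x. (\<integral>\<^sup>+y. ennreal ((w y)\<^sup>2) * ennreal (S x y) \<partial>lebesgue) \<partial>lebesgue) = (\<integral>\<^sup>+x. (\<integral>\<^sup>+y. ennreal ((w x)\<^sup>2) * ennreal (S x y) \<partial>lebesgue) \<partial>lebesgue)"
    proof -
      have "(\<integral>\<^sup>+x. (\<integral>\<^sup>+y. ennreal ((w y)\<^sup>2) * ennreal (S x y) \<partial>lebesgue) \<partial>lebesgue) = (\<integral>\<^sup>+y. (\<integral>\<^sup>+x. ennreal ((w y)\<^sup>2) * ennreal (S x y) \<partial>lebesgue) \<partial>lebesgue)"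
        by (rule lebesgue_pair.Fubini') measurable
      also have "\<dots> = (\<integral>\<^sup>+y. (\<integral>\<^sup>+x. ennreal ((w y)\<^sup>2) * ennreal (S y x) \<partial>lebesgue) \<partial>lebesgue)"
        by (subst Ssym) (rule refl)
      finally show ?thesis .
    qed
    have "(\<Sum>i\<in>I. gagliardo s (\<lambda>x. \<psi> i x * w x)) = (\<integral>\<^sup>+x. (\<integral>\<^sup>+y. (\<Sum>i\<in>I. ennreal (\<bar>\<psi> i x * w x - \<psi> i y * w y\<bar>\<^sup>2 / ?wt x y)) \<partial>lebesgue) \<partial>lebesgue)"
    proof -
      have "(\<Sum>i\<in>I. gagliardo s (\<lambda>x. \<psi> i x * w x)) = (\<integral>\<^sup>+x. (\<Sum>i\<in>I. (\<integral>\<^sup>+y. ennreal (\<bar>\<psi> i x * w x - \<psi> i y * w y\<bar>\<^sup>2 / ?wt x y) \<partial>lebesgue)) \<partial>lebesgue)"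
        unfolding gagliardo_def by (rule nn_integral_sum[symmetric]) (use m\<psi> in measurable)
      also have "\<dots> = (\<integral>\<^sup>+x. (\<integral>\<^sup>+y. (\<Sum>i\<in>I. ennreal (\<bar>\<psi> i x * w x - \<psi> i y * w y\<bar>\<^sup>2 / ?wt x y)) \<partial>lebesgue) \<partial>lebesgue)"
        by (intro nn_integral_cong nn_integral_sum[symmetric]) (use m\<psi> in measurable)
      finally show ?thesis .
    qed
    also have "\<dots> \<le> (\<integral>\<^sup>+x. (\<integral>\<^sup>+y. ennreal (\<bar>w x - w y\<bar>\<^sup>2 / ?wt x y) + ennreal (1 / 2) * (ennreal ((w x)\<^sup>2) * ennreal (S x y) + ennreal ((w y)\<^sup>2) * ennreal (S x y)) \<partial>lebesgue) \<partial>lebesgue)"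
    proof (intro nn_integral_mono)
      fix x y :: 'a
      let ?T = "\<Sum>i\<in>I. \<bar>\<psi> i x - \<psi> i y\<bar>\<^sup>2"
      have id: "(\<Sum>i\<in>I. \<bar>\<psi> i x * w x - \<psi> i y * w y\<bar>\<^sup>2) = \<bar>w x - w y\<bar>\<^sup>2 + w x * w y * ?T"
      proof -
        have "(\<Sum>i\<in>I. \<bar>\<psi> i x * w x - \<psi> i y * w y\<bar>\<^sup>2) = (\<Sum>i\<in>I. (w x)\<^sup>2 * (\<psi> i x)\<^sup>2 + (w y)\<^sup>2 * (\<psi> i y)\<^sup>2 - 2 * w x * w y * (\<psi> i x * \<psi> i y))"
          by (intro sum.cong) (auto simp: power2_eq_square algebra_simps)
        also have "\<dots> = (w x)\<^sup>2 * 1 + (w y)\<^sup>2 * 1 - 2 * w x * w y * (\<Sum>i\<in>I. \<psi> i x * \<psi> i y)"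
          unfolding sum_subtractf sum.distrib sum_distrib_left[symmetric] one ..
        finally have 1: "(\<Sum>i\<in>I. \<bar>\<psi> i x * w x - \<psi> i y * w y\<bar>\<^sup>2) = (w x)\<^sup>2 * 1 + (w y)\<^sup>2 * 1 - 2 * w x * w y * (\<Sum>i\<in>I. \<psi> i x * \<psi> i y)" .
        have "?T = (\<Sum>i\<in>I. (\<psi> i x)\<^sup>2 + (\<psi> i y)\<^sup>2 - 2 * (\<psi> i x * \<psi> i y))"
          by (intro sum.cong) (auto simp: power2_eq_square algebra_simps)
        also have "\<dots> = 1 + 1 - 2 * (\<Sum>i\<in>I. \<psi> i x * \<psi> i y)"
          unfolding sum_subtractf sum.distrib sum_distrib_left[symmetric] one ..
        finally have 2: "?T = 1 + 1 - 2 * (\<Sum>i\<in>I. \<psi> i x * \<psi> i y)" .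
        show ?thesis unfolding 1 2 by (simp add: power2_eq_square algebra_simps)
      qed
      have T0: "?T \<ge> 0" by (intro sum_nonneg) auto
      \<comment> \<open>The cross term is bounded symmetrically, and the two halves recombine into
        one full L^2 error.\<close>
      have "w x * w y \<le> 1 / 2 * ((w x)\<^sup>2 + (w y)\<^sup>2)" using sum_squares_bound[of "w x" "w y"] by simp
      then have "w x * w y * ?T \<le> 1 / 2 * ((w x)\<^sup>2 + (w y)\<^sup>2) * ?T" using T0 by (rule mult_right_mono)
      then have "(\<Sum>i\<in>I. \<bar>\<psi> i x * w x - \<psi> i y * w y\<bar>\<^sup>2) / ?wt x y \<le> (\<bar>w x - w y\<bar>\<^sup>2 + 1 / 2 * ((w x)\<^sup>2 + (w y)\<^sup>2) * ?T) / ?wt x y"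
        unfolding id by (intro divide_right_mono add_left_mono) auto
      also have "\<dots> = \<bar>w x - w y\<bar>\<^sup>2 / ?wt x y + 1 / 2 * ((w x)\<^sup>2 * (?T / ?wt x y) + (w y)\<^sup>2 * (?T / ?wt x y))"
        by (simp add: add_divide_distrib distrib_right)
      also have "?T / ?wt x y = S x y" unfolding S_def by (rule sum_divide_distrib)
      finally have "ennreal ((\<Sum>i\<in>I. \<bar>\<psi> i x * w x - \<psi> i y * w y\<bar>\<^sup>2) / ?wt x y) \<le> ennreal (\<bar>w x - w y\<bar>\<^sup>2 / ?wt x y + 1 / 2 * ((w x)\<^sup>2 * S x y + (w y)\<^sup>2 * S x y))"
        by (rule ennreal_leI)
      also have "\<dots> = ennreal (\<bar>w x - w y\<bar>\<^sup>2 / ?wt x y) + ennreal (1 / 2 * ((w x)\<^sup>2 * S x y + (w y)\<^sup>2 * S x y))"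
        using S0[of x y] by (intro ennreal_plus) (auto intro!: mult_nonneg_nonneg add_nonneg_nonneg)
      also have "ennreal (1 / 2 * ((w x)\<^sup>2 * S x y + (w y)\<^sup>2 * S x y)) = ennreal (1 / 2) * ennreal ((w x)\<^sup>2 * S x y + (w y)\<^sup>2 * S x y)"
        by (rule ennreal_mult') simp
      also have "ennreal ((w x)\<^sup>2 * S x y + (w y)\<^sup>2 * S x y) = ennreal ((w x)\<^sup>2 * S x y) + ennreal ((w y)\<^sup>2 * S x y)"
        using S0[of x y] by (intro ennreal_plus) (auto intro!: mult_nonneg_nonneg)
      also have "ennreal ((w x)\<^sup>2 * S x y) = ennreal ((w x)\<^sup>2) * ennreal (S x y)" by (rule ennreal_mult') simp
      also have "ennreal ((w y)\<^sup>2 * S x y) = ennreal ((w y)\<^sup>2) * ennreal (S x y)" by (rule ennreal_mult') simp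
      also have "ennreal ((\<Sum>i\<in>I. \<bar>\<psi> i x * w x - \<psi> i y * w y\<bar>\<^sup>2) / ?wt x y) = (\<Sum>i\<in>I. ennreal (\<bar>\<psi> i x * w x - \<psi> i y * w y\<bar>\<^sup>2 / ?wt x y))"
        unfolding sum_divide_distrib by (rule sum_ennreal[symmetric]) auto
      finally show "(\<Sum>i\<in>I. ennreal (\<bar>\<psi> i x * w x - \<psi> i y * w y\<bar>\<^sup>2 / ?wt x y)) \<le> ennreal (\<bar>w x - w y\<bar>\<^sup>2 / ?wt x y) + ennreal (1 / 2) * (ennreal ((w x)\<^sup>2) * ennreal (S x y) + ennreal ((w y)\<^sup>2) * ennreal (S x y))" .
    qed
    also have "\<dots> = gagliardo s w + ennreal (1 / 2) * ((\<integral>\<^sup>+x. (\<integral>\<^sup>+y. ennreal ((w x)\<^sup>2) * ennreal (S x y) \<partial>lebesgue) \<partial>lebesgue)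
        + (\<integral>\<^sup>+x. (\<integral>\<^sup>+y. ennreal ((w y)\<^sup>2) * ennreal (S x y) \<partial>lebesgue) \<partial>lebesgue))"
    proof -
      define F where "F x y = ennreal (\<bar>w x - w y\<bar>\<^sup>2 / ?wt x y)" for x y
      define G where "G x y = ennreal ((w x)\<^sup>2) * ennreal (S x y)" for x y
      define H where "H x y = ennreal ((w y)\<^sup>2) * ennreal (S x y)" for x y
      have [measurable]: "(\<lambda>p. F (fst p) (snd p)) \<in> borel_measurable (lebesgue \<Otimes>\<^sub>M lebesgue)"
        unfolding F_def by measurable
      have [measurable]: "(\<lambda>p. G (fst p) (snd p)) \<in> borel_measurable (lebesgue \<Otimes>\<^sub>M lebesgue)"
        unfolding G_def by measurable
      have [measurable]: "(\<lambda>p. H (fst p) (snd p)) \<in> borel_measurable (lebesgue \<Otimes>\<^sub>M lebesgue)"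
        unfolding H_def by measurable
      have "(\<integral>\<^sup>+x. (\<integral>\<^sup>+y. F x y + ennreal (1 / 2) * (G x y + H x y) \<partial>lebesgue) \<partial>lebesgue)
        = (\<integral>\<^sup>+p. F (fst p) (snd p) + ennreal (1 / 2) * (G (fst p) (snd p) + H (fst p) (snd p)) \<partial>(lebesgue \<Otimes>\<^sub>M lebesgue))"
        by (subst lebesgue.nn_integral_fst[symmetric]) auto
      also have "\<dots> = (\<integral>\<^sup>+p. F (fst p) (snd p) \<partial>(lebesgue \<Otimes>\<^sub>M lebesgue)) + ennreal (1 / 2) *
          ((\<integral>\<^sup>+p. G (fst p) (snd p) \<partial>(lebesgue \<Otimes>\<^sub>M lebesgue)) + (\<integral>\<^sup>+p. H (fst p) (snd p) \<partial>(lebesgue \<Otimes>\<^sub>M lebesgue)))"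
        by (simp add: nn_integral_add nn_integral_cmult)
      also have "(\<integral>\<^sup>+p. F (fst p) (snd p) \<partial>(lebesgue \<Otimes>\<^sub>M lebesgue)) = (\<integral>\<^sup>+x. (\<integral>\<^sup>+y. F x y \<partial>lebesgue) \<partial>lebesgue)"
        by (subst lebesgue.nn_integral_fst[symmetric]) auto
      also have "(\<integral>\<^sup>+p. G (fst p) (snd p) \<partial>(lebesgue \<Otimes>\<^sub>M lebesgue)) = (\<integral>\<^sup>+x. (\<integral>\<^sup>+y. G x y \<partial>lebesgue) \<partial>lebesgue)"
        by (subst lebesgue.nn_integral_fst[symmetric]) auto
      also have "(\<integral>\<^sup>+p. H (fst p) (snd p) \<partial>(lebesgue \<Otimes>\<^sub>M lebesgue)) = (\<integral>\<^sup>+x. (\<integral>\<^sup>+y. H x y \<partial>lebesgue) \<partial>lebesgue)"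
        by (subst lebesgue.nn_integral_fst[symmetric]) auto
      finally show ?thesis unfolding F_def G_def H_def gagliardo_def .
    qed
    also have "\<dots> \<le> gagliardo s w + ennreal (1 / 2) * (ennreal (\<Sum>i\<in>I. K i) * ?W + ennreal (\<Sum>i\<in>I. K i) * ?W)"
      unfolding half2 by (intro add_left_mono mult_left_mono add_mono half1) auto
    also have "ennreal (1 / 2) * (ennreal (\<Sum>i\<in>I. K i) * ?W + ennreal (\<Sum>i\<in>I. K i) * ?W) = ennreal (\<Sum>i\<in>I. K i) * ?W"
    proof -
      have "ennreal (1 / 2) * (z + z) = z" for z :: ennreal
      proof -
        have "ennreal (1 / 2) * (z + z) = (ennreal (1 / 2) + ennreal (1 / 2)) * z" by (simp only: distrib_left distrib_right)
        also have "ennreal (1 / 2) + ennreal (1 / 2) = 1" by (subst ennreal_plus[symmetric]) auto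
        finally show ?thesis by simp
      qed
      then show ?thesis .
    qed
    finally have main: "(\<Sum>i\<in>I. gagliardo s (\<lambda>x. \<psi> i x * w x)) \<le> gagliardo s w + ennreal (\<Sum>i\<in>I. K i) * ?W" .
    have "(\<Sum>i\<in>I. ext_energy s (\<lambda>x. \<psi> i x * w x)) = (\<Sum>i\<in>I. ennreal ?c * gagliardo s (\<lambda>x. \<psi> i x * w x))"
      by (intro sum.cong refl ext_energy_eq) (use m\<psi> in measurable)
    also have "\<dots> = ennreal ?c * (\<Sum>i\<in>I. gagliardo s (\<lambda>x. \<psi> i x * w x))" by (rule sum_distrib_left[symmetric])
    also have "\<dots> \<le> ennreal ?c * (gagliardo s w + ennreal (\<Sum>i\<in>I. K i) * ?W)" by (intro mult_left_mono main) simp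
    also have "\<dots> = ext_energy s w + ennreal C * ?W"
      unfolding ext_energy_eq[OF w] distrib_left C_def ennreal_mult'[OF less_imp_le[OF c]] by (simp only: mult.assoc)
    finally show ?thesis .
  qed
  then show ?thesis using C by blast
qed

lemma X_space_Hdot: "w \<in> X_space s \<Omega> \<Longrightarrow> w \<in> Hdot s"
  by (simp add: X_space_def)

text \<open>A Poincare inequality obtained from Hardy's: on a set inside the ball of radius R the
  weight |x|^(-2s) is at least R^(-2s).\<close>

lemma X_space_L2:
  fixes \<Omega> :: "'a::euclidean_space set"
  assumes s: "0 < s" "s < 1" and N: "real DIM('a) > 2 * s" and \<Omega>: "bounded \<Omega>"
  shows "\<exists>C\<ge>0. \<forall>w\<in>X_space s \<Omega>. (\<integral>\<^sup>+x. ennreal ((w x)\<^sup>2) \<partial>lebesgue) \<le> ennreal C * ext_energy s w"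
proof -
  obtain R where R: "R > 0" "\<And>x. x \<in> \<Omega> \<Longrightarrow> norm x \<le> R" using \<Omega> unfolding bounded_pos by blast
  let ?\<Lambda> = "Hardy_const TYPE('a) s"
  have \<Lambda>: "?\<Lambda> > 0" using Hardy_const_pos[OF N s(1)] .
  define C where "C = R powr (2 * s) / ?\<Lambda>"
  have ae0: "AE x in lebesgue. x \<noteq> (0::'a)"
    by (rule AE_completion) (rule AE_lborel_singleton)
  have "(\<integral>\<^sup>+x. ennreal ((w x)\<^sup>2) \<partial>lebesgue) \<le> ennreal C * ext_energy s w" if w: "w \<in> X_space s \<Omega>" for w
  proof -
    note H = X_space_Hdot[OF w]
    note [measurable] = Hdot_measurable[OF H]
    have z: "AE x in lebesgue. x \<notin> \<Omega> \<longrightarrow> w x = 0" using w by (simp add: X_space_def)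
    have "(\<integral>\<^sup>+x. ennreal ((w x)\<^sup>2) \<partial>lebesgue) \<le> (\<integral>\<^sup>+x. ennreal (R powr (2 * s)) * ennreal ((w x)\<^sup>2 / norm (x - 0) powr (2 * s)) \<partial>lebesgue)"
    proof (rule nn_integral_mono_AE, use ae0 z in eventually_elim)
      fix x :: 'a assume x: "x \<noteq> 0" "x \<notin> \<Omega> \<longrightarrow> w x = 0"
      have "(w x)\<^sup>2 \<le> R powr (2 * s) * ((w x)\<^sup>2 / norm x powr (2 * s))"
      proof (cases "w x = 0")
        case False
        then have "norm x \<le> R" using x R by auto
        then have "norm x powr (2 * s) \<le> R powr (2 * s)" using s by (intro powr_mono2) auto
        then have "(w x)\<^sup>2 * norm x powr (2 * s) \<le> (w x)\<^sup>2 * R powr (2 * s)" by (intro mult_left_mono) auto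
        then show ?thesis using x(1) by (simp add: pos_le_divide_eq mult.commute)
      qed simp
      then have "ennreal ((w x)\<^sup>2) \<le> ennreal (R powr (2 * s) * ((w x)\<^sup>2 / norm (x - 0) powr (2 * s)))"
        by (intro ennreal_leI) simp
      also have "\<dots> = ennreal (R powr (2 * s)) * ennreal ((w x)\<^sup>2 / norm (x - 0) powr (2 * s))"
        by (rule ennreal_mult') simp
      finally show "ennreal ((w x)\<^sup>2) \<le> ennreal (R powr (2 * s)) * ennreal ((w x)\<^sup>2 / norm (x - 0) powr (2 * s))" .
    qed
    also have "\<dots> = ennreal (R powr (2 * s)) * hardy_nn s 0 w"
      unfolding hardy_nn_def by (rule nn_integral_cmult) measurable
    also have "\<dots> = ennreal (C * ?\<Lambda>) * hardy_nn s 0 w" using \<Lambda> by (simp add: C_def)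
    also have "ennreal (C * ?\<Lambda>) = ennreal C * ennreal ?\<Lambda>" using \<Lambda> by (intro ennreal_mult) (auto simp: C_def)
    also have "ennreal C * ennreal ?\<Lambda> * hardy_nn s 0 w \<le> ennreal C * ext_energy s w"
      unfolding mult.assoc by (intro mult_left_mono hardy_nn_le[OF s N H]) simp
    finally show ?thesis .
  qed
  moreover have "C \<ge> 0" using \<Lambda> by (simp add: C_def)
  ultimately show ?thesis by blast
qed

text \<open>The weight lost at \<open>a i\<close> is the sum of \<open>(\<psi> j)\<^sup>2\<close>
  over the other indices. Each \<open>\<psi> j\<close> is Lipschitz and zero at \<open>a i\<close>,
  so its square is of second order there and absorbs |x - a i|^(-2s), as s < 1; away from
  \<open>a i\<close> boundedness suffices.\<close>

lemma hardy_localization: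
  fixes \<psi> :: "'i \<Rightarrow> 'a::euclidean_space \<Rightarrow> real"
  assumes s: "0 < s" "s < 1" and I: "finite I" and \<psi>: "\<And>i. i \<in> I \<Longrightarrow> multiplier (\<psi> i)"
    and one: "\<And>x. (\<Sum>i\<in>I. (\<psi> i x)\<^sup>2) = 1"
    and zero: "\<And>i j. i \<in> I \<Longrightarrow> j \<in> I \<Longrightarrow> i \<noteq> j \<Longrightarrow> \<psi> j (a i) = 0"
  shows "\<exists>C\<ge>0. \<forall>w\<in>borel_measurable lebesgue. \<forall>i\<in>I.
     hardy_nn s (a i) w \<le> hardy_nn s (a i) (\<lambda>x. \<psi> i x * w x) + ennreal C * (\<integral>\<^sup>+x. ennreal ((w x)\<^sup>2) \<partial>lebesgue)"
proof -
  have "\<forall>i\<in>I. \<exists>C. C > 0 \<and> (\<forall>x. \<bar>\<psi> i x\<bar> \<le> C) \<and> (\<forall>x y. \<bar>\<psi> i x - \<psi> i y\<bar> * (1 + norm x) \<le> C * norm (x - y))"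
    using \<psi> unfolding multiplier_def by blast
  from bchoice[OF this] obtain B where B: "\<forall>i\<in>I. B i > 0 \<and> (\<forall>x. \<bar>\<psi> i x\<bar> \<le> B i) \<and> (\<forall>x y. \<bar>\<psi> i x - \<psi> i y\<bar> * (1 + norm x) \<le> B i * norm (x - y))" ..
  define C where "C = (\<Sum>i\<in>I. (B i)\<^sup>2)"
  have C: "C \<ge> 0" unfolding C_def by (intro sum_nonneg) auto
  have small: "(\<psi> j x)\<^sup>2 \<le> (B j)\<^sup>2 * norm (x - a i) powr (2 * s)" if ij: "i \<in> I" "j \<in> I" "i \<noteq> j" and x: "x \<noteq> a i" for i j x
  proof (cases "norm (x - a i) \<le> 1")
    case True
    have "\<bar>\<psi> j x - \<psi> j (a i)\<bar> * 1 \<le> \<bar>\<psi> j x - \<psi> j (a i)\<bar> * (1 + norm x)" by (intro mult_left_mono) auto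
    also have "\<dots> \<le> B j * norm (x - a i)" using B ij by blast
    finally have "\<bar>\<psi> j x\<bar> \<le> B j * norm (x - a i)" using zero[OF ij] by simp
    from power_mono[OF this, of 2] have "(\<psi> j x)\<^sup>2 \<le> (B j)\<^sup>2 * (norm (x - a i))\<^sup>2" by (simp add: power_mult_distrib)
    also have "(norm (x - a i))\<^sup>2 = norm (x - a i) powr 2" using x by simp
    also have "\<dots> \<le> norm (x - a i) powr (2 * s)" using True x s by (intro powr_mono') auto
    finally show ?thesis by (simp add: mult_left_mono)
  next
    case False
    have "\<bar>\<psi> j x\<bar> \<le> B j" using B ij by blast
    from power_mono[OF this, of 2] have "(\<psi> j x)\<^sup>2 \<le> (B j)\<^sup>2 * 1" by simp
    also have "\<dots> \<le> (B j)\<^sup>2 * norm (x - a i) powr (2 * s)"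
      using False s by (intro mult_left_mono ge_one_powr_ge_zero) auto
    finally show ?thesis .
  qed
  have "hardy_nn s (a i) w \<le> hardy_nn s (a i) (\<lambda>x. \<psi> i x * w x) + ennreal C * (\<integral>\<^sup>+x. ennreal ((w x)\<^sup>2) \<partial>lebesgue)"
    if w[measurable]: "w \<in> borel_measurable lebesgue" and i: "i \<in> I" for w i
  proof -
    have [measurable]: "\<psi> i \<in> borel_measurable lebesgue"
      using multiplier_smooth[OF \<psi>[OF i]] by (intro measurable_completion) (simp add: borel_measurable_smooth)
    have ae: "AE x in lebesgue. x \<noteq> a i"
      by (rule AE_completion) (rule AE_lborel_singleton)
    have "hardy_nn s (a i) w \<le> (\<integral>\<^sup>+x. ennreal ((\<psi> i x * w x)\<^sup>2 / norm (x - a i) powr (2 * s)) + ennreal C * ennreal ((w x)\<^sup>2) \<partial>lebesgue)"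
      unfolding hardy_nn_def
    proof (rule nn_integral_mono_AE, use ae in eventually_elim)
      fix x assume x: "x \<noteq> a i"
      let ?p = "norm (x - a i) powr (2 * s)"
      have p: "?p > 0" using x by simp
      have "1 = (\<psi> i x)\<^sup>2 + (\<Sum>j\<in>I - {i}. (\<psi> j x)\<^sup>2)" using one[of x] I i by (simp add: sum.remove)
      moreover have "(\<Sum>j\<in>I - {i}. (\<psi> j x)\<^sup>2) \<le> (\<Sum>j\<in>I - {i}. (B j)\<^sup>2 * ?p)"
        using i x by (intro sum_mono small) auto
      moreover have "(\<Sum>j\<in>I - {i}. (B j)\<^sup>2 * ?p) \<le> C * ?p"
        unfolding C_def sum_distrib_right using I by (intro sum_mono2) auto
      ultimately have "1 \<le> (\<psi> i x)\<^sup>2 + C * ?p" by linarith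
      then have "(w x)\<^sup>2 * 1 \<le> (w x)\<^sup>2 * ((\<psi> i x)\<^sup>2 + C * ?p)" by (intro mult_left_mono) auto
      also have "\<dots> = (\<psi> i x * w x)\<^sup>2 + C * (w x)\<^sup>2 * ?p" by (simp add: power_mult_distrib algebra_simps)
      finally have "(w x)\<^sup>2 / ?p \<le> ((\<psi> i x * w x)\<^sup>2 + C * (w x)\<^sup>2 * ?p) / ?p"
        using p by (intro divide_right_mono) auto
      also have "\<dots> = (\<psi> i x * w x)\<^sup>2 / ?p + C * (w x)\<^sup>2" using p by (simp add: add_divide_distrib)
      finally have "ennreal ((w x)\<^sup>2 / ?p) \<le> ennreal ((\<psi> i x * w x)\<^sup>2 / ?p + C * (w x)\<^sup>2)" by (rule ennreal_leI)
      also have "\<dots> = ennreal ((\<psi> i x * w x)\<^sup>2 / ?p) + ennreal (C * (w x)\<^sup>2)"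
        using C by (intro ennreal_plus) auto
      also have "ennreal (C * (w x)\<^sup>2) = ennreal C * ennreal ((w x)\<^sup>2)" using C by (rule ennreal_mult')
      finally show "ennreal ((w x)\<^sup>2 / ?p) \<le> ennreal ((\<psi> i x * w x)\<^sup>2 / ?p) + ennreal C * ennreal ((w x)\<^sup>2)" .
    qed
    also have "\<dots> = hardy_nn s (a i) (\<lambda>x. \<psi> i x * w x) + (\<integral>\<^sup>+x. ennreal C * ennreal ((w x)\<^sup>2) \<partial>lebesgue)"
      unfolding hardy_nn_def by (rule nn_integral_add) measurable
    also have "(\<integral>\<^sup>+x. ennreal C * ennreal ((w x)\<^sup>2) \<partial>lebesgue) = ennreal C * (\<integral>\<^sup>+x. ennreal ((w x)\<^sup>2) \<partial>lebesgue)"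
      by (rule nn_integral_cmult) measurable
    finally show ?thesis .
  qed
  then show ?thesis using C by blast
qed

lemma Lp_norm_eq_UNIV:
  fixes w :: "'a::euclidean_space \<Rightarrow> real"
  assumes [measurable]: "w \<in> borel_measurable lebesgue" "A \<in> sets lebesgue"
    and z: "AE x in lebesgue. x \<notin> A \<longrightarrow> w x = 0"
  shows "Lp_norm p A w = Lp_norm p UNIV w"
proof -
  have "(LINT x:A|lebesgue. \<bar>w x\<bar> powr p) = (LINT x:UNIV|lebesgue. \<bar>w x\<bar> powr p)"
    unfolding set_lebesgue_integral_def
    by (rule integral_cong_AE, measurable, use z in eventually_elim) (auto simp: indicator_def)
  then show ?thesis by (simp add: Lp_norm_def)
qed

lemma Lp_norm_localization:
  fixes \<psi> :: "'i \<Rightarrow> 'a::euclidean_space \<Rightarrow> real"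
  assumes I: "finite I" "I \<noteq> {}" and p: "p \<ge> 2"
    and m: "\<And>i. i \<in> I \<Longrightarrow> \<psi> i \<in> borel_measurable lebesgue"
    and one: "\<And>x. (\<Sum>i\<in>I. (\<psi> i x)\<^sup>2) = 1"
    and w[measurable]: "w \<in> borel_measurable lebesgue"
  shows "(Lp_norm p UNIV w)\<^sup>2 \<le> (\<Sum>i\<in>I. (Lp_norm p UNIV (\<lambda>x. \<psi> i x * w x))\<^sup>2)"
proof (cases "integrable lebesgue (\<lambda>x. \<bar>w x\<bar> powr p)")
  \<comment> \<open>If the integral diverges, \<open>Lp_norm\<close> has the default value 0 on the
    left. In the other case Minkowski's inequality is applied to the functions
    \<open>(\<psi> i x * w x)\<^sup>2\<close>, whose sum is \<open>(w x)\<^sup>2\<close>.\<close>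
  case False
  then have "Lp_norm p UNIV w = 0"
    by (simp add: Lp_norm_def set_lebesgue_integral_def not_integrable_integral_eq)
  then show ?thesis by (simp add: sum_nonneg)
next
  case True
  let ?q = "p / 2"
  have q: "?q \<ge> 1" using p by simp
  have pw: "(r\<^sup>2) powr ?q = \<bar>r\<bar> powr p" for r :: real
  proof -
    have "r\<^sup>2 = \<bar>r\<bar> powr 2" by (cases "r = 0") auto
    then have "(r\<^sup>2) powr ?q = \<bar>r\<bar> powr (2 * ?q)" by (simp only: powr_powr)
    then show ?thesis by simp
  qed
  have sq: "(Lp_norm p UNIV v)\<^sup>2 = (\<integral>x. ((v x)\<^sup>2) powr ?q \<partial>lebesgue) powr (1 / ?q)" for v :: "'a \<Rightarrow> real"
  proof -
    have "(Lp_norm p UNIV v)\<^sup>2 = ((\<integral>x. \<bar>v x\<bar> powr p \<partial>lebesgue) powr (1 / p)) powr 2"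
      unfolding Lp_norm_def set_lebesgue_integral_def by simp
    also have "\<dots> = (\<integral>x. \<bar>v x\<bar> powr p \<partial>lebesgue) powr (1 / p * 2)" by (rule powr_powr)
    finally show ?thesis unfolding pw by simp
  qed
  have sum_eq: "(\<Sum>i\<in>I. (\<psi> i x * w x)\<^sup>2) = (w x)\<^sup>2" for x
    using one[of x] by (simp add: power_mult_distrib sum_distrib_right[symmetric])
  have i1: "integrable lebesgue (\<lambda>x. ((\<psi> i x * w x)\<^sup>2) powr ?q)" if i: "i \<in> I" for i
    unfolding pw
  proof (rule Bochner_Integration.integrable_bound[OF True])
    note [measurable] = m[OF i]
    show "(\<lambda>x. \<bar>\<psi> i x * w x\<bar> powr p) \<in> borel_measurable lebesgue" by measurable
    show "AE x in lebesgue. norm (\<bar>\<psi> i x * w x\<bar> powr p) \<le> norm (\<bar>w x\<bar> powr p)"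
    proof (rule AE_I2)
      fix x
      have "(\<psi> i x)\<^sup>2 \<le> (\<Sum>i\<in>I. (\<psi> i x)\<^sup>2)" using I i by (intro member_le_sum) auto
      then have "(\<psi> i x)\<^sup>2 \<le> 1" using one[of x] by simp
      then have "\<bar>\<psi> i x\<bar> \<le> 1" by (simp add: abs_square_le_1)
      then have "\<bar>\<psi> i x * w x\<bar> \<le> \<bar>w x\<bar>" by (simp add: abs_mult mult_left_le_one_le)
      then show "norm (\<bar>\<psi> i x * w x\<bar> powr p) \<le> norm (\<bar>w x\<bar> powr p)" using p by (simp add: powr_mono2)
    qed
  qed
  have i2: "integrable lebesgue (\<lambda>x. (\<Sum>i\<in>I. (\<psi> i x * w x)\<^sup>2) powr ?q)"
    unfolding sum_eq pw by (rule True)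
  show ?thesis
    using minkowski_integral[OF I q _ i1 i2] unfolding sq sum_eq by simp
qed

section \<open>Lower bound for the quadratic form\<close>

lemma crit_exp_ge_2:
  assumes "0 < s" "real DIM('a::euclidean_space) > 2 * s"
  shows "crit_exp TYPE('a) s \<ge> 2"
  using assms by (simp add: crit_exp_def pos_le_divide_eq)

lemma form_lower_bound:
  fixes \<Omega> :: "'a::euclidean_space set" and a :: "nat \<Rightarrow> 'a" and \<mu> :: "nat \<Rightarrow> real"
  assumes s: "0 < s" "s < 1" and N: "real DIM('a) > 2 * s"
    and \<Omega>: "open \<Omega>" "bounded \<Omega>" and k: "k \<ge> 1" and inj: "inj_on a {1..k}"
    and \<mu>: "\<forall>i\<in>{1..k}. \<mu> i \<ge> 0" "(\<Sum>i=1..k. \<mu> i) < Hardy_const TYPE('a) s"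
  shows "\<exists>C\<ge>0. \<forall>w\<in>X_space s \<Omega>. - (C * enn2real (\<integral>\<^sup>+x. ennreal ((w x)\<^sup>2) \<partial>lebesgue)) \<le>
     Q_form s \<Omega> k \<mu> a w - S_star TYPE('a) s k \<mu> * (Lp_norm (crit_exp TYPE('a) s) \<Omega> w)\<^sup>2"
proof -
  let ?I = "{1..k}" and ?p = "crit_exp TYPE('a) s" and ?S = "S_star TYPE('a) s k \<mu>"
  have I: "finite ?I" "?I \<noteq> {}" using k by auto
  obtain \<psi> where \<psi>0: "\<forall>i\<in>?I. multiplier (\<psi> i)" "\<forall>x. (\<Sum>i\<in>?I. (\<psi> i x)\<^sup>2) = 1"
    "\<forall>i\<in>?I. \<forall>j\<in>?I. i \<noteq> j \<longrightarrow> \<psi> j (a i) = 0"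
    using partition_at_points[OF I inj] by blast
  have \<psi>: "\<And>i. i \<in> ?I \<Longrightarrow> multiplier (\<psi> i)" "\<And>x. (\<Sum>i\<in>?I. (\<psi> i x)\<^sup>2) = 1"
    "\<And>i j. i \<in> ?I \<Longrightarrow> j \<in> ?I \<Longrightarrow> i \<noteq> j \<Longrightarrow> \<psi> j (a i) = 0"
    using \<psi>0 by blast+
  have m\<psi>: "\<psi> i \<in> borel_measurable lebesgue" if "i \<in> ?I" for i
    using multiplier_smooth[OF \<psi>(1)[OF that]] by (intro measurable_completion) (simp add: borel_measurable_smooth)
  define L where "L w = (\<integral>\<^sup>+x. ennreal ((w x)\<^sup>2) \<partial>lebesgue)" for w :: "'a \<Rightarrow> real"
  have "\<exists>C\<ge>0. \<forall>w\<in>borel_measurable lebesgue.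
     (\<Sum>i\<in>?I. ext_energy s (\<lambda>x. \<psi> i x * w x)) \<le> ext_energy s w + ennreal C * L w"
    unfolding L_def by (rule ims_localization[OF s I(1)]) (erule \<psi>(1), rule \<psi>(2))
  then obtain C1 where C1: "C1 \<ge> 0" "\<forall>w\<in>borel_measurable lebesgue.
     (\<Sum>i\<in>?I. ext_energy s (\<lambda>x. \<psi> i x * w x)) \<le> ext_energy s w + ennreal C1 * L w"
    by (elim exE conjE) (rule that)
  have "\<exists>C\<ge>0. \<forall>w\<in>borel_measurable lebesgue. \<forall>i\<in>?I.
     hardy_nn s (a i) w \<le> hardy_nn s (a i) (\<lambda>x. \<psi> i x * w x) + ennreal C * L w"
    unfolding L_def by (rule hardy_localization[OF s I(1)]) (erule \<psi>(1), rule \<psi>(2), erule (2) \<psi>(3))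
  then obtain C2 where C2: "C2 \<ge> 0" "\<forall>w\<in>borel_measurable lebesgue. \<forall>i\<in>?I.
     hardy_nn s (a i) w \<le> hardy_nn s (a i) (\<lambda>x. \<psi> i x * w x) + ennreal C2 * L w"
    by (elim exE conjE) (rule that)
  \<comment> \<open>Guarantees that the L^2 norm of \<open>w\<close> is finite, so that the
    estimates in \<open>ennreal\<close> can be read in the reals.\<close>
  from X_space_L2[OF s N \<Omega>(2)] obtain C3 where C3: "\<forall>w\<in>X_space s \<Omega>. L w \<le> ennreal C3 * ext_energy s w"
    unfolding L_def[symmetric] by (elim exE conjE) (rule that)
  have \<mu>le: "\<mu> i \<le> Hardy_const TYPE('a) s" if "i \<in> ?I" for i
  proof -
    have "\<mu> i \<le> (\<Sum>i=1..k. \<mu> i)" using that \<mu>(1) by (intro member_le_sum) auto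
    then show ?thesis using \<mu>(2) by linarith
  qed
  define M where "M = (\<Sum>i\<in>?I. \<mu> i)"
  have M: "M \<ge> 0" unfolding M_def using \<mu>(1) by (intro sum_nonneg) auto
  \<comment> \<open>\<open>C1\<close> is the cost of localizing the energy, \<open>C2\<close> that
    of localizing one Hardy term, counted with the weights \<mu>.\<close>
  define C where "C = C1 + M * C2"
  have C: "C \<ge> 0" using C1 C2 M by (simp add: C_def)
  have "- (C * enn2real (L w)) \<le> Q_form s \<Omega> k \<mu> a w - ?S * (Lp_norm ?p \<Omega> w)\<^sup>2" if w: "w \<in> X_space s \<Omega>" for w
  proof -
    note H = X_space_Hdot[OF w]
    note m = Hdot_measurable[OF H]
    have z: "AE x in lebesgue. x \<notin> \<Omega> \<longrightarrow> w x = 0" using w by (simp add: X_space_def)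
    have \<Omega>m: "\<Omega> \<in> sets lebesgue" using \<Omega>(1) by simp
    have "L w < \<infinity>"
      using le_less_trans[OF C3[rule_format, OF w]] Hdot_finite[OF s H] by (simp add: ennreal_mult_less_top)
    then obtain l where l: "l \<ge> 0" "L w = ennreal l" by (cases "L w") auto
    have Hi: "(\<lambda>x. \<psi> i x * w x) \<in> Hdot s" if "i \<in> ?I" for i
      by (rule Hdot_mult[OF s N \<psi>(1)[OF that] H])
    define e where "e i = energy s (\<lambda>x. \<psi> i x * w x)" for i
    define h where "h i = enn2real (hardy_nn s (a i) (\<lambda>x. \<psi> i x * w x))" for i
    have E: "(\<Sum>i\<in>?I. e i) \<le> energy s w + C1 * l"
    proof -
      have "ennreal (\<Sum>i\<in>?I. e i) = (\<Sum>i\<in>?I. ennreal (e i))" by (rule sum_ennreal[symmetric]) (simp add: e_def energy_nonneg)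
      also have "\<dots> = (\<Sum>i\<in>?I. ext_energy s (\<lambda>x. \<psi> i x * w x))"
        unfolding e_def by (intro sum.cong refl energy_ennreal[OF s, symmetric] Hi)
      also have "\<dots> \<le> ennreal (energy s w) + ennreal C1 * ennreal l"
        using C1(2)[rule_format, OF m] unfolding energy_ennreal[OF s H] l(2) .
      also have "\<dots> = ennreal (energy s w + C1 * l)"
        using C1(1) l(1) by (simp add: energy_nonneg ennreal_mult)
      finally show ?thesis using energy_nonneg[of s w] C1(1) l(1) by (subst (asm) ennreal_le_iff) auto
    qed
    have Hh: "Hardy_term s (a i) \<Omega> w \<le> h i + C2 * l" if i: "i \<in> ?I" for i
    proof -
      have "hardy_nn s (a i) (\<lambda>x. \<psi> i x * w x) = ennreal (h i)"
        unfolding h_def using hardy_nn_finite[OF s N Hi[OF i], of "a i"] by (simp add: less_top)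
      then have "hardy_nn s (a i) w \<le> ennreal (h i) + ennreal C2 * ennreal l"
        using C2(2)[rule_format, OF m i] l(2) by simp
      also have "\<dots> = ennreal (h i + C2 * l)"
        using C2(1) l(1) by (simp add: h_def ennreal_mult)
      finally have "enn2real (hardy_nn s (a i) w) \<le> h i + C2 * l"
        using C2(1) l(1) by (intro enn2real_leI) (auto simp: h_def)
      then show ?thesis using Hardy_term_eq[OF m \<Omega>m z] by simp
    qed
    have Q: "(\<Sum>i\<in>?I. e i - \<mu> i * h i) - C * l \<le> Q_form s \<Omega> k \<mu> a w"
    proof -
      have "(\<Sum>i=1..k. \<mu> i * Hardy_term s (a i) \<Omega> w) \<le> (\<Sum>i\<in>?I. \<mu> i * (h i + C2 * l))"
        using \<mu>(1) Hh by (intro sum_mono mult_left_mono) auto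
      also have "\<dots> = (\<Sum>i\<in>?I. \<mu> i * h i) + M * (C2 * l)"
        by (simp only: distrib_left sum.distrib sum_distrib_right[symmetric] M_def)
      finally show ?thesis using E unfolding Q_form_def C_def by (simp add: sum_subtractf algebra_simps)
    qed
    have pos: "S_mu TYPE('a) s (\<mu> i) * (Lp_norm ?p UNIV (\<lambda>x. \<psi> i x * w x))\<^sup>2 \<le> e i - \<mu> i * h i" if i: "i \<in> ?I" for i
      unfolding e_def h_def by (rule S_mu_le_at[OF s N Hi[OF i] \<mu>le[OF i]])
    have "?S * (Lp_norm ?p \<Omega> w)\<^sup>2 \<le> (\<Sum>i\<in>?I. e i - \<mu> i * h i)"
    \<comment> \<open>Enlarging the norm on the left needs \<open>?S\<close> to be nonnegative. This
      comes from \<open>S_mu_nonneg\<close> with \<open>w\<close> itself as the nonzero witness, so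
      a function vanishing almost everywhere is treated apart.\<close>
    proof (cases "AE x in lebesgue. w x = 0")
      case True
      have "(LINT x:UNIV|lebesgue. \<bar>w x\<bar> powr ?p) = 0"
        unfolding set_lebesgue_integral_def using True by (intro integral_eq_zero_AE) (auto elim: eventually_mono)
      then have "Lp_norm ?p \<Omega> w = 0" using Lp_norm_eq_UNIV[OF m \<Omega>m z] by (simp add: Lp_norm_def)
      moreover have "0 \<le> (\<Sum>i\<in>?I. e i - \<mu> i * h i)"
      proof (rule sum_nonneg)
        fix i assume i: "i \<in> ?I"
        have "h i \<ge> 0" by (simp add: h_def)
        then have "\<mu> i * h i \<le> Hardy_const TYPE('a) s * h i" using \<mu>le[OF i] by (rule mult_right_mono[rotated])
        also have "\<dots> \<le> e i" unfolding e_def h_def by (rule hardy_real[OF s N Hi[OF i]])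
        finally show "0 \<le> e i - \<mu> i * h i" by simp
      qed
      ultimately show ?thesis by simp
    next
      case False
      have S_le: "?S \<le> S_mu TYPE('a) s (\<mu> i)" if "i \<in> ?I" for i
        unfolding S_star_def using that by (intro Min_le) auto
      have S_pos: "?S \<ge> 0"
        unfolding S_star_def
        using S_mu_nonneg[OF s N H False \<mu>le] S_mu_nonneg[OF s N H False less_imp_le[OF Hardy_const_pos[OF N s(1)]]]
        by (intro Min.boundedI) auto
      have "?S * (Lp_norm ?p \<Omega> w)\<^sup>2 = ?S * (Lp_norm ?p UNIV w)\<^sup>2" using Lp_norm_eq_UNIV[OF m \<Omega>m z] by simp
      also have "\<dots> \<le> ?S * (\<Sum>i\<in>?I. (Lp_norm ?p UNIV (\<lambda>x. \<psi> i x * w x))\<^sup>2)"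
        using crit_exp_ge_2[OF s(1) N] by (intro mult_left_mono S_pos Lp_norm_localization[OF I _ m\<psi> \<psi>(2) m])
      also have "\<dots> = (\<Sum>i\<in>?I. ?S * (Lp_norm ?p UNIV (\<lambda>x. \<psi> i x * w x))\<^sup>2)" by (rule sum_distrib_left)
      also have "\<dots> \<le> (\<Sum>i\<in>?I. e i - \<mu> i * h i)"
        by (intro sum_mono order.trans[OF mult_right_mono[OF S_le] pos]) auto
      finally show ?thesis .
    qed
    then show ?thesis using Q l by simp
  qed
  then show ?thesis using C unfolding L_def by blast
qed

section \<open>Weakly null sequences\<close>

lemma cauchy_schwarz_integral:
  fixes f g :: "'b \<Rightarrow> real"
  assumes [measurable]: "f \<in> borel_measurable M" "g \<in> borel_measurable M"
    and f: "integrable M (\<lambda>x. (f x)\<^sup>2)" and g: "integrable M (\<lambda>x. (g x)\<^sup>2)"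
  shows "integrable M (\<lambda>x. f x * g x)"
    and "\<bar>\<integral>x. f x * g x \<partial>M\<bar> \<le> sqrt (\<integral>x. (f x)\<^sup>2 \<partial>M) * sqrt (\<integral>x. (g x)\<^sup>2 \<partial>M)"
proof -
  show fg: "integrable M (\<lambda>x. f x * g x)"
  proof (rule Bochner_Integration.integrable_bound[OF Bochner_Integration.integrable_add[OF f g]])
    show "AE x in M. norm (f x * g x) \<le> norm ((f x)\<^sup>2 + (g x)\<^sup>2)"
    proof (rule AE_I2)
      fix x
      have "2 * \<bar>f x\<bar> * \<bar>g x\<bar> \<le> \<bar>f x\<bar>\<^sup>2 + \<bar>g x\<bar>\<^sup>2" by (rule sum_squares_bound)
      moreover have "0 \<le> \<bar>f x\<bar> * \<bar>g x\<bar>" by simp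
      ultimately have "\<bar>f x\<bar> * \<bar>g x\<bar> \<le> (f x)\<^sup>2 + (g x)\<^sup>2" unfolding power2_abs by linarith
      then show "norm (f x * g x) \<le> norm ((f x)\<^sup>2 + (g x)\<^sup>2)" by (simp add: abs_mult)
    qed
  qed measurable
  define A where "A = (\<integral>x. (f x)\<^sup>2 \<partial>M)"
  define B where "B = (\<integral>x. (g x)\<^sup>2 \<partial>M)"
  define I where "I = (\<integral>x. f x * g x \<partial>M)"
  have AB: "A \<ge> 0" "B \<ge> 0" by (auto simp: A_def B_def)
  have q: "0 \<le> A + 2 * t * I + t\<^sup>2 * B" for t
  proof -
    have "0 \<le> (\<integral>x. (f x + t * g x)\<^sup>2 \<partial>M)" by simp
    also have "\<dots> = (\<integral>x. (f x)\<^sup>2 + 2 * t * (f x * g x) + t\<^sup>2 * (g x)\<^sup>2 \<partial>M)"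
      by (intro Bochner_Integration.integral_cong) (auto simp: power2_eq_square algebra_simps)
    also have "\<dots> = A + 2 * t * I + t\<^sup>2 * B"
      using f g fg by (simp add: A_def B_def I_def)
    finally show ?thesis .
  qed
  have "I\<^sup>2 \<le> A * B"
  proof (cases "B = 0")
    case True
    have "I = 0"
    proof (rule ccontr)
      assume "I \<noteq> 0"
      \<comment> \<open>For B = 0 the quadratic is affine in t; this t makes its value - 1.\<close>
      then have "A + 2 * (- (A + 1) / (2 * I)) * I + (- (A + 1) / (2 * I))\<^sup>2 * B = - 1" using True by (simp add: field_simps)
      then show False using q[of "- (A + 1) / (2 * I)"] by simp
    qed
    then show ?thesis using AB by simp
  next
    case False
    then have B: "B > 0" using AB by simp
    \<comment> \<open>The quadratic at its minimiser t = - I / B.\<close>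
    have "A + 2 * (- I / B) * I + (- I / B)\<^sup>2 * B = A - I\<^sup>2 / B"
      using B by (simp add: power2_eq_square)
    then have "I\<^sup>2 / B \<le> A" using q[of "- I / B"] by simp
    then show ?thesis using B by (simp add: pos_divide_le_eq)
  qed
  then have "sqrt (I\<^sup>2) \<le> sqrt (A * B)" by (rule real_sqrt_le_mono)
  then show "\<bar>\<integral>x. f x * g x \<partial>M\<bar> \<le> sqrt (\<integral>x. (f x)\<^sup>2 \<partial>M) * sqrt (\<integral>x. (g x)\<^sup>2 \<partial>M)"
    by (simp add: A_def B_def I_def real_sqrt_mult)
qed

text \<open>The kernel enters with half its exponent, so the square of this function is the energy
  density and the energy becomes a squared L^2 norm on the product space.\<close>

definition diff_quot :: "real \<Rightarrow> ('a::euclidean_space \<Rightarrow> real) \<Rightarrow> 'a \<times> 'a \<Rightarrow> real" where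
  "diff_quot s u p = (u (fst p) - u (snd p)) / norm (fst p - snd p) powr ((real DIM('a) + 2 * s) / 2)"

definition energy_inner :: "real \<Rightarrow> ('a::euclidean_space \<Rightarrow> real) \<Rightarrow> ('a \<Rightarrow> real) \<Rightarrow> real" where
  "energy_inner s u v = C_const TYPE('a) s / 2 * (\<integral>p. diff_quot s u p * diff_quot s v p \<partial>(lebesgue \<Otimes>\<^sub>M lebesgue))"

lemma diff_quot_measurable:
  fixes u :: "'a::euclidean_space \<Rightarrow> real"
  assumes [measurable]: "u \<in> borel_measurable lebesgue"
  shows "diff_quot s u \<in> borel_measurable (lebesgue \<Otimes>\<^sub>M lebesgue)"
  unfolding diff_quot_def[abs_def] by measurable

lemma diff_quot_square:
  fixes u :: "'a::euclidean_space \<Rightarrow> real"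
  shows "(diff_quot s u p)\<^sup>2 = \<bar>u (fst p) - u (snd p)\<bar>\<^sup>2 / norm (fst p - snd p) powr (real DIM('a) + 2 * s)"
proof -
  have "(norm (fst p - snd p) powr ((real DIM('a) + 2 * s) / 2))\<^sup>2 = norm (fst p - snd p) powr ((real DIM('a) + 2 * s) / 2 + (real DIM('a) + 2 * s) / 2)"
    unfolding power2_eq_square powr_add ..
  then show ?thesis by (simp add: diff_quot_def power_divide)
qed

context
  fixes s :: real
  assumes s: "0 < s" "s < 1"
begin

lemma diff_quot_L2:
  fixes u :: "'a::euclidean_space \<Rightarrow> real"
  assumes u: "u \<in> Hdot s"
  shows "integrable (lebesgue \<Otimes>\<^sub>M lebesgue) (\<lambda>p. (diff_quot s u p)\<^sup>2)"
    and "energy s u = C_const TYPE('a) s / 2 * (\<integral>p. (diff_quot s u p)\<^sup>2 \<partial>(lebesgue \<Otimes>\<^sub>M lebesgue))"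
proof -
  note [measurable] = diff_quot_measurable[OF Hdot_measurable[OF u]]
  have c: "C_const TYPE('a) s / 2 > 0" using C_const_pos[OF s, where 'a='a] by simp
  have e: "ext_energy s u = ennreal (C_const TYPE('a) s / 2) * (\<integral>\<^sup>+p. ennreal ((diff_quot s u p)\<^sup>2) \<partial>(lebesgue \<Otimes>\<^sub>M lebesgue))"
    by (simp add: ext_energy_def diff_quot_square)
  have "(\<integral>\<^sup>+p. ennreal ((diff_quot s u p)\<^sup>2) \<partial>(lebesgue \<Otimes>\<^sub>M lebesgue)) < \<infinity>"
    using Hdot_finite[OF s u] c unfolding e by (auto simp: ennreal_mult_less_top)
  then show i: "integrable (lebesgue \<Otimes>\<^sub>M lebesgue) (\<lambda>p. (diff_quot s u p)\<^sup>2)"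
    by (intro integrableI_nonneg) auto
  show "energy s u = C_const TYPE('a) s / 2 * (\<integral>p. (diff_quot s u p)\<^sup>2 \<partial>(lebesgue \<Otimes>\<^sub>M lebesgue))"
    unfolding energy_def e using c by (subst nn_integral_eq_integral[OF i]) (auto simp: enn2real_mult)
qed

lemma energy_inner_self:
  fixes u :: "'a::euclidean_space \<Rightarrow> real"
  assumes "u \<in> Hdot s"
  shows "energy_inner s u u = (seminorm_s s u)\<^sup>2"
  using diff_quot_L2(2)[OF assms] energy_nonneg[of s u]
  by (simp add: energy_inner_def seminorm_s_def power2_eq_square)

lemma energy_inner_commute: "energy_inner s u v = energy_inner s v u"
  by (simp add: energy_inner_def mult.commute)

lemma energy_inner_bound:
  fixes u :: "'a::euclidean_space \<Rightarrow> real"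
  assumes u: "u \<in> Hdot s" and v: "v \<in> Hdot s"
  shows "\<bar>energy_inner s u v\<bar> \<le> seminorm_s s u * seminorm_s s v"
proof -
  let ?c = "C_const TYPE('a) s / 2"
  have c: "?c \<ge> 0" using C_const_pos[OF s, where 'a='a] by simp
  note m = diff_quot_measurable[OF Hdot_measurable[OF u]] diff_quot_measurable[OF Hdot_measurable[OF v]]
  let ?U = "(\<integral>p. (diff_quot s u p)\<^sup>2 \<partial>(lebesgue \<Otimes>\<^sub>M lebesgue))" and ?V = "(\<integral>p. (diff_quot s v p)\<^sup>2 \<partial>(lebesgue \<Otimes>\<^sub>M lebesgue))"
  have "\<bar>energy_inner s u v\<bar> = ?c * \<bar>\<integral>p. diff_quot s u p * diff_quot s v p \<partial>(lebesgue \<Otimes>\<^sub>M lebesgue)\<bar>"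
    unfolding energy_inner_def abs_mult using c by simp
  also have "\<dots> \<le> ?c * (sqrt ?U * sqrt ?V)"
    by (intro mult_left_mono cauchy_schwarz_integral(2) m diff_quot_L2(1) u v c)
  also have "\<dots> = (sqrt ?c * sqrt ?c) * (sqrt ?U * sqrt ?V)" using c by simp
  also have "\<dots> = seminorm_s s u * seminorm_s s v"
    unfolding seminorm_s_def diff_quot_L2(2)[OF u] diff_quot_L2(2)[OF v] real_sqrt_mult by (simp only: mult_ac)
  finally show ?thesis .
qed

lemma energy_inner_add:
  fixes u v w :: "'a::euclidean_space \<Rightarrow> real"
  assumes u: "u \<in> Hdot s" and v: "v \<in> Hdot s" and w: "w \<in> Hdot s"
  shows "energy_inner s w (\<lambda>x. u x + v x) = energy_inner s w u + energy_inner s w v"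
proof -
  have i: "integrable (lebesgue \<Otimes>\<^sub>M lebesgue) (\<lambda>p. diff_quot s w p * diff_quot s z p)" if "z \<in> Hdot s" for z :: "'a \<Rightarrow> real"
    by (intro cauchy_schwarz_integral(1) diff_quot_measurable Hdot_measurable[OF w] Hdot_measurable[OF that]
        diff_quot_L2(1) w that)
  have "diff_quot s w p * diff_quot s (\<lambda>x. u x + v x) p = diff_quot s w p * diff_quot s u p + diff_quot s w p * diff_quot s v p" for p
  proof -
    have "diff_quot s (\<lambda>x. u x + v x) p = diff_quot s u p + diff_quot s v p"
      unfolding diff_quot_def add_divide_distrib[symmetric] by (simp add: algebra_simps)
    then show ?thesis by (simp only: distrib_left)
  qed
  then show ?thesis
    unfolding energy_inner_def using i[OF u] i[OF v] by (simp add: distrib_left)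
qed

lemma energy_inner_scale:
  "energy_inner s w (\<lambda>x. c * u x) = c * energy_inner s w u"
proof -
  have d: "diff_quot s (\<lambda>x. c * u x) = (\<lambda>p. c * diff_quot s u p)"
    by (rule ext) (simp add: diff_quot_def right_diff_distrib[symmetric])
  show ?thesis unfolding energy_inner_def d by (simp add: mult.left_commute[of _ c])
qed

text \<open>Testing weak convergence with these functionals makes the inner products of a weakly
  null sequence with any fixed element tend to 0.\<close>

lemma energy_inner_dual:
  assumes "v \<in> X_space s \<Omega>"
  shows "energy_inner s v \<in> X_dual s \<Omega>"
  unfolding X_dual_def
proof (intro CollectI conjI ballI allI exI)
  note H = X_space_Hdot[OF assms]
  show "energy_inner s v (\<lambda>x. u x + z x) = energy_inner s v u + energy_inner s v z"
    if "u \<in> X_space s \<Omega>" "z \<in> X_space s \<Omega>" for u z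
    by (rule energy_inner_add[OF X_space_Hdot[OF that(1)] X_space_Hdot[OF that(2)] H])
  show "energy_inner s v (\<lambda>x. c * u x) = c * energy_inner s v u" for c u
    by (rule energy_inner_scale)
  show "\<bar>energy_inner s v u\<bar> \<le> seminorm_s s v * seminorm_s s u" if "u \<in> X_space s \<Omega>" for u
    by (rule energy_inner_bound[OF H X_space_Hdot[OF that]])
qed

text \<open>Uniform boundedness by a gliding hump: along a sparse subsequence \<open>v\<^sub>j\<close> of an unbounded weakly
  null sequence, the functional \<open>\<Sum>\<^sub>j 2\<^sup>-\<^sup>j \<langle>v\<^sub>j, \<cdot>\<rangle> / \<parallel>v\<^sub>j\<parallel>\<close> is bounded, but its values on \<open>v\<^sub>j\<close> tend to infinity.\<close>
lemma weakly_null_bounded: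
  fixes \<Omega> :: "'a::euclidean_space set"
  assumes w: "X_weakly_converges s \<Omega> w (\<lambda>_. 0)"
  shows "\<exists>B. \<forall>n. seminorm_s s (w n) \<le> B"
proof (rule ccontr)
  assume unb: "\<not> (\<exists>B. \<forall>n. seminorm_s s (w n) \<le> B)"
  have wX: "w n \<in> X_space s \<Omega>" for n using w by (simp add: X_weakly_converges_def)
  have wH: "w n \<in> Hdot s" for n using X_space_Hdot[OF wX] .
  have zero: "F (\<lambda>_. 0) = 0" if F: "F \<in> X_dual s \<Omega>" for F
  proof -
    have z: "(\<lambda>_. 0) \<in> X_space s \<Omega>" using w by (simp add: X_weakly_converges_def)
    have "\<forall>c. \<forall>u\<in>X_space s \<Omega>. F (\<lambda>x. c * u x) = c * F u" using F by (simp add: X_dual_def)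
    from this[rule_format, OF z, of 0] show ?thesis by simp
  qed
  have conv: "(\<lambda>n. F (w n)) \<longlonglongrightarrow> 0" if "F \<in> X_dual s \<Omega>" for F
  proof -
    have "(\<lambda>n. F (w n)) \<longlonglongrightarrow> F (\<lambda>_. 0)" using w that by (simp add: X_weakly_converges_def)
    then show ?thesis unfolding zero[OF that] .
  qed
  define nm where "nm n = seminorm_s s (w n)" for n
  define ip where "ip m n = energy_inner s (w m) (w n)" for m n
  have nm0: "nm n \<ge> 0" for n by (simp add: nm_def seminorm_s_def energy_nonneg)
  have ip0: "(\<lambda>n. ip m n) \<longlonglongrightarrow> 0" for m
    unfolding ip_def by (rule conv[OF energy_inner_dual[OF wX]])
  have ipsym: "ip m n = ip n m" for m n unfolding ip_def by (rule energy_inner_commute)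
  have big: "\<exists>n>n0. nm n \<ge> K" for n0 K
  proof (rule ccontr)
    assume "\<not> (\<exists>n>n0. nm n \<ge> K)"
    then have le: "nm n \<le> K" if "n > n0" for n using that by force
    have "nm n \<le> max K (Max (nm ` {..n0}))" for n
    proof (cases "n > n0")
      case True then show ?thesis using le by (simp add: le_max_iff_disj)
    next
      case False
      then have "nm n \<le> Max (nm ` {..n0})" by (intro Max_ge) auto
      then show ?thesis by (simp add: le_max_iff_disj)
    qed
    then show False using unb unfolding nm_def by blast
  qed
  \<comment> \<open>Norms of at least 4^j leave a factor 2^j after weighting with 2^(-j). Inner
    products of at most 1 with all earlier terms keep the off-diagonal contributions
    summable.\<close>
  have "\<exists>r. \<forall>j. (nm (r j) \<ge> 4 ^ j) \<and> (r j < r (Suc j) \<and> (\<forall>m\<le>r j. \<bar>ip m (r (Suc j))\<bar> \<le> 1))"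
  proof (rule dependent_nat_choice)
    show "\<exists>n. 4 ^ 0 \<le> nm n" using big[where K="4 ^ 0"] by blast
  next
    fix n j
    have "\<forall>\<^sub>F n' in sequentially. \<bar>ip m n'\<bar> < 1" for m
    proof -
      have "(\<lambda>n'. \<bar>ip m n'\<bar>) \<longlonglongrightarrow> \<bar>0\<bar>" by (intro tendsto_rabs ip0)
      then show ?thesis by (rule order_tendstoD(2)) simp
    qed
    then have "\<forall>\<^sub>F n' in sequentially. \<forall>m\<in>{..n}. \<bar>ip m n'\<bar> < 1" by (intro eventually_ball_finite) auto
    then obtain n1 where n1: "\<And>n'. n' \<ge> n1 \<Longrightarrow> \<forall>m\<in>{..n}. \<bar>ip m n'\<bar> < 1" by (auto simp: eventually_sequentially)
    obtain n' where "n' > max n n1" "nm n' \<ge> 4 ^ Suc j" using big by blast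
    then show "\<exists>n'. 4 ^ Suc j \<le> nm n' \<and> n < n' \<and> (\<forall>m\<le>n. \<bar>ip m n'\<bar> \<le> 1)"
      using n1[of n'] by (intro exI[of _ n']) (auto intro: less_imp_le)
  qed
  then obtain r where r0: "\<forall>j. (nm (r j) \<ge> 4 ^ j) \<and> (r j < r (Suc j) \<and> (\<forall>m\<le>r j. \<bar>ip m (r (Suc j))\<bar> \<le> 1))" ..
  have r: "\<And>j. nm (r j) \<ge> 4 ^ j" "\<And>j. r j < r (Suc j)" "\<And>j m. m \<le> r j \<Longrightarrow> \<bar>ip m (r (Suc j))\<bar> \<le> 1"
    using r0 by simp_all
  have mono: "strict_mono r" unfolding strict_mono_Suc_iff using r(2) by simp
  have small: "\<bar>ip (r i) (r j)\<bar> \<le> 1" if "i < j" for i j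
  proof -
    obtain j' where j': "j = Suc j'" using \<open>i < j\<close> by (cases j) auto
    then have "r i \<le> r j'" using \<open>i < j\<close> strict_mono_less_eq[OF mono] by simp
    then show ?thesis using r(3) j' by simp
  qed
  have small': "\<bar>ip (r j) (r m)\<bar> \<le> 1" if "j \<noteq> m" for j m
    using small[of j m] small[of m j] that ipsym[of "r j" "r m"] by (cases "j < m") auto
  \<comment> \<open>Norms of at least 1 allow the division and turn the bound 1 on the inner
    products into a bound by the norm.\<close>
  have nm1: "nm (r j) \<ge> 1" for j
  proof -
    have "(1::real) \<le> 4 ^ j" by simp
    then show ?thesis using r(1)[of j] by linarith
  qed
  define t where "t u j = (1 / 2) ^ j * (energy_inner s (w (r j)) u / nm (r j))" for u j
  define F where "F u = (\<Sum>j. t u j)" for u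
  have geo: "(\<lambda>j. (1 / 2) ^ j :: real) sums 2" using geometric_sums[of "1 / 2 :: real"] by simp
  have tb: "\<bar>t u j\<bar> \<le> (1 / 2) ^ j * seminorm_s s u" if u: "u \<in> Hdot s" for u j
  proof -
    have "\<bar>energy_inner s (w (r j)) u\<bar> \<le> nm (r j) * seminorm_s s u"
      unfolding nm_def by (rule energy_inner_bound[OF wH u])
    then have "\<bar>energy_inner s (w (r j)) u\<bar> / nm (r j) \<le> seminorm_s s u"
      using nm1[of j] by (simp add: pos_divide_le_eq mult.commute)
    then have "\<bar>energy_inner s (w (r j)) u / nm (r j)\<bar> \<le> seminorm_s s u"
      using nm0[of "r j"] by simp
    then show ?thesis unfolding t_def abs_mult by (intro mult_mono) auto
  qed
  have gs: "(\<lambda>j. (1 / 2) ^ j * S) sums (2 * S)" for S :: real by (rule sums_mult2[OF geo])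
  have ts: "summable (t u)" if u: "u \<in> Hdot s" for u
    using tb[OF u] by (intro summable_comparison_test'[OF sums_summable[OF gs[of "seminorm_s s u"]]]) auto
  have Fb: "\<bar>F u\<bar> \<le> 2 * seminorm_s s u" if u: "u \<in> Hdot s" for u
  proof -
    have sa: "summable (\<lambda>j. \<bar>t u j\<bar>)"
      using tb[OF u] by (intro summable_comparison_test'[OF sums_summable[OF gs[of "seminorm_s s u"]]]) auto
    have "\<bar>F u\<bar> \<le> (\<Sum>j. \<bar>t u j\<bar>)" unfolding F_def by (rule summable_rabs[OF sa])
    also have "\<dots> \<le> (\<Sum>j. (1 / 2) ^ j * seminorm_s s u)"
      by (rule suminf_le[OF tb[OF u] sa sums_summable[OF gs]])
    also have "\<dots> = 2 * seminorm_s s u" by (rule sums_unique[OF gs, symmetric])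
    finally show ?thesis .
  qed
  have "F \<in> X_dual s \<Omega>"
    unfolding X_dual_def
  proof (intro CollectI conjI ballI allI exI)
    fix u v assume uv: "u \<in> X_space s \<Omega>" "v \<in> X_space s \<Omega>"
    note H = X_space_Hdot[OF uv(1)] X_space_Hdot[OF uv(2)]
    have "t (\<lambda>x. u x + v x) = (\<lambda>j. t u j + t v j)"
      by (rule ext) (simp only: t_def energy_inner_add[OF H wH] add_divide_distrib distrib_left)
    then show "F (\<lambda>x. u x + v x) = F u + F v"
      unfolding F_def using suminf_add[OF ts[OF H(1)] ts[OF H(2)]] by simp
  next
    fix c :: real and u assume u: "u \<in> X_space s \<Omega>"
    have "t (\<lambda>x. c * u x) = (\<lambda>j. c * t u j)"
      by (rule ext) (simp add: t_def energy_inner_scale)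
    then show "F (\<lambda>x. c * u x) = c * F u"
      unfolding F_def using suminf_mult[OF ts[OF X_space_Hdot[OF u]], of c] by simp
  next
    fix u assume u: "u \<in> X_space s \<Omega>"
    show "\<bar>F u\<bar> \<le> 2 * seminorm_s s u" by (rule Fb[OF X_space_Hdot[OF u]])
  qed
  then have "(\<lambda>n. F (w n)) \<longlonglongrightarrow> 0" by (rule conv)
  then have lim: "(\<lambda>m. F (w (r m))) \<longlonglongrightarrow> 0" using LIMSEQ_subseq_LIMSEQ[OF _ mono] by (auto simp: comp_def)
  have low: "F (w (r m)) \<ge> 2 ^ m - 2" for m
  proof -
    \<comment> \<open>The diagonal term contributes at least 2^m and every other term at least -
      2^(-j); the negative parts add up to at most 2, whence 2^m - 2.\<close>
    have pt: "(if j = m then 2 ^ m else 0) - (1 / 2) ^ j \<le> t (w (r m)) j" for j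
    proof (cases "j = m")
      case True
      have "energy_inner s (w (r m)) (w (r m)) = nm (r m) * nm (r m)"
        unfolding nm_def energy_inner_self[OF wH] by (simp add: power2_eq_square)
      then have "t (w (r m)) m = (1 / 2) ^ m * nm (r m)"
        unfolding t_def using nm1[of m] by simp
      moreover have "(1 / 2) ^ m * 4 ^ m \<le> (1 / 2) ^ m * nm (r m)" using r(1) by (intro mult_left_mono) auto
      moreover have "(1 / 2 :: real) ^ m * 4 ^ m = 2 ^ m" by (simp flip: power_mult_distrib)
      moreover have "0 \<le> (1 / 2 :: real) ^ m" by simp
      ultimately have "2 ^ m - (1 / 2) ^ m \<le> t (w (r m)) m" by linarith
      then show ?thesis using True by simp
    next
      case False
      have "\<bar>energy_inner s (w (r j)) (w (r m))\<bar> \<le> 1 * nm (r j)"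
        using small'[OF False] nm1[of j] unfolding ip_def by linarith
      then have "\<bar>energy_inner s (w (r j)) (w (r m))\<bar> / nm (r j) \<le> 1"
        using nm1[of j] by (simp add: pos_divide_le_eq)
      then have "\<bar>energy_inner s (w (r j)) (w (r m)) / nm (r j)\<bar> \<le> 1" using nm0[of "r j"] by simp
      then have "\<bar>t (w (r m)) j\<bar> \<le> (1 / 2) ^ j * 1" unfolding t_def abs_mult by (intro mult_mono) auto
      then show ?thesis using False by auto
    qed
    have s1: "(\<lambda>j. (if j = m then 2 ^ m else 0 :: real)) sums 2 ^ m" by (rule sums_single)
    have s2: "(\<lambda>j. (if j = m then 2 ^ m else 0) - (1 / 2) ^ j :: real) sums (2 ^ m - 2)" by (rule sums_diff[OF s1 geo])
    have "2 ^ m - 2 = (\<Sum>j. (if j = m then 2 ^ m else 0) - (1 / 2) ^ j :: real)" by (rule sums_unique[OF s2])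
    also have "\<dots> \<le> F (w (r m))" unfolding F_def by (rule suminf_le[OF pt sums_summable[OF s2] ts[OF wH]])
    finally show ?thesis .
  qed
  have "\<forall>\<^sub>F m in sequentially. F (w (r m)) < 1" using lim by (rule order_tendstoD) simp
  then obtain m0 where m0: "\<And>m. m \<ge> m0 \<Longrightarrow> F (w (r m)) < 1" by (auto simp: eventually_sequentially)
  \<comment> \<open>At m0 + 2 the lower bound 2^m - 2 is at least 2, which contradicts the bound 1
    from convergence.\<close>
  have "(2::real) ^ 2 \<le> 2 ^ (m0 + 2)" by (rule power_increasing) auto
  moreover have "(2::real) ^ 2 = 4" by simp
  ultimately show False using m0[OF le_add1[of m0 2]] low[of "m0 + 2"] by linarith
qed

end

section \<open>Ball averages and convergence in L^2\<close>

lemma X_space_square_integrable: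
  fixes \<Omega> :: "'a::euclidean_space set"
  assumes s: "0 < s" "s < 1" and N: "real DIM('a) > 2 * s" and \<Omega>: "bounded \<Omega>"
  shows "\<exists>C\<ge>0. \<forall>w\<in>X_space s \<Omega>. integrable lebesgue (\<lambda>x. (w x)\<^sup>2) \<and> (\<integral>x. (w x)\<^sup>2 \<partial>lebesgue) \<le> C * energy s w"
proof -
  from X_space_L2[OF assms] obtain C where C: "C \<ge> 0"
    "\<forall>w\<in>X_space s \<Omega>. (\<integral>\<^sup>+x. ennreal ((w x)\<^sup>2) \<partial>lebesgue) \<le> ennreal C * ext_energy s w"
    by (elim exE conjE) (rule that)
  have "integrable lebesgue (\<lambda>x. (w x)\<^sup>2) \<and> (\<integral>x. (w x)\<^sup>2 \<partial>lebesgue) \<le> C * energy s w" if w: "w \<in> X_space s \<Omega>" for w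
  proof -
    note H = X_space_Hdot[OF w]
    note [measurable] = Hdot_measurable[OF H]
    have le: "(\<integral>\<^sup>+x. ennreal ((w x)\<^sup>2) \<partial>lebesgue) \<le> ennreal (C * energy s w)"
      using C(2)[rule_format, OF w] C(1) unfolding energy_ennreal[OF s H] by (simp add: ennreal_mult')
    have i: "integrable lebesgue (\<lambda>x. (w x)\<^sup>2)"
      using le_less_trans[OF le] by (intro integrableI_nonneg) auto
    moreover have "(\<integral>x. (w x)\<^sup>2 \<partial>lebesgue) \<le> C * energy s w"
      using le C(1) energy_nonneg[of s w] unfolding nn_integral_eq_integral[OF i AE_I2[OF zero_le_power2]]
      by (subst (asm) ennreal_le_iff) auto
    ultimately show ?thesis by simp
  qed
  then show ?thesis using C(1) by blast
qed

definition ball_integral :: "real \<Rightarrow> ('a::euclidean_space \<Rightarrow> real) \<Rightarrow> 'a \<Rightarrow> real" where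
  "ball_integral r u x = (\<integral>y. indicat_real (ball x r) y * u y \<partial>lebesgue)"

lemma indicator_ball_L2:
  fixes x :: "'a::euclidean_space"
  assumes "r > 0"
  shows "integrable lebesgue (indicat_real (ball x r))"
    and "(\<integral>y. (indicat_real (ball x r) y)\<^sup>2 \<partial>lebesgue) = unit_ball_vol (real DIM('a)) * r ^ DIM('a)"
    and "integrable lebesgue (\<lambda>y. (indicat_real (ball x r) y)\<^sup>2)"
    and "(\<integral>y. indicat_real (ball x r) y \<partial>lebesgue) = unit_ball_vol (real DIM('a)) * r ^ DIM('a)"
proof -
  have sq: "(indicat_real (ball x r) y)\<^sup>2 = indicat_real (ball x r) y" for y by (simp add: indicator_def)
  have fin: "emeasure lebesgue (ball x r) < \<infinity>" using emeasure_bounded_finite[of "ball x r"] by simp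
  show 1: "integrable lebesgue (indicat_real (ball x r))"
    using fin by (intro integrable_real_indicator) auto
  show 2: "(\<integral>y. indicat_real (ball x r) y \<partial>lebesgue) = unit_ball_vol (real DIM('a)) * r ^ DIM('a)"
    using content_ball[of r x] assms by simp
  show "(\<integral>y. (indicat_real (ball x r) y)\<^sup>2 \<partial>lebesgue) = unit_ball_vol (real DIM('a)) * r ^ DIM('a)"
    "integrable lebesgue (\<lambda>y. (indicat_real (ball x r) y)\<^sup>2)"
    unfolding sq using 1 2 by auto
qed

lemma ball_integral_bound:
  fixes u :: "'a::euclidean_space \<Rightarrow> real"
  assumes r: "r > 0" and [measurable]: "u \<in> borel_measurable lebesgue" and u: "integrable lebesgue (\<lambda>x. (u x)\<^sup>2)"
  shows "integrable lebesgue (\<lambda>y. indicat_real (ball x r) y * u y)"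
    and "\<bar>ball_integral r u x\<bar> \<le> sqrt (unit_ball_vol (real DIM('a)) * r ^ DIM('a)) * sqrt (\<integral>x. (u x)\<^sup>2 \<partial>lebesgue)"
proof -
  have m: "indicat_real (ball x r) \<in> borel_measurable lebesgue" by (intro borel_measurable_indicator) auto
  note cs = cauchy_schwarz_integral[OF m assms(2) indicator_ball_L2(3)[OF r] u]
  show "integrable lebesgue (\<lambda>y. indicat_real (ball x r) y * u y)" by (rule cs(1))
  show "\<bar>ball_integral r u x\<bar> \<le> sqrt (unit_ball_vol (real DIM('a)) * r ^ DIM('a)) * sqrt (\<integral>x. (u x)\<^sup>2 \<partial>lebesgue)"
    using cs(2) unfolding ball_integral_def indicator_ball_L2(2)[OF r] .
qed

text \<open>By Cauchy-Schwarz and the L^2 bound on a bounded set, integration over a ball is a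
  bounded functional. Weak convergence therefore gives convergence of the ball integrals at every
  centre \<open>x\<close>.\<close>

lemma ball_integral_dual:
  fixes \<Omega> :: "'a::euclidean_space set"
  assumes s: "0 < s" "s < 1" and N: "real DIM('a) > 2 * s" and \<Omega>: "bounded \<Omega>" and r: "r > 0"
  shows "(\<lambda>u. ball_integral r u x) \<in> X_dual s \<Omega>"
proof -
  obtain C where C: "C \<ge> 0" "\<And>w. w \<in> X_space s \<Omega> \<Longrightarrow> integrable lebesgue (\<lambda>x. (w x)\<^sup>2)"
    "\<And>w. w \<in> X_space s \<Omega> \<Longrightarrow> (\<integral>x. (w x)\<^sup>2 \<partial>lebesgue) \<le> C * energy s w"
    using X_space_square_integrable[OF s N \<Omega>] by blast
  have m: "w \<in> borel_measurable lebesgue" if "w \<in> X_space s \<Omega>" for w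
    using Hdot_measurable[OF X_space_Hdot[OF that]] .
  show ?thesis
    unfolding X_dual_def
  proof (intro CollectI conjI ballI allI exI)
    fix u v assume uv: "u \<in> X_space s \<Omega>" "v \<in> X_space s \<Omega>"
    show "ball_integral r (\<lambda>x. u x + v x) x = ball_integral r u x + ball_integral r v x"
      unfolding ball_integral_def distrib_left
      by (intro Bochner_Integration.integral_add ball_integral_bound(1) r m C(2) uv)
  next
    fix c :: real and u
    show "ball_integral r (\<lambda>x. c * u x) x = c * ball_integral r u x"
      unfolding ball_integral_def by (simp add: mult.left_commute[of _ c])
  next
    let ?V = "sqrt (unit_ball_vol (real DIM('a)) * r ^ DIM('a))"
    fix u assume u: "u \<in> X_space s \<Omega>"
    have V: "0 \<le> ?V" using r by simp
    have "\<bar>ball_integral r u x\<bar> \<le> ?V * sqrt (\<integral>x. (u x)\<^sup>2 \<partial>lebesgue)"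
      by (rule ball_integral_bound(2)[OF r m[OF u] C(2)[OF u]])
    also have "\<dots> \<le> ?V * sqrt (C * energy s u)"
      by (intro mult_left_mono real_sqrt_le_mono C(3) u V)
    also have "\<dots> = (?V * sqrt C) * seminorm_s s u" by (simp add: seminorm_s_def real_sqrt_mult)
    finally show "\<bar>ball_integral r u x\<bar> \<le> (?V * sqrt C) * seminorm_s s u" .
  qed
qed

lemma ball_integral_measurable:
  fixes u :: "'a::euclidean_space \<Rightarrow> real"
  assumes [measurable]: "u \<in> borel_measurable lebesgue"
  shows "ball_integral r u \<in> borel_measurable lebesgue"
proof -
  \<comment> \<open>With the ball written as a condition on \<open>dist x y\<close>, the integrand
    is jointly measurable in x and y.\<close>
  have "ball_integral r u = (\<lambda>x. \<integral>y. (if dist x y < r then u y else 0) \<partial>lebesgue)"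
    unfolding ball_integral_def by (intro ext Bochner_Integration.integral_cong) (auto simp: indicator_def)
  moreover have "(\<lambda>x. \<integral>y. (if dist x y < r then u y else 0) \<partial>lebesgue) \<in> borel_measurable lebesgue"
    by (rule lebesgue.borel_measurable_lebesgue_integral) measurable
  ultimately show ?thesis by simp
qed

text \<open>Comparing \<open>w(x)\<close> with its mean over a ball: \<open>|w(x) - w(y)|\<^sup>2\<close> is controlled by the energy
  density with a factor that is small with the radius.\<close>
lemma square_le_ball_average:
  fixes w :: "'a::euclidean_space \<Rightarrow> real"
  assumes s: "0 < s" and r: "r > 0" and m[measurable]: "w \<in> borel_measurable lebesgue" and w: "integrable lebesgue (\<lambda>x. (w x)\<^sup>2)"
  defines "V \<equiv> unit_ball_vol (real DIM('a)) * r ^ DIM('a)"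
  shows "ennreal ((w x)\<^sup>2) \<le> ennreal (2 * r powr (real DIM('a) + 2 * s) / V) *
       (\<integral>\<^sup>+y. ennreal (\<bar>w x - w y\<bar>\<^sup>2 / norm (x - y) powr (real DIM('a) + 2 * s)) \<partial>lebesgue)
     + ennreal (2 / V\<^sup>2 * (ball_integral r w x)\<^sup>2)"
proof -
  let ?e = "real DIM('a) + 2 * s"
  let ?b = "indicat_real (ball x r)"
  have V: "V > 0" using r by (simp add: V_def)
  define T where "T = ball_integral r w x"
  have mb[measurable]: "?b \<in> borel_measurable lebesgue" by (intro borel_measurable_indicator) auto
  note ib = indicator_ball_L2(1)[OF r, of x]
  note iw = ball_integral_bound(1)[OF r m w, of x]
  have iw2: "integrable lebesgue (\<lambda>y. ?b y * (w y)\<^sup>2)"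
    by (rule Bochner_Integration.integrable_bound[OF w]) (auto simp: indicator_def)
  have split: "?b y * (w x - w y)\<^sup>2 = (w x)\<^sup>2 * ?b y - 2 * w x * (?b y * w y) + ?b y * (w y)\<^sup>2" for y
    by (simp add: power2_eq_square algebra_simps)
  have id: "integrable lebesgue (\<lambda>y. ?b y * (w x - w y)\<^sup>2)"
    unfolding split using ib iw iw2 by (intro Bochner_Integration.integrable_add Bochner_Integration.integrable_diff) auto
  define A where "A = (\<integral>y. ?b y * (w x - w y)\<^sup>2 \<partial>lebesgue)"
  \<comment> \<open>The lower bound 3/4 w(x)^2 - w(x) w(y) is linear in w(y), so integrating it over
    the ball produces the ball integral \<open>T\<close> instead of a local L^2 norm. The discarded
    part is the square of w(x)/2 - w(y).\<close>
  have "(\<integral>y. 3 / 4 * (w x)\<^sup>2 * ?b y - w x * (?b y * w y) \<partial>lebesgue) \<le> A"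
    unfolding A_def
  proof (rule integral_mono)
    show "integrable lebesgue (\<lambda>y. 3 / 4 * (w x)\<^sup>2 * ?b y - w x * (?b y * w y))" using ib iw by auto
    show "integrable lebesgue (\<lambda>y. ?b y * (w x - w y)\<^sup>2)" by (rule id)
    fix y
    have "0 \<le> (w x / 2 - w y)\<^sup>2" by simp
    then have "3 / 4 * (w x)\<^sup>2 - w x * w y \<le> (w x - w y)\<^sup>2" by (simp add: power2_eq_square algebra_simps)
    then show "3 / 4 * (w x)\<^sup>2 * ?b y - w x * (?b y * w y) \<le> ?b y * (w x - w y)\<^sup>2" by (simp add: indicator_def)
  qed
  moreover have "(\<integral>y. 3 / 4 * (w x)\<^sup>2 * ?b y - w x * (?b y * w y) \<partial>lebesgue) = 3 / 4 * (w x)\<^sup>2 * V - w x * T"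
    using ib iw indicator_ball_L2(4)[OF r, of x] by (simp add: T_def ball_integral_def V_def)
  ultimately have 1: "3 / 4 * (w x)\<^sup>2 * V - w x * T \<le> A" by simp
  \<comment> \<open>Young's inequality absorbs w(x) T into a quarter of w(x)^2 V, so that half of
    w(x)^2 V remains on the left.\<close>
  have "0 \<le> (w x * V / 2 - T)\<^sup>2" by simp
  then have "w x * T * V \<le> (w x)\<^sup>2 * V\<^sup>2 / 4 + T\<^sup>2" by (simp add: power2_eq_square algebra_simps)
  then have "w x * T * V / V \<le> ((w x)\<^sup>2 * V\<^sup>2 / 4 + T\<^sup>2) / V" using V by (intro divide_right_mono) auto
  then have 2: "w x * T \<le> (w x)\<^sup>2 * V / 4 + T\<^sup>2 / V" using V by (simp add: add_divide_distrib power2_eq_square)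
  have "(w x)\<^sup>2 * V \<le> 2 * A + 2 * (T\<^sup>2 / V)" using 1 2 by argo
  then have "(w x)\<^sup>2 * V / V \<le> (2 * A + 2 * (T\<^sup>2 / V)) / V" using V by (intro divide_right_mono) auto
  then have 3: "(w x)\<^sup>2 \<le> 2 / V * A + 2 / V\<^sup>2 * T\<^sup>2" using V by (simp add: add_divide_distrib power2_eq_square)
  have A0: "A \<ge> 0" unfolding A_def by (intro integral_nonneg_AE AE_I2) (auto simp: indicator_def)
  have Ale: "ennreal A \<le> ennreal (r powr ?e) * (\<integral>\<^sup>+y. ennreal (\<bar>w x - w y\<bar>\<^sup>2 / norm (x - y) powr ?e) \<partial>lebesgue)"
  proof -
    have "ennreal A = (\<integral>\<^sup>+y. ennreal (?b y * (w x - w y)\<^sup>2) \<partial>lebesgue)"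
      unfolding A_def by (rule nn_integral_eq_integral[OF id, symmetric]) (auto simp: indicator_def)
    also have "\<dots> \<le> (\<integral>\<^sup>+y. ennreal (r powr ?e) * ennreal (\<bar>w x - w y\<bar>\<^sup>2 / norm (x - y) powr ?e) \<partial>lebesgue)"
    proof (rule nn_integral_mono)
      fix y
      \<comment> \<open>Inside the ball the kernel is at least r^(-N-2s); outside it, and at y = x,
        the left side is 0.\<close>
      have "?b y * (w x - w y)\<^sup>2 \<le> r powr ?e * (\<bar>w x - w y\<bar>\<^sup>2 / norm (x - y) powr ?e)"
      proof (cases "y \<in> ball x r \<and> y \<noteq> x")
        case True
        then have d: "norm (x - y) \<le> r" "norm (x - y) > 0" by (auto simp: dist_norm)
        then have "norm (x - y) powr ?e \<le> r powr ?e" using s by (intro powr_mono2) auto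
        then have "(w x - w y)\<^sup>2 * norm (x - y) powr ?e \<le> (w x - w y)\<^sup>2 * r powr ?e" by (intro mult_left_mono) auto
        then show ?thesis using True d by (simp add: pos_le_divide_eq mult.commute)
      qed (auto simp: indicator_def)
      then have "ennreal (?b y * (w x - w y)\<^sup>2) \<le> ennreal (r powr ?e * (\<bar>w x - w y\<bar>\<^sup>2 / norm (x - y) powr ?e))" by (rule ennreal_leI)
      also have "\<dots> = ennreal (r powr ?e) * ennreal (\<bar>w x - w y\<bar>\<^sup>2 / norm (x - y) powr ?e)" by (rule ennreal_mult') simp
      finally show "ennreal (?b y * (w x - w y)\<^sup>2) \<le> ennreal (r powr ?e) * ennreal (\<bar>w x - w y\<bar>\<^sup>2 / norm (x - y) powr ?e)" .
    qed
    also have "\<dots> = ennreal (r powr ?e) * (\<integral>\<^sup>+y. ennreal (\<bar>w x - w y\<bar>\<^sup>2 / norm (x - y) powr ?e) \<partial>lebesgue)"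
      by (rule nn_integral_cmult) measurable
    finally show ?thesis .
  qed
  have "ennreal ((w x)\<^sup>2) \<le> ennreal (2 / V * A + 2 / V\<^sup>2 * T\<^sup>2)" by (rule ennreal_leI[OF 3])
  also have "\<dots> = ennreal (2 / V) * ennreal A + ennreal (2 / V\<^sup>2 * T\<^sup>2)"
    using V A0 by (subst ennreal_plus) (auto simp: ennreal_mult simp del: times_divide_eq_left)
  also have "\<dots> \<le> ennreal (2 / V) * (ennreal (r powr ?e) * (\<integral>\<^sup>+y. ennreal (\<bar>w x - w y\<bar>\<^sup>2 / norm (x - y) powr ?e) \<partial>lebesgue)) + ennreal (2 / V\<^sup>2 * T\<^sup>2)"
    by (intro add_right_mono mult_left_mono Ale) auto
  also have "ennreal (2 / V) * (ennreal (r powr ?e) * (\<integral>\<^sup>+y. ennreal (\<bar>w x - w y\<bar>\<^sup>2 / norm (x - y) powr ?e) \<partial>lebesgue))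
     = ennreal (2 / V * r powr ?e) * (\<integral>\<^sup>+y. ennreal (\<bar>w x - w y\<bar>\<^sup>2 / norm (x - y) powr ?e) \<partial>lebesgue)"
    using V by (simp only: mult.assoc[symmetric] ennreal_mult' divide_nonneg_pos zero_le_numeral)
  finally show ?thesis by (simp only: T_def times_divide_eq_left)
qed

text \<open>The error K r^(2s) is uniform in n, so the radius is fixed first. For this radius the
  ball integrals tend to 0 pointwise and stay bounded, and dominated convergence finishes.\<close>

lemma weakly_null_L2:
  fixes \<Omega> :: "'a::euclidean_space set"
  assumes s: "0 < s" "s < 1" and N: "real DIM('a) > 2 * s" and \<Omega>: "open \<Omega>" "bounded \<Omega>"
    and w: "X_weakly_converges s \<Omega> w (\<lambda>_. 0)"
  shows "(\<lambda>n. \<integral>\<^sup>+x. ennreal ((w n x)\<^sup>2) \<partial>lebesgue) \<longlonglongrightarrow> 0"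
proof -
  have wX: "w n \<in> X_space s \<Omega>" for n using w by (simp add: X_weakly_converges_def)
  have wF: "\<forall>F\<in>X_dual s \<Omega>. (\<lambda>n. F (w n)) \<longlonglongrightarrow> F (\<lambda>_. 0)" using w by (simp add: X_weakly_converges_def)
  have wH: "w n \<in> Hdot s" for n using X_space_Hdot[OF wX] .
  note m[measurable] = Hdot_measurable[OF wH]
  obtain B where B: "\<And>n. seminorm_s s (w n) \<le> B" using weakly_null_bounded[OF s w] by blast
  define E where "E = B\<^sup>2"
  have E: "energy s (w n) \<le> E" for n
  proof -
    have "0 \<le> seminorm_s s (w n)" by (simp add: seminorm_s_def energy_nonneg)
    from power_mono[OF B[of n] this, of 2] show ?thesis by (simp add: seminorm_s_def E_def energy_nonneg)
  qed
  have E0: "E \<ge> 0" by (simp add: E_def)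
  obtain C where C: "C \<ge> 0" "\<And>w. w \<in> X_space s \<Omega> \<Longrightarrow> integrable lebesgue (\<lambda>x. (w x)\<^sup>2)"
    "\<And>w. w \<in> X_space s \<Omega> \<Longrightarrow> (\<integral>x. (w x)\<^sup>2 \<partial>lebesgue) \<le> C * energy s w"
    using X_space_square_integrable[OF s N \<Omega>(2)] by blast
  let ?U = "unit_ball_vol (real DIM('a))" and ?e = "real DIM('a) + 2 * s"
  have U: "?U > 0" by simp
  have c: "C_const TYPE('a) s / 2 > 0" using C_const_pos[OF s, where 'a='a] by simp
  \<comment> \<open>2 / ?U is what is left of 2 r^(N+2s) / V once r^(2s) is taken out; the other
    factors bound the \<open>gagliardo\<close> energies.\<close>
  define K where "K = 2 / ?U * (2 / C_const TYPE('a) s) * E"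
  have K: "K \<ge> 0" using E0 c by (simp add: K_def)
  have gag: "gagliardo s (w n) \<le> ennreal (2 / C_const TYPE('a) s * E)" for n
  proof -
    let ?c = "C_const TYPE('a) s / 2"
    have "gagliardo s (w n) = ennreal (1 / ?c) * (ennreal ?c * gagliardo s (w n))"
      unfolding mult.assoc[symmetric] using c by (subst ennreal_mult'[symmetric]) auto
    also have "ennreal ?c * gagliardo s (w n) = ennreal (energy s (w n))"
      unfolding ext_energy_eq[OF m, symmetric] by (rule energy_ennreal[OF s wH])
    also have "ennreal (1 / ?c) * ennreal (energy s (w n)) \<le> ennreal (1 / ?c) * ennreal E"
      by (intro mult_left_mono ennreal_leI E) auto
    also have "\<dots> = ennreal (2 / C_const TYPE('a) s * E)"
      using c by (subst ennreal_mult'[symmetric]) auto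
    finally show ?thesis .
  qed
  \<comment> \<open>The restriction to \<Omega>, possible because \<open>w n\<close> vanishes almost
    everywhere outside, provides the integrable majorant for dominated convergence.\<close>
  define Tn where "Tn r n = (\<integral>\<^sup>+x. ennreal (2 / (?U * r ^ DIM('a))\<^sup>2 * (ball_integral r (w n) x)\<^sup>2) * indicator \<Omega> x \<partial>lebesgue)" for r n
  have \<Omega>m[measurable]: "\<Omega> \<in> sets lebesgue" using \<Omega>(1) by simp
  have est: "(\<integral>\<^sup>+x. ennreal ((w n x)\<^sup>2) \<partial>lebesgue) \<le> ennreal (K * r powr (2 * s)) + Tn r n" if r: "r > 0" for r n
  proof -
    define V where "V = ?U * r ^ DIM('a)"
    have V: "V > 0" using r by (simp add: V_def)
    have z: "AE x in lebesgue. x \<notin> \<Omega> \<longrightarrow> w n x = 0" using wX[of n] by (simp add: X_space_def)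
    let ?k = "ennreal (2 * r powr ?e / V)"
    let ?J = "\<lambda>x. \<integral>\<^sup>+y. ennreal (\<bar>w n x - w n y\<bar>\<^sup>2 / norm (x - y) powr ?e) \<partial>lebesgue"
    note [measurable] = ball_integral_measurable[OF m]
    have "(\<integral>\<^sup>+x. ennreal ((w n x)\<^sup>2) \<partial>lebesgue) \<le> (\<integral>\<^sup>+x. ?k * ?J x + ennreal (2 / V\<^sup>2 * (ball_integral r (w n) x)\<^sup>2) * indicator \<Omega> x \<partial>lebesgue)"
    proof (rule nn_integral_mono_AE, use z in eventually_elim)
      fix x assume "x \<notin> \<Omega> \<longrightarrow> w n x = 0"
      then show "ennreal ((w n x)\<^sup>2) \<le> ?k * ?J x + ennreal (2 / V\<^sup>2 * (ball_integral r (w n) x)\<^sup>2) * indicator \<Omega> x"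
        using square_le_ball_average[OF s(1) r m C(2)[OF wX], of n x] unfolding V_def by (cases "x \<in> \<Omega>") auto
    qed
    also have "\<dots> = (\<integral>\<^sup>+x. ?k * ?J x \<partial>lebesgue) + Tn r n"
      unfolding Tn_def V_def[symmetric] by (rule nn_integral_add) measurable
    also have "(\<integral>\<^sup>+x. ?k * ?J x \<partial>lebesgue) = ?k * gagliardo s (w n)"
      unfolding gagliardo_def by (rule nn_integral_cmult) measurable
    also have "?k * gagliardo s (w n) \<le> ?k * ennreal (2 / C_const TYPE('a) s * E)" by (intro mult_left_mono gag) auto
    also have "\<dots> = ennreal (K * r powr (2 * s))"
    proof -
      have "r powr ?e = r ^ DIM('a) * r powr (2 * s)" using r by (simp add: powr_add powr_realpow)
      then have "2 * r powr ?e / V = 2 / ?U * r powr (2 * s)" using r U by (simp add: V_def)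
      moreover have "?k * ennreal (2 / C_const TYPE('a) s * E) = ennreal (2 * r powr ?e / V * (2 / C_const TYPE('a) s * E))"
        using V by (intro ennreal_mult'[symmetric]) auto
      ultimately show ?thesis by (simp add: K_def mult_ac)
    qed
    finally show ?thesis by (simp add: add_mono)
  qed
  have Tlim: "(\<lambda>n. Tn r n) \<longlonglongrightarrow> 0" if r: "r > 0" for r
  proof -
    define b where "b = 2 / (?U * r ^ DIM('a))\<^sup>2"
    have b: "b \<ge> 0" by (simp add: b_def)
    define D where "D = sqrt (?U * r ^ DIM('a)) * sqrt (C * E)"
    have bound: "\<bar>ball_integral r (w n) x\<bar> \<le> D" for n x
    proof -
      have "\<bar>ball_integral r (w n) x\<bar> \<le> sqrt (?U * r ^ DIM('a)) * sqrt (\<integral>x. (w n x)\<^sup>2 \<partial>lebesgue)"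
        by (rule ball_integral_bound(2)[OF r m C(2)[OF wX]])
      also have "\<dots> \<le> D"
        unfolding D_def using C(3)[OF wX, of n] mult_left_mono[OF E C(1), of n] r
        by (intro mult_left_mono real_sqrt_le_mono) auto
      finally show ?thesis .
    qed
    note [measurable] = ball_integral_measurable[OF m]
    have lim: "(\<lambda>n. ball_integral r (w n) x) \<longlonglongrightarrow> 0" for x
    proof -
      have "(\<lambda>n. ball_integral r (w n) x) \<longlonglongrightarrow> ball_integral r (\<lambda>_. 0) x"
        using bspec[OF wF ball_integral_dual[OF s N \<Omega>(2) r, of x]] .
      then show ?thesis by (simp add: ball_integral_def)
    qed
    have "(\<lambda>n. \<integral>\<^sup>+x. ennreal (b * (ball_integral r (w n) x)\<^sup>2) * indicator \<Omega> x \<partial>lebesgue) \<longlonglongrightarrow> (\<integral>\<^sup>+x. (0::ennreal) \<partial>(lebesgue :: 'a measure))"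
    proof (rule nn_integral_dominated_convergence[where w="\<lambda>x. ennreal (b * D\<^sup>2) * indicator \<Omega> x"])
      show "(\<integral>\<^sup>+x. ennreal (b * D\<^sup>2) * indicator \<Omega> x \<partial>lebesgue) < \<infinity>"
        using emeasure_bounded_finite[OF \<Omega>(2)] \<Omega>(1) by (simp add: nn_integral_cmult_indicator ennreal_mult_less_top)
      show "AE x in lebesgue. ennreal (b * (ball_integral r (w n) x)\<^sup>2) * indicator \<Omega> x \<le> ennreal (b * D\<^sup>2) * indicator \<Omega> x" for n
      proof (intro AE_I2 mult_right_mono ennreal_leI mult_left_mono b)
        fix x show "(ball_integral r (w n) x)\<^sup>2 \<le> D\<^sup>2" using power_mono[OF bound[of n x], of 2] by simp
      qed simp
      show "AE x in lebesgue. (\<lambda>n. ennreal (b * (ball_integral r (w n) x)\<^sup>2) * indicator \<Omega> x) \<longlonglongrightarrow> 0"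
      proof (rule AE_I2)
        fix x
        have "(\<lambda>n. b * (ball_integral r (w n) x)\<^sup>2) \<longlonglongrightarrow> b * 0\<^sup>2" by (intro tendsto_intros lim)
        then have "(\<lambda>n. ennreal (b * (ball_integral r (w n) x)\<^sup>2)) \<longlonglongrightarrow> ennreal 0" by (intro tendsto_ennrealI) simp
        then show "(\<lambda>n. ennreal (b * (ball_integral r (w n) x)\<^sup>2) * indicator \<Omega> x) \<longlonglongrightarrow> 0"
          by (cases "x \<in> \<Omega>") auto
      qed
    qed measurable
    then show ?thesis by (simp add: Tn_def b_def)
  qed
  show ?thesis
  proof (rule order_tendstoI)
    fix a :: ennreal assume "a < 0"
    then show "\<forall>\<^sub>F n in sequentially. a < (\<integral>\<^sup>+x. ennreal ((w n x)\<^sup>2) \<partial>lebesgue)" by simp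
  next
    fix a :: ennreal assume a: "0 < a"
    obtain \<epsilon> where \<epsilon>: "\<epsilon> > 0" "ennreal \<epsilon> < a"
    proof -
      obtain z where z: "0 < z" "z < a" using dense[OF a] by blast
      then have "z \<noteq> top" by (auto simp: top_unique dest: less_imp_le)
      then obtain \<epsilon> where "z = ennreal \<epsilon>" "\<epsilon> \<ge> 0" by (cases z) auto
      then show ?thesis using z that[of \<epsilon>] by (auto simp: ennreal_less_zero_iff)
    qed
    \<comment> \<open>\<open>K + 1\<close> because \<open>K\<close> may be 0. The radius is then
      chosen so that r^(2s) = \<delta>, which makes K r^(2s) at most \<epsilon> / 2.\<close>
    define \<delta> where "\<delta> = \<epsilon> / (2 * (K + 1))"
    have \<delta>: "\<delta> > 0" using \<epsilon> K by (simp add: \<delta>_def)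
    define r where "r = \<delta> powr (1 / (2 * s))"
    have r: "r > 0" using \<delta> by (simp add: r_def)
    have "r powr (2 * s) = \<delta>" using \<delta> s by (simp add: r_def powr_powr)
    moreover have "K * \<delta> \<le> \<epsilon> / 2" using K \<epsilon> by (simp add: \<delta>_def pos_divide_le_eq mult_left_mono)
    ultimately have Kr: "K * r powr (2 * s) \<le> \<epsilon> / 2" by simp
    have "\<forall>\<^sub>F n in sequentially. Tn r n < ennreal (\<epsilon> / 2)"
      using Tlim[OF r] \<epsilon> by (intro order_tendstoD) auto
    then show "\<forall>\<^sub>F n in sequentially. (\<integral>\<^sup>+x. ennreal ((w n x)\<^sup>2) \<partial>lebesgue) < a"
    proof eventually_elim
      case (elim n)
      have "(\<integral>\<^sup>+x. ennreal ((w n x)\<^sup>2) \<partial>lebesgue) \<le> ennreal (K * r powr (2 * s)) + Tn r n" by (rule est[OF r])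
      also have "\<dots> \<le> ennreal (\<epsilon> / 2) + ennreal (\<epsilon> / 2)" using Kr elim by (intro add_mono ennreal_leI) auto
      also have "\<dots> = ennreal \<epsilon>" using \<epsilon> by (subst ennreal_plus[symmetric]) auto
      finally show ?case using \<epsilon>(2) by simp
    qed
  qed
qed

theorem theorem1p3:
  fixes s :: real and \<Omega> :: "'a::euclidean_space set"
    and k :: nat and a :: "nat \<Rightarrow> 'a" and \<mu> :: "nat \<Rightarrow> real"
    and w :: "nat \<Rightarrow> 'a \<Rightarrow> real"
  assumes s: "0 < s" "s < 1" "real DIM('a) > 2 * s"
    and \<Omega>: "open \<Omega>" "connected \<Omega>" "bounded \<Omega>" "smooth_boundary \<Omega>"
    and k: "k \<ge> 1"
    and a: "\<forall>i\<in>{1..k}. a i \<in> \<Omega>" "inj_on a {1..k}"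
    and \<mu>: "\<forall>i\<in>{1..k}. \<mu> i \<ge> 0" "(\<Sum>i=1..k. \<mu> i) < Hardy_const TYPE('a) s"
    and w: "X_weakly_converges s \<Omega> w (\<lambda>_. 0)"
  shows "liminf (\<lambda>n. ereal (Q_form s \<Omega> k \<mu> a (w n)
           - S_star TYPE('a) s k \<mu> * (Lp_norm (crit_exp TYPE('a) s) \<Omega> (w n))\<^sup>2)) \<ge> 0"
proof -
  let ?q = "\<lambda>n. Q_form s \<Omega> k \<mu> a (w n) - S_star TYPE('a) s k \<mu> * (Lp_norm (crit_exp TYPE('a) s) \<Omega> (w n))\<^sup>2"
  let ?l = "\<lambda>n. enn2real (\<integral>\<^sup>+x. ennreal ((w n x)\<^sup>2) \<partial>lebesgue)"
  have wX: "w n \<in> X_space s \<Omega>" for n using w by (simp add: X_weakly_converges_def)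
  \<comment> \<open>One constant for the whole space, so the lower bound depends on n through the
    L^2 norms alone.\<close>
  from form_lower_bound[OF s \<Omega>(1,3) k a(2) \<mu>] obtain C where C: "\<forall>w\<in>X_space s \<Omega>.
     - (C * enn2real (\<integral>\<^sup>+x. ennreal ((w x)\<^sup>2) \<partial>lebesgue)) \<le>
     Q_form s \<Omega> k \<mu> a w - S_star TYPE('a) s k \<mu> * (Lp_norm (crit_exp TYPE('a) s) \<Omega> w)\<^sup>2"
    by (elim exE conjE) (rule that)
  have "?l \<longlonglongrightarrow> 0"
    using weakly_null_L2[OF s \<Omega>(1,3) w] tendsto_enn2real[where l=0] by simp
  then have "(\<lambda>n. - (C * ?l n)) \<longlonglongrightarrow> - (C * 0)" by (rule tendsto_minus[OF tendsto_mult_left])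
  then have "(\<lambda>n. ereal (- (C * ?l n))) \<longlonglongrightarrow> ereal 0" by simp
  then have "0 = liminf (\<lambda>n. ereal (- (C * ?l n)))"
    by (subst lim_imp_Liminf) (auto simp: zero_ereal_def)
  also have "\<dots> \<le> liminf (\<lambda>n. ereal (?q n))"
    by (intro Liminf_mono always_eventually allI ereal_less_eq(3)[THEN iffD2] C[rule_format, OF wX])
  finally show ?thesis .
qed

end
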